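(* Let $a\equiv\mathrm{Id}$ and let $\tilde\theta$ be a $d$-dimensional random checkerboard with mean $\mathbb{E}[\tilde\theta]=1$. Fix a $\gamma>1$. It is possible to construct the joint law of $(\theta^{\mathrm{stripe}},\tilde\theta)$ such that, in any dimension $d$, if $\theta(y)=\theta^{\mathrm{stripe}}(y_1)\tilde\theta(y)$ for $y=(y_1,\dots,y_d)\in\mathbb{R}^d$ and the scale $\epsilon\mapsto\delta(\epsilon)>0$ is chosen so that both $\epsilon^{-1}\delta(\epsilon)\to0$ as $\epsilon\to0$ and $$\liminf_{\epsilon\downarrow0}\epsilon^{-\gamma}\delta(\epsilon)>0,$$ then, for any $\varrho>0$, $$\liminf_{\epsilon\downarrow0}\varrho^{-(d-1)}\sigma_{\epsilon,\delta(\epsilon)}(e_1;[-\varrho/2,\varrho/2]^d)\le\sigma_W\sqrt{\theta^{\mathrm{stripe}}_*}<\bar\sigma(e_1)$$ in probability, where $\theta^{\mathrm{stripe}}_*$ is the essential infimum of $\theta^{\mathrm{stripe}}$.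
   Context: Let $W:\mathbb{R}\to[0,\infty)$ be continuous with zeros precisely at $-1$ and $1$, and let $\sigma_W=\int_{-1}^1\sqrt{2W(u)}\,du$. A $d$-dimensional random checkerboard is $\tilde\theta(x)=\sum_{z\in\mathbb{Z}^d}\tilde\Theta_z\mathbf{1}_{z+(-1/2,1/2)^d}(x)$ with $\{\tilde\Theta_z\}_{z\in\mathbb{Z}^d}$ i.i.d. random variables bounded between two positive constants. The field $\theta^{\mathrm{stripe}}$ is a stationary ergodic random field on $\mathbb{R}$ bounded between two positive constants; as for the checkerboard, stationarity and ergodicity may be understood with respect to integer translations. For $\epsilon,\delta>0$ and $U\subseteq\mathbb{R}^d$, $$\mathscr{F}_{\epsilon,\delta}(u;U)=\int_U\Big(\frac\epsilon2|\nabla u|^2+\frac1\epsilon\theta(\delta^{-1}x)W(u)\Big)dx,$$ which is the energy with gradient coefficient $a\equiv\mathrm{Id}$. Fix an arbitrary smooth $q:\mathbb{R}\to[-1,1]$ with $q(\infty)=1$, $q(-\infty)=-1$. With $e_1=(1,0,\dots,0)$ and $Q=[-\varrho/2,\varrho/2]^d$, the finite-volume surface tension is $$\sigma_{\epsilon,\delta}(e_1;Q)=\min\{\mathscr{F}_{\epsilon,\delta}(u;Q)\mid u(x)=q(\epsilon^{-1}x\cdot e_1)\text{ for }x\in\partial Q\}.$$ Finally $\bar\sigma(e_1)=\sigma_W\sqrt{\bar\theta}$ with $\bar\theta=\mathbb{E}[\theta(0)]$ the mean of $\theta$.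
   Formalization: The smooth profile q is additionally assumed to have bounded derivative; for d ≥ 2 the claim fails for some wildly oscillating q, e.g. q(s)=1-(1+sin(exp(s^2)))/(2s) for large s, since the boundary datum on the lateral faces makes the surface tension tend to infinity. *)

theory Defs
  imports "HOL-Probability.Probability"
begin

definition double_well :: "(real \<Rightarrow> real) \<Rightarrow> bool" where
  "double_well W \<longleftrightarrow> continuous_on UNIV W \<and> (\<forall>u. 0 \<le> W u) \<and> (\<forall>u. W u = 0 \<longleftrightarrow> u = -1 \<or> u = 1)"

definition sigma_W :: "(real \<Rightarrow> real) \<Rightarrow> real" where
  "sigma_W W = integral {-1..1} (\<lambda>u. sqrt (2 * W u))"

text \<open>
  The bound on the derivative cannot be dropped in dimension at least 2. The datum is prescribed on
  the lateral faces of the cube as well, and for a smooth profile whose oscillations near infinity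
  get arbitrarily fast, such as \<open>1 - (1 + sin (exp (s^2))) / (2 * s)\<close> for large \<open>s\<close>, the
  \<open>H^{1/2}\<close> norm of the rescaled datum, and with it the surface tension, is unbounded
  as \<open>\<epsilon>\<close> tends to 0.
\<close>

definition boundary_profile :: "(real \<Rightarrow> real) \<Rightarrow> bool" where
  "boundary_profile q \<longleftrightarrow>
     (\<forall>k x. ((deriv ^^ k) q) differentiable (at x)) \<and> bounded (range (deriv q)) \<and>
     range q \<subseteq> {-1..1} \<and> (q \<longlongrightarrow> 1) at_top \<and> (q \<longlongrightarrow> -1) at_bot"

definition C1_with_gradient ::
    "((real^'d) \<Rightarrow> real) \<Rightarrow> ((real^'d) \<Rightarrow> (real^'d)) \<Rightarrow> bool" where
  "C1_with_gradient f Df \<longleftrightarrow>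
     (\<forall>x. (f has_derivative (\<lambda>h. Df x \<bullet> h)) (at x)) \<and> continuous_on UNIV Df"

definition C1_compact_support ::
    "(real^'d) set \<Rightarrow> ((real^'d) \<Rightarrow> real) \<Rightarrow> ((real^'d) \<Rightarrow> (real^'d)) \<Rightarrow> bool" where
  "C1_compact_support U \<phi> D\<phi> \<longleftrightarrow>
     C1_with_gradient \<phi> D\<phi> \<and> (\<exists>K. compact K \<and> K \<subseteq> U \<and> (\<forall>x. x \<notin> K \<longrightarrow> \<phi> x = 0))"

text \<open>
  For an open set \<open>U\<close>, \<open>H10 U v g\<close> says that \<open>v\<close> lies in the Sobolev space \<open>H^1_0(U)\<close>, the closure
  of the compactly supported C1 functions in the \<open>H^1\<close> norm, and that \<open>g\<close> is its gradient; \<open>g\<close> is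
  determined by \<open>v\<close> almost everywhere in \<open>U\<close>, because the gradient is closable.
\<close>

definition H10 :: "(real^'d) set \<Rightarrow> ((real^'d) \<Rightarrow> real) \<Rightarrow> ((real^'d) \<Rightarrow> (real^'d)) \<Rightarrow> bool" where
  "H10 U v g \<longleftrightarrow>
     v \<in> borel_measurable borel \<and> g \<in> borel_measurable borel \<and>
     (\<exists>\<phi> D\<phi>. (\<forall>n::nat. C1_compact_support U (\<phi> n) (D\<phi> n)) \<and>
        (\<lambda>n. \<integral>\<^sup>+x\<in>U. ennreal ((\<phi> n x - v x)\<^sup>2) \<partial>lborel) \<longlonglongrightarrow> 0 \<and>
        (\<lambda>n. \<integral>\<^sup>+x\<in>U. ennreal ((norm (D\<phi> n x - g x))\<^sup>2) \<partial>lborel) \<longlonglongrightarrow> 0)"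

text \<open>
  Pairs of a function \<open>u\<close> and its gradient, where \<open>u\<close> lies in \<open>w + H^1_0(U)\<close>; these are the
  \<open>H^1\<close> functions with trace \<open>w\<close> on the boundary.
\<close>

definition dirichlet_class ::
    "(real^'d) set \<Rightarrow> ((real^'d) \<Rightarrow> real) \<Rightarrow> (((real^'d) \<Rightarrow> real) \<times> ((real^'d) \<Rightarrow> (real^'d))) set" where
  "dirichlet_class U w =
     {(u, g). \<exists>Dw v h. C1_with_gradient w Dw \<and> H10 U v h \<and>
        u = (\<lambda>x. w x + v x) \<and> g = (\<lambda>x. Dw x + h x)}"

text \<open>
  The energy takes values in \<open>[0, \<infinity>]\<close>: \<open>W\<close> has no growth condition, so \<open>W \<circ> u\<close> need not be
  integrable.
\<close>

definition energy ::
    "(real \<Rightarrow> real) \<Rightarrow> ((real^'d) \<Rightarrow> real) \<Rightarrow> real \<Rightarrow> real \<Rightarrow> (real^'d) set \<Rightarrow>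
     ((real^'d) \<Rightarrow> real) \<Rightarrow> ((real^'d) \<Rightarrow> (real^'d)) \<Rightarrow> ennreal" where
  "energy W \<theta> \<epsilon> \<delta> U u g =
     (\<integral>\<^sup>+x\<in>U. ennreal (\<epsilon> / 2 * (norm (g x))\<^sup>2 + 1 / \<epsilon> * \<theta> ((1 / \<delta>) *\<^sub>R x) * W (u x)) \<partial>lborel)"

definition surface_tension ::
    "(real \<Rightarrow> real) \<Rightarrow> (real \<Rightarrow> real) \<Rightarrow> ((real^'d) \<Rightarrow> real) \<Rightarrow> real \<Rightarrow> real \<Rightarrow> (real^'d) \<Rightarrow>
     (real^'d) set \<Rightarrow> ennreal" where
  "surface_tension W q \<theta> \<epsilon> \<delta> e Q =
     (INF (u, g) \<in> dirichlet_class (interior Q) (\<lambda>x. q ((x \<bullet> e) / \<epsilon>)). energy W \<theta> \<epsilon> \<delta> Q u g)"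

definition cube :: "real \<Rightarrow> (real^'d) set" where
  "cube \<rho> = cbox (\<chi> i. - \<rho> / 2) (\<chi> i. \<rho> / 2)"

definition random_checkerboard :: "'w measure \<Rightarrow> (int^'d \<Rightarrow> 'w \<Rightarrow> real) \<Rightarrow> bool" where
  "random_checkerboard M \<Theta> \<longleftrightarrow>
     prob_space M \<and>
     prob_space.indep_vars M (\<lambda>_. borel) \<Theta> UNIV \<and>
     (\<forall>z z'. distr M borel (\<Theta> z) = distr M borel (\<Theta> z')) \<and>
     (\<exists>a b. 0 < a \<and> (\<forall>z. AE \<omega> in M. a \<le> \<Theta> z \<omega> \<and> \<Theta> z \<omega> \<le> b))"

definition checkerboard_field :: "(int^'d \<Rightarrow> 'w \<Rightarrow> real) \<Rightarrow> (real^'d) \<Rightarrow> 'w \<Rightarrow> real" where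
  "checkerboard_field \<Theta> x \<omega> =
     (\<Sum>\<^sub>\<infinity>z. \<Theta> z \<omega> *
        indicator (box (\<chi> i. of_int (z $ i) - 1 / 2) (\<chi> i. of_int (z $ i) + 1 / 2)) x)"

text \<open>
  Ergodicity is stated with strictly invariant events; for a countable group of translations this is
  equivalent to the version with events invariant up to null sets.
\<close>

definition stationary_ergodic_field :: "'w measure \<Rightarrow> (real \<Rightarrow> 'w \<Rightarrow> real) \<Rightarrow> bool" where
  "stationary_ergodic_field M S \<longleftrightarrow>
     prob_space M \<and>
     case_prod S \<in> borel_measurable (borel \<Otimes>\<^sub>M M) \<and>
     (\<exists>a b. 0 < a \<and> (AE \<omega> in M. \<forall>x. a \<le> S x \<omega> \<and> S x \<omega> \<le> b)) \<and>
     (\<forall>k::int. distr M (PiM UNIV (\<lambda>_. borel)) (\<lambda>\<omega> x. S (x + of_int k) \<omega>) =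
               distr M (PiM UNIV (\<lambda>_. borel)) (\<lambda>\<omega> x. S x \<omega>)) \<and>
     (\<forall>A \<in> sets (PiM UNIV (\<lambda>_. borel)).
        (\<forall>(k::int) f. (\<lambda>x. f (x + of_int k)) \<in> A \<longleftrightarrow> f \<in> A) \<longrightarrow>
        measure M {\<omega> \<in> space M. (\<lambda>x. S x \<omega>) \<in> A} \<in> {0, 1})"

definition ess_inf_field :: "'w measure \<Rightarrow> (real \<Rightarrow> 'w \<Rightarrow> real) \<Rightarrow> real" where
  "ess_inf_field M S = real_of_ereal (- esssup (lborel \<Otimes>\<^sub>M M) (\<lambda>(x, \<omega>). - ereal (S x \<omega>)))"

definition product_field ::
    "'d \<Rightarrow> (real \<Rightarrow> 'w \<Rightarrow> real) \<Rightarrow> (int^'d \<Rightarrow> 'w \<Rightarrow> real) \<Rightarrow> (real^'d) \<Rightarrow> 'w \<Rightarrow> real" where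
  "product_field i S \<Theta> y \<omega> = S (y $ i) \<omega> * checkerboard_field \<Theta> y \<omega>"

definition field_mean :: "'w measure \<Rightarrow> ((real^'d) \<Rightarrow> 'w \<Rightarrow> real) \<Rightarrow> real" where
  "field_mean M \<theta> = prob_space.expectation M (\<theta> 0)"

text \<open>
  Stationarity under integer translations alone leaves open that the one-point mean varies within
  the unit cell, in which case the mean at the origin would not be the mean of the field; the next
  condition excludes this. It is automatic under stationarity with respect to all translations.
\<close>

definition mean_homogeneous :: "'w measure \<Rightarrow> ((real^'d) \<Rightarrow> 'w \<Rightarrow> real) \<Rightarrow> bool" where
  "mean_homogeneous M \<theta> \<longleftrightarrow>
     (AE y in lborel. prob_space.expectation M (\<theta> y) = field_mean M \<theta>)"

definition sigma_bar ::
    "(real \<Rightarrow> real) \<Rightarrow> 'w measure \<Rightarrow> ((real^'d) \<Rightarrow> 'w \<Rightarrow> real) \<Rightarrow> real" where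
  "sigma_bar W M \<theta> = sigma_W W * sqrt (field_mean M \<theta>)"

text \<open>
  A family \<open>X \<epsilon>\<close> is asymptotically at most \<open>c\<close> in probability if \<open>P (X \<epsilon> \<le> c + \<eta>)\<close> tends to 1 for
  every \<open>\<eta> > 0\<close>. In particular the lower limit of \<open>X \<epsilon>\<close> is then at most \<open>c\<close> almost surely. The
  condition is phrased with probabilities tending to 1, and not with those of the complements
  tending to 0, because \<open>measure\<close> vanishes on sets that are not measurable.
\<close>

definition asymptotically_le_in_prob ::
    "'w measure \<Rightarrow> (real \<Rightarrow> 'w \<Rightarrow> ennreal) \<Rightarrow> real \<Rightarrow> bool" where
  "asymptotically_le_in_prob M X c \<longleftrightarrow>
     (\<forall>\<eta>>0. ((\<lambda>\<epsilon>. measure M {\<omega> \<in> space M. X \<epsilon> \<omega> \<le> ennreal (c + \<eta>)}) \<longlongrightarrow> 1) (at_right 0))"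

end

theory Submission
  imports Defs "HOL-Real_Asymp.Real_Asymp"
begin

text \<open>
  The stripe field takes the values 1 and 2. It is driven by independent uniform variables at the
  integers: the site \<open>k\<close> switches the field to 1 on the cells at distance \<open>l\<close> from \<open>k\<close> if its
  variable is below a multiple of \<open>(1 + l) powr - (1 + 1 / \<gamma>)\<close>. This is summable with small sum, so the
  mean exceeds the essential infimum 1; but the tail is so heavy that among the \<open>1 / \<delta>\<close> cells near
  the origin there is, with probability tending to 1, a run of ones longer than any multiple of
  \<open>\<epsilon> / \<delta>\<close>. Independently of it the checkerboard has the given law.

  An optimal one-dimensional transition placed inside such a run does not feel the value 2, while
  the checkerboard averages out there because its cells are small compared to \<open>\<epsilon>\<close>. The boundary datum is
  restored in a layer of width \<open>\<kappa> \<epsilon>\<close>, whose cost tends to 0 if first \<open>\<epsilon>\<close> and then \<open>\<kappa>\<close> tends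
  to 0, as the run is located near the origin.
\<close>

section \<open>Optimal profiles\<close>

text \<open>Three competing costs fix the order of the parameters. In a layer of width \<kappa>
  \<epsilon> the cutoff has gradient of order 1 / (\<kappa> \<epsilon>). Where the distance to the
  midplane is at most r, profile and datum may differ by an amount of order 1, which costs order r /
  \<kappa>; elsewhere they differ by at most \<tau>, which costs order \<tau>^2 / \<kappa>; the
  layer itself costs order \<kappa>. So \<kappa> is fixed before r and \<tau>, and the run has to be
  found among the sites k with \<delta> |k| \<le> r / 2 for an arbitrarily small but fixed r. The
  position of the run is a function of the stripe field alone. Once it is frozen, the checkerboard
  is integrated against a deterministic weight of size 1 / \<epsilon>, and the variance is of order
  \<delta>^d / \<epsilon>. The lower bounds on probabilities are meaningful only for measurable
  events, since \<open>measure\<close> vanishes elsewhere, so the infimum over the uncountable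
  Dirichlet class has to be shown measurable. Competitors are kept C1, which makes membership in the
  Dirichlet class immediate; hence the transition and the cutoffs are quadratic splines built from
  \<open>pos_sq\<close>.\<close>

definition pos_sq :: "real \<Rightarrow> real" where
  "pos_sq t = (max 0 t)\<^sup>2"

lemma DERIV_pos_sq: "(pos_sq has_real_derivative 2 * max 0 t) (at t)"
proof (cases t "0::real" rule: linorder_cases)
  case less
  have "((\<lambda>_::real. 0::real) has_real_derivative 2 * max 0 t) (at t)" using less by simp
  moreover have "\<forall>\<^sub>F x in nhds t. (\<lambda>_. 0) x = pos_sq x"
    using eventually_nhds_in_open[of "{..<0}" t] less
    by (auto elim!: eventually_mono simp: pos_sq_def)
  ultimately show ?thesis by (rule DERIV_cong_ev[OF refl _ refl, THEN iffD1, rotated])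
next
  case greater
  have "((\<lambda>x::real. x\<^sup>2) has_real_derivative 2 * max 0 t) (at t)"
    using greater by (auto intro!: derivative_eq_intros)
  moreover have "\<forall>\<^sub>F x in nhds t. x\<^sup>2 = pos_sq x"
    using eventually_nhds_in_open[of "{0<..}" t] greater
    by (auto elim!: eventually_mono simp: pos_sq_def)
  ultimately show ?thesis by (rule DERIV_cong_ev[OF refl _ refl, THEN iffD1, rotated])
next
  case equal
  have "((\<lambda>h. max 0 h) \<longlongrightarrow> max 0 0) (at (0::real))"
    by (intro tendsto_intros)
  moreover have "pos_sq h / h = max 0 h" for h
    by (auto simp: pos_sq_def max_def power2_eq_square)
  ultimately show ?thesis using equal by (simp add: DERIV_def pos_sq_def[of 0])
qed

lemmas DERIV_pos_sq_chain [derivative_intros] = DERIV_chain2[OF DERIV_pos_sq]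

text \<open>A second difference of \<open>pos_sq\<close>: a C1 step from -1 to 1 whose derivative is
  the hat function of height 2 on [-1, 1].\<close>

definition ramp :: "real \<Rightarrow> real" where
  "ramp t = pos_sq (t + 1) - 2 * pos_sq t + pos_sq (t - 1) - 1"

definition ramp' :: "real \<Rightarrow> real" where
  "ramp' t = 2 * max 0 (t + 1) - 4 * max 0 t + 2 * max 0 (t - 1)"

lemma DERIV_ramp: "(ramp has_real_derivative ramp' t) (at t)"
  unfolding ramp_def ramp'_def by (auto intro!: derivative_eq_intros)

lemma continuous_ramp' [continuous_intros]: "continuous_on S f \<Longrightarrow> continuous_on S (\<lambda>x. ramp' (f x))"
  unfolding ramp'_def by (intro continuous_intros)

lemma continuous_ramp [continuous_intros]: "continuous_on S f \<Longrightarrow> continuous_on S (\<lambda>x. ramp (f x))"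
  unfolding ramp_def pos_sq_def by (intro continuous_intros)

lemma ramp'_nonneg: "0 \<le> ramp' t"
  unfolding ramp'_def by (auto simp: max_def)

lemma ramp_le: "t \<le> -1 \<Longrightarrow> ramp t = -1" "t \<le> -1 \<Longrightarrow> ramp' t = 0"
  unfolding ramp_def ramp'_def pos_sq_def by (auto simp: max_def)

lemma ramp_ge: "t \<ge> 1 \<Longrightarrow> ramp t = 1" "t \<ge> 1 \<Longrightarrow> ramp' t = 0"
  unfolding ramp_def ramp'_def pos_sq_def
  by (auto simp: max_def power2_eq_square algebra_simps)

lemma ramp_mono: "s \<le> t \<Longrightarrow> ramp s \<le> ramp t"
  by (rule DERIV_nonneg_imp_nondecreasing) (use DERIV_ramp ramp'_nonneg in blast)+

lemma ramp_range: "-1 \<le> ramp t" "ramp t \<le> 1"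
  using ramp_mono[of "min t (-1)" t] ramp_mono[of t "max t 1"]
    ramp_le(1)[of "min t (-1)"] ramp_ge(1)[of "max t 1"] by auto

text \<open>Separation of variables: the inverse of a primitive of \<open>G\<close> solves f' = 1 /
  G(f). No Lipschitz condition enters, which matters because \<open>W\<close>, and with it the
  \<open>G\<close> used below, is merely continuous. The lower bound \<open>c\<close> makes the
  primitive grow at least linearly, so the solution is global.\<close>

lemma positive_continuous_primitive_inverse:
  fixes G :: "real \<Rightarrow> real"
  assumes cont: "continuous_on UNIV G" and c: "0 < c" "\<And>x. c \<le> G x"
  obtains T f where "\<And>x. f (T x) = x" "\<And>s. T (f s) = s" "strict_mono T" "strict_mono f"
    "\<And>s. (f has_real_derivative inverse (G (f s))) (at s)"
proof -
  define T where "T x = (if x \<ge> 0 then integral {0..x} G else - integral {x..0} G)" for x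
  \<comment> \<open>A fixed base point -n turns the two cases of \<open>T\<close> into one formula
    near any given point, to which the fundamental theorem applies.\<close>
  have T_eq: "T y = integral {-n..y} G - integral {-n..0} G" if "y \<in> {-n..n}" for n y
  proof -
    have int: "G integrable_on {a..b}" for a b
      by (intro integrable_continuous_real continuous_on_subset[OF cont]) auto
    show ?thesis
    proof (cases "y \<ge> 0")
      case True
      then show ?thesis using Henstock_Kurzweil_Integration.integral_combine[of "-n" 0 y G] int that
        by (auto simp: T_def)
    next
      case False
      then show ?thesis using Henstock_Kurzweil_Integration.integral_combine[of "-n" y 0 G] int that
        by (auto simp: T_def)
    qed
  qed
  have T': "(T has_real_derivative G x) (at x)" for x
  proof -
    define n where "n = \<bar>x\<bar> + 1"
    have "((\<lambda>y. integral {-n..y} G) has_real_derivative G x) (at x within {-n..n})"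
      by (rule integral_has_real_derivative) (use continuous_on_subset[OF cont] n_def in auto)
    then have "((\<lambda>y. integral {-n..y} G - integral {-n..0} G) has_real_derivative G x) (at x within {-n..n})"
      by (auto intro!: derivative_eq_intros)
    then have "((\<lambda>y. integral {-n..y} G - integral {-n..0} G) has_real_derivative G x) (at x)"
      by (subst (asm) at_within_interior) (auto simp: n_def)
    then show ?thesis
    proof (rule has_field_derivative_transform_within_open[of _ _ _ "{-n<..<n}"])
      fix y assume "y \<in> {-n<..<n}"
      then show "integral {-n..y} G - integral {-n..0} G = T y" using T_eq[of y n] by auto
    qed (auto simp: n_def)
  qed
  have T_lower: "c * (y - x) \<le> T y - T x" if "x \<le> y" for x y
  proof (cases "x < y")
    case True
    obtain z where "T y - T x = (y - x) * G z"
      using MVT2[OF True, of T G] T' by auto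
    then show ?thesis using c(2)[of z] that by (simp add: mult.commute[of "y - x"] mult_right_mono)
  qed (use that in auto)
  have mono: "strict_mono T"
  proof (rule strict_monoI)
    fix x y :: real assume "x < y"
    then have "0 < c * (y - x)" using c by simp
    then show "T x < T y" using T_lower[of x y] \<open>x < y\<close> by linarith
  qed
  have T0: "T 0 = 0" by (simp add: T_def)
  have contT: "isCont T x" for x using T' DERIV_isCont by blast
  have surj: "\<exists>x. T x = s" for s
  proof -
    define a where "a = \<bar>s\<bar> / c"
    have a: "0 \<le> a" "c * a = \<bar>s\<bar>" using c by (auto simp: a_def)
    have "T (-a) \<le> s" "s \<le> T a" using T_lower[of 0 a] T_lower[of "-a" 0] a T0 by auto
    then show ?thesis using IVT[of T "-a" s a] contT a by fastforce
  qed
  define f where "f s = (SOME x. T x = s)" for s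
  have Tf: "T (f s) = s" for s unfolding f_def using someI_ex[OF surj] .
  have fT: "f (T x) = x" for x using Tf[of "T x"] strict_mono_eq[OF mono] by blast
  have contf: "isCont f s" for s
    using isCont_inverse_function[of 1 "f s" f T] fT contT Tf by simp
  have f': "(f has_real_derivative inverse (G (f s))) (at s)" for s
    by (rule DERIV_inverse_function[where f = T and a = "s - 1" and b = "s + 1"])
       (use T' Tf contf c(1) c(2)[of "f s"] in auto)
  have "strict_mono f"
    using Tf strict_mono_less[OF mono] by (intro strict_monoI) metis
  with that fT Tf mono f' show ?thesis by blast
qed

lemma double_wellD:
  assumes "double_well W"
  shows "continuous_on UNIV W" "0 \<le> W u" "W u = 0 \<longleftrightarrow> u = -1 \<or> u = 1"
  using assms unfolding double_well_def by auto

lemma double_well_bounded: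
  assumes "double_well W"
  obtains m where "0 < m" "\<And>u. \<bar>u\<bar> \<le> 1 \<Longrightarrow> W u \<le> m"
proof -
  have "compact (W ` {-1..1})"
    by (intro compact_continuous_image continuous_on_subset[OF double_wellD(1)[OF assms]]) auto
  then have "bounded (W ` {-1..1})" by (rule compact_imp_bounded)
  then obtain m where "\<forall>y\<in>W ` {-1..1}. \<bar>y\<bar> \<le> m" by (auto simp: bounded_real)
  then have "W u \<le> m" if "\<bar>u\<bar> \<le> 1" for u
    using that abs_le_iff[of u 1] abs_le_iff[of "W u" m] by (simp add: image_iff Bex_def)
  then have "W u \<le> max 1 m" if "\<bar>u\<bar> \<le> 1" for u
    using that by (meson max.coboundedI2)
  then show ?thesis by (intro that[of "max 1 m"]) auto
qed

text \<open>
  The equipartition equation \<open>P' = \<surd>(2 W \<circ> P)\<close> degenerates at the wells. Writing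
  \<open>P = ramp \<circ> f\<close> and solving for the reparametrisation \<open>f\<close> instead makes it a regular equation,
  after adding a small \<open>z\<close> to both the numerator and the denominator, and gives a
  \<open>C\<^sup>1\<close> profile that reaches the wells in finite time.
\<close>

lemma optimal_profile:
  assumes W: "double_well W" and eta: "\<eta> > 0"
  obtains P P' a b where "a \<le> b" "\<And>s. (P has_real_derivative P' s) (at s)" "continuous_on UNIV P'"
    "\<And>s. -1 \<le> P s \<and> P s \<le> 1" "\<And>s. s \<le> a \<Longrightarrow> P s = -1" "\<And>s. b \<le> s \<Longrightarrow> P s = 1"
    "\<And>s. s \<notin> {a..b} \<Longrightarrow> P' s = 0"
    "integral {a..b} (\<lambda>s. (P' s)\<^sup>2 / 2 + W (P s)) \<le> sigma_W W + \<eta>"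
proof -
  note Wc = double_wellD(1)[OF W] and W0 = double_wellD(2)[OF W] and Wz = double_wellD(3)[OF W]
  obtain m where m: "0 < m" "\<And>u. \<bar>u\<bar> \<le> 1 \<Longrightarrow> W u \<le> m" using double_well_bounded[OF W] by blast
  define r where "r = (\<lambda>u. sqrt (2 * W u))"
  define k where "k = sqrt (2 * m)"
  have k: "0 < k" using m by (simp add: k_def)
  have r0: "0 \<le> r u" for u by (simp add: r_def W0)
  have rc: "continuous_on S r" for S
    unfolding r_def by (intro continuous_intros continuous_on_subset[OF Wc]) auto
  have rk: "r (ramp t) \<le> k" for t
    using m(2)[of "ramp t"] ramp_range[of t] by (simp add: r_def k_def)
  \<comment> \<open>The regularisation costs z * (1 + k) in total: \<open>P\<close> and
    \<open>f\<close> both increase by 2 across the transition, and they enter \<open>H\<close> below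
    with the weights z / 2 and z / 2 * k.\<close>
  define z where "z = \<eta> / (1 + k)"
  have z: "0 < z" "z * (1 + k) = \<eta>" using eta k by (auto simp: z_def)
  define G where "G t = (ramp' t + z) / (r (ramp t) + z)" for t
  have rz: "0 < r u + z" for u using r0[of u] z by linarith
  have hz: "0 < ramp' t + z" for t using ramp'_nonneg[of t] z by linarith
  have Gc: "continuous_on UNIV G"
    unfolding G_def using rz
    by (intro continuous_intros continuous_on_compose2[OF rc]) (auto simp: less_imp_neq[symmetric] intro: less_imp_neq[OF rz, symmetric])
  have Glow: "z / (k + z) \<le> G t" for t
    unfolding G_def using rk[of t] rz[of "ramp t"] ramp'_nonneg[of t] z
    by (intro frac_le) auto
  have Gpos: "0 < G t" for t using rz hz by (simp add: G_def)
  obtain T f where f: "\<And>x. f (T x) = x" "\<And>s. T (f s) = s" "strict_mono T" "strict_mono f"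
    "\<And>s. (f has_real_derivative inverse (G (f s))) (at s)"
    by (rule positive_continuous_primitive_inverse[OF Gc _ Glow]) (use z k in auto)
  have fc: "continuous_on UNIV f" using f(5) by (intro DERIV_continuous_on) (auto intro: has_field_derivative_at_within)
  define P where "P s = ramp (f s)" for s
  define P' where "P' s = ramp' (f s) * inverse (G (f s))" for s
  define S where "S v = integral {-1..v} r" for v
  have S': "(S has_real_derivative r v) (at v within {-1..1})" if "v \<in> {-1..1}" for v
    unfolding S_def by (rule integral_has_real_derivative[OF rc that])
  \<comment> \<open>An explicit primitive of an upper bound for the energy density. Its first term
    contributes exactly \<open>sigma_W W\<close>, by the change of variables u = P s; the other two
    collect the error.\<close>
  define H where "H s = S (P s) + z / 2 * P s + z / 2 * k * f s" for s
  define H' where "H' s = r (P s) * P' s + z / 2 * P' s + z / 2 * k * inverse (G (f s))" for s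
  have PD: "(P has_real_derivative P' s) (at s)" for s
    unfolding P_def P'_def by (rule DERIV_chain2[OF DERIV_ramp f(5)])
  have Pr: "-1 \<le> P s \<and> P s \<le> 1" for s unfolding P_def using ramp_range by auto
  have invG: "continuous_on UNIV (\<lambda>s. inverse (G (f s)))"
    using Gpos by (intro continuous_intros continuous_on_compose2[OF Gc fc] ballI less_imp_neq[OF Gpos, symmetric]) auto
  have P'c: "continuous_on UNIV P'" unfolding P'_def by (intro continuous_intros fc invG)
  have Pc: "continuous_on UNIV P" unfolding P_def by (intro continuous_intros fc)
  have bound: "(P' s)\<^sup>2 / 2 + W (P s) \<le> H' s" for s
  proof -
    define h g w where "h = ramp' (f s)" and "g = G (f s)" and "w = r (P s)"
    have hg: "0 \<le> h" "0 < g" "0 \<le> w" "w \<le> k" "g = (h + z) / (w + z)"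
      unfolding h_def g_def w_def using ramp'_nonneg Gpos r0 rk by (auto simp: G_def P_def)
    have Ww: "W (P s) = w\<^sup>2 / 2" unfolding w_def r_def using W0 by simp
    have gw: "g * (w + z) = h + z" using hg z by simp
    have "h * inverse g = h * (w + z) / (h + z)" using hg(5) by simp
    also have "\<dots> \<le> w + z"
      using hg z by (simp add: divide_le_eq mult.commute mult_left_mono mult_nonneg_nonneg)
    finally have p1: "P' s \<le> w + z" unfolding P'_def h_def g_def .
    have p0: "0 \<le> P' s" unfolding P'_def using ramp'_nonneg Gpos[of "f s"] by auto
    have "(P' s)\<^sup>2 / 2 \<le> P' s * (w + z) / 2"
      using mult_left_mono[OF p1 p0] by (simp add: power2_eq_square)
    \<comment> \<open>By the choice of \<open>G\<close>, P' + z / g = w + z; hence w \<le> P' + z /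
      g, and this is multiplied by w / 2.\<close>
    moreover have "w\<^sup>2 / 2 \<le> w / 2 * P' s + w * z / 2 * inverse g"
    proof -
      have "(h + z) * inverse g = w + z" using hg(2) by (simp flip: gw)
      then have "w \<le> (h + z) * inverse g" using z by simp
      then have "w / 2 * w \<le> w / 2 * ((h + z) * inverse g)" using hg by (intro mult_left_mono) auto
      then show ?thesis unfolding P'_def h_def g_def by (simp add: power2_eq_square algebra_simps)
    qed
    moreover have "w * z / 2 * inverse g \<le> z / 2 * k * inverse g"
      using hg z by (intro mult_right_mono) (auto simp: mult.commute)
    ultimately show ?thesis unfolding H'_def Ww g_def[symmetric] w_def[symmetric]
      by (simp add: algebra_simps add_divide_distrib)
  qed
  have HD: "(H has_real_derivative H' s) (at s)" for s
  proof -
    have "((\<lambda>s. S (P s)) has_real_derivative r (P s) * P' s) (at s)"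
    proof -
      \<comment> \<open>\<open>S\<close> is differentiable only relative to [-1, 1], while
        \<open>P\<close> reaches both ends; the chain rule relative to the image of \<open>P\<close>
        covers this.\<close>
      have "(S has_real_derivative r (P s)) (at (P s) within range P)"
        by (rule has_field_derivative_subset[OF S']) (use Pr in auto)
      from DERIV_image_chain[OF this PD] show ?thesis by (simp add: o_def)
    qed
    then show ?thesis unfolding H_def H'_def
      by (auto intro!: derivative_eq_intros PD f(5))
  qed
  define a b where "a = T (-1)" and "b = T 1"
  have ab: "a < b" unfolding a_def b_def using strict_mono_less[OF f(3)] by simp
  have fa: "f s \<le> -1" if "s \<le> a" for s
    using strict_mono_less_eq[OF f(4), of s a] that f(1) by (simp add: a_def)
  have fb: "1 \<le> f s" if "b \<le> s" for s
    using strict_mono_less_eq[OF f(4), of b s] that f(1) by (simp add: b_def)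
  have "integral {a..b} (\<lambda>s. (P' s)\<^sup>2 / 2 + W (P s)) \<le> H b - H a"
  proof -
    have "(H' has_integral (H b - H a)) {a..b}"
      using ab HD by (intro fundamental_theorem_of_calculus)
        (auto simp: has_real_derivative_iff_has_vector_derivative[symmetric] intro: has_field_derivative_at_within)
    moreover have "(\<lambda>s. (P' s)\<^sup>2 / 2 + W (P s)) integrable_on {a..b}"
      by (intro integrable_continuous_real continuous_intros continuous_on_subset[OF P'c]
          continuous_on_compose2[OF Wc continuous_on_subset[OF Pc]]) auto
    ultimately show ?thesis
      using has_integral_le[OF integrable_integral] bound by blast
  qed
  also have "H b - H a = sigma_W W + \<eta>"
  proof -
    have "P b = 1" "P a = -1" "f a = -1" "f b = 1"
      using fa[of a] fb[of b] ramp_le ramp_ge f(1) by (auto simp: P_def a_def b_def)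
    moreover have "S 1 = sigma_W W" "S (-1) = 0" unfolding S_def sigma_W_def r_def by auto
    ultimately show ?thesis unfolding H_def using z by (simp add: algebra_simps)
  qed
  finally show ?thesis
    by (intro that[of a b P P']) (use ab PD P'c Pr fa fb ramp_le ramp_ge in \<open>auto simp: P_def P'_def\<close>)
qed

section \<open>Boxes and boundary layers\<close>

lemma nn_integral_vec_prod:
  fixes f :: "'d::finite \<Rightarrow> real \<Rightarrow> ennreal"
  assumes [measurable]: "\<And>i. f i \<in> borel_measurable borel"
  shows "(\<integral>\<^sup>+x. (\<Prod>i\<in>UNIV. f i (x $ i)) \<partial>(lborel :: (real^'d) measure)) = (\<Prod>i\<in>UNIV. \<integral>\<^sup>+t. f i t \<partial>lborel)"
proof -
  \<comment> \<open>Inverse of the enumeration of the standard basis by coordinates, so that the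
    product formula over \<open>Basis\<close> can be read over the index type.\<close>
  define ix :: "real^'d \<Rightarrow> 'd" where "ix b = (SOME i. axis i 1 = b)" for b
  have inj: "inj (\<lambda>i::'d. axis i (1::real))" by (auto simp: inj_on_def axis_eq_axis)
  have ix: "ix (axis i 1) = i" for i by (simp add: ix_def axis_eq_axis)
  have B: "(Basis :: (real^'d) set) = range (\<lambda>i. axis i 1)" by (auto simp: Basis_vec_def)
  have "(\<integral>\<^sup>+x. (\<Prod>b\<in>Basis. f (ix b) (x \<bullet> b)) \<partial>(lborel :: (real^'d) measure)) = (\<Prod>b\<in>(Basis :: (real^'d) set). \<integral>\<^sup>+t. f (ix b) t \<partial>lborel)"
    by (rule nn_integral_lborel_prod) auto
  then show ?thesis unfolding B using inj
    by (simp add: prod.reindex ix inner_axis)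
qed

lemma sets_vec_box [measurable]:
  fixes A :: "'d::finite \<Rightarrow> real set"
  assumes [measurable]: "\<And>i. A i \<in> sets borel"
  shows "{x :: real^'d. \<forall>i. x $ i \<in> A i} \<in> sets borel"
  by measurable

lemma emeasure_vec_box:
  fixes A :: "'d::finite \<Rightarrow> real set"
  assumes [measurable]: "\<And>i. A i \<in> sets borel"
  shows "emeasure lborel {x :: real^'d. \<forall>i. x $ i \<in> A i} = (\<Prod>i\<in>UNIV. emeasure lborel (A i))"
proof -
  have "emeasure lborel {x :: real^'d. \<forall>i. x $ i \<in> A i} = (\<integral>\<^sup>+x. indicator {x :: real^'d. \<forall>i. x $ i \<in> A i} x \<partial>lborel)"
    by (rule nn_integral_indicator[symmetric]) measurable
  also have "\<dots> = (\<integral>\<^sup>+x. (\<Prod>i\<in>UNIV. indicator (A i) (x $ i)) \<partial>(lborel :: (real^'d) measure))"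
    by (intro nn_integral_cong) (auto simp: indicator_def prod_zero_iff)
  also have "\<dots> = (\<Prod>i\<in>UNIV. emeasure lborel (A i))"
    by (subst nn_integral_vec_prod) auto
  finally show ?thesis .
qed

lemma mem_cube: "x \<in> cube \<rho> \<longleftrightarrow> (\<forall>i. \<bar>x $ i\<bar> \<le> \<rho> / 2)"
proof -
  have "\<bar>t\<bar> \<le> \<rho> / 2 \<longleftrightarrow> -\<rho> / 2 \<le> t \<and> t \<le> \<rho> / 2" for t :: real by auto
  then show ?thesis by (simp add: cube_def mem_box_cart)
qed

lemma mem_cube_Icc: "x \<in> cube \<rho> \<longleftrightarrow> (\<forall>i. x $ i \<in> {-\<rho>/2..\<rho>/2})"
  by (simp add: cube_def mem_box_cart)

lemma sets_cube [measurable]: "cube \<rho> \<in> sets borel" by (simp add: cube_def)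

lemma nn_integral_cube_coordinate:
  fixes i :: "'d::finite"
  assumes [measurable]: "g \<in> borel_measurable borel" and rho: "0 < \<rho>"
  shows "(\<integral>\<^sup>+x\<in>cube \<rho>. g (x $ i) \<partial>(lborel :: (real^'d) measure)) =
    ennreal (\<rho> ^ (CARD('d) - 1)) * (\<integral>\<^sup>+t\<in>{-\<rho>/2..\<rho>/2}. g t \<partial>lborel)"
proof -
  define I where "I = {-\<rho>/2..\<rho>/2}"
  define f where "f j t = (if j = i then g t else 1) * indicator I t" for j t
  have [measurable]: "f j \<in> borel_measurable borel" for j
    unfolding f_def I_def by (cases "j = i") (auto simp: if_cancel)
  have *: "g (x $ i) * indicator (cube \<rho>) x = (\<Prod>j\<in>UNIV. f j (x $ j))" for x
  proof -
    have "(\<Prod>j\<in>UNIV. f j (x $ j)) = (\<Prod>j\<in>UNIV. if j = i then g (x $ i) else 1) * (\<Prod>j\<in>UNIV. indicator I (x $ j))"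
      unfolding prod.distrib[symmetric] f_def by (intro prod.cong) auto
    also have "(\<Prod>j\<in>UNIV. indicator I (x $ j)) = (indicator (cube \<rho>) x :: ennreal)"
      unfolding mem_cube_Icc I_def[symmetric] indicator_def by (auto simp: prod_zero_iff)
    finally show ?thesis by simp
  qed
  have "(\<integral>\<^sup>+x\<in>cube \<rho>. g (x $ i) \<partial>(lborel :: (real^'d) measure)) = (\<Prod>j\<in>UNIV. \<integral>\<^sup>+t. f j t \<partial>lborel)"
    unfolding * by (rule nn_integral_vec_prod) measurable
  also have "\<dots> = (\<integral>\<^sup>+t. f i t \<partial>lborel) * (\<Prod>j\<in>UNIV - {i}. \<integral>\<^sup>+t. f j t \<partial>lborel)"
    by (subst prod.remove[of _ i]) auto
  also have "(\<Prod>j\<in>UNIV - {i}. \<integral>\<^sup>+t. f j t \<partial>lborel) = (\<Prod>j\<in>UNIV - {i}. ennreal \<rho>)"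
    using rho by (intro prod.cong) (auto simp: f_def I_def)
  also have "\<dots> = ennreal (\<rho> ^ (CARD('d) - 1))"
    using rho by (simp add: ennreal_power card_Diff_singleton)
  finally show ?thesis by (simp add: f_def I_def mult.commute)
qed

lemma ennreal_mult_mult: "0 \<le> a \<Longrightarrow> 0 \<le> b \<Longrightarrow> ennreal a * (ennreal b * ennreal c) = ennreal (a * b * c)"
  by (simp add: ennreal_mult' mult.assoc)

lemma sum_const_ennreal: "(\<Sum>j\<in>A. ennreal c) = ennreal (real (card A) * c)"
  by (simp add: ennreal_of_nat_eq_real_of_nat ennreal_mult')

text \<open>The layer is covered by slabs, one for each coordinate close to a face. Within distance
  r of the midplane this coordinate cannot be \<open>i\<close>, so in direction \<open>i\<close> the
  side \<rho> is replaced by 2 * r; this is the gain in the third bound. Writing \<rho> ^ (d - 1) /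
  \<rho> keeps the formula homogeneous in \<rho> also for d = 1, where truncated subtraction would
  spoil the exponent d - 2.\<close>

lemma emeasure_boundary_layer:
  fixes i :: "'d::finite" and r \<rho> \<mu> :: real
  assumes rho: "0 < \<rho>" and lam: "0 < \<mu>" "\<mu> \<le> \<rho> / 2"
  defines "L \<equiv> {x :: real^'d. x \<in> cube \<rho> \<and> (\<exists>j. \<rho> / 2 - \<mu> < \<bar>x $ j\<bar>)}"
  shows "L \<in> sets borel"
    and "emeasure lborel L \<le> ennreal (CARD('d) * (2 * \<mu>) * \<rho> ^ (CARD('d) - 1))"
    and "0 \<le> r \<Longrightarrow> r \<le> \<rho> / 2 - \<mu> \<Longrightarrow> emeasure lborel {x \<in> L. \<bar>x $ i\<bar> \<le> r} \<le>
      ennreal (CARD('d) * (2 * \<mu>) * (2 * r) * (\<rho> ^ (CARD('d) - 1) / \<rho>))"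
proof -
  define I where "I = {-\<rho>/2..\<rho>/2}"
  define J where "J = {-\<rho>/2..-(\<rho>/2-\<mu>)} \<union> {\<rho>/2-\<mu>..\<rho>/2}"
  define Lj where "Lj j = {x :: real^'d. \<forall>k. x $ k \<in> (if k = j then J else I)}" for j
  define Mj where "Mj j = {x :: real^'d. \<forall>k. x $ k \<in> (if k = j then J else if k = i then {-r..r} else I)}" for j
  have [measurable]: "I \<in> sets borel" "J \<in> sets borel" by (auto simp: I_def J_def)
  have [measurable]: "Lj j \<in> sets borel" "Mj j \<in> sets borel" for j
    unfolding Lj_def Mj_def by (intro sets_vec_box; simp)+
  show [measurable]: "L \<in> sets borel" unfolding L_def by measurable
  have mI: "emeasure lborel I = ennreal \<rho>" using rho by (simp add: I_def)
  have mJ: "emeasure lborel J \<le> ennreal (2 * \<mu>)"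
  proof -
    have "emeasure lborel J \<le> emeasure lborel {-\<rho>/2..-(\<rho>/2-\<mu>)} + emeasure lborel {\<rho>/2-\<mu>..\<rho>/2}"
      unfolding J_def by (rule emeasure_subadditive) auto
    also have "\<dots> = ennreal (2 * \<mu>)" using lam by (simp flip: ennreal_plus)
    finally show ?thesis .
  qed
  have inI: "x $ k \<in> I" if "x \<in> cube \<rho>" for x :: "real^'d" and k
    using that unfolding mem_cube_Icc I_def by blast
  have inJ: "x $ k \<in> J" if "x \<in> cube \<rho>" "\<rho> / 2 - \<mu> < \<bar>x $ k\<bar>" for x :: "real^'d" and k
    using inI[OF that(1), of k] that(2) unfolding I_def J_def by auto
  have mL: "emeasure lborel (Lj j) \<le> ennreal (2 * \<mu> * \<rho> ^ (CARD('d) - 1))" for j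
  proof -
    have "emeasure lborel (Lj j) = (\<Prod>k\<in>UNIV. emeasure lborel (if k = j then J else I))"
      unfolding Lj_def by (rule emeasure_vec_box) auto
    also have "\<dots> = emeasure lborel J * (\<Prod>k\<in>UNIV-{j}. ennreal \<rho>)"
      by (subst prod.remove[of _ j]) (auto intro!: arg_cong2[where f = times] prod.cong simp: mI)
    also have "\<dots> \<le> ennreal (2 * \<mu>) * ennreal (\<rho> ^ (CARD('d) - 1))"
      using rho by (auto intro!: mult_mono mJ simp: ennreal_power card_Diff_singleton)
    finally show ?thesis using rho lam by (simp add: ennreal_mult)
  qed
  have "emeasure lborel L \<le> emeasure lborel (\<Union>j\<in>UNIV. Lj j)"
    by (rule emeasure_mono) (auto simp: L_def Lj_def inI inJ, metis inI inJ)
  also have "\<dots> \<le> (\<Sum>j\<in>UNIV. emeasure lborel (Lj j))" by (rule emeasure_subadditive_finite) auto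
  also have "\<dots> \<le> (\<Sum>j\<in>(UNIV::'d set). ennreal (2 * \<mu> * \<rho> ^ (CARD('d) - 1)))" by (intro sum_mono mL)
  also have "\<dots> = ennreal (CARD('d) * (2 * \<mu>) * \<rho> ^ (CARD('d) - 1))"
    unfolding sum_const_ennreal by (simp only: mult.assoc)
  finally show "emeasure lborel L \<le> ennreal (CARD('d) * (2 * \<mu>) * \<rho> ^ (CARD('d) - 1))" .
  assume r: "0 \<le> r" "r \<le> \<rho> / 2 - \<mu>"
  have mM: "emeasure lborel (Mj j) \<le> ennreal (2 * \<mu> * (2 * r) * (\<rho> ^ (CARD('d) - 1) / \<rho>))" if "j \<noteq> i" for j
  proof -
    have "emeasure lborel (Mj j) = (\<Prod>k\<in>UNIV. emeasure lborel (if k = j then J else if k = i then {-r..r} else I))"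
      unfolding Mj_def by (rule emeasure_vec_box) auto
    also have "\<dots> = emeasure lborel J * (emeasure lborel {-r..r} * (\<Prod>k\<in>UNIV-{j}-{i}. ennreal \<rho>))"
      using that by (subst prod.remove[of _ j]; (subst prod.remove[of _ i])?)
        (auto intro!: arg_cong2[where f = times] prod.cong simp: mI)
    also have "\<dots> \<le> ennreal (2 * \<mu>) * (ennreal (2 * r) * ennreal (\<rho> ^ (CARD('d) - 1 - 1)))"
      using rho r that by (auto intro!: mult_mono mJ simp: ennreal_power card_Diff_singleton)
    \<comment> \<open>Two distinct coordinates force d \<ge> 2, so the subtraction does not
      truncate.\<close>
    also have "\<rho> ^ (CARD('d) - 1 - 1) = \<rho> ^ (CARD('d) - 1) / \<rho>"
    proof -
      have "card {i, j} \<le> CARD('d)" by (rule card_mono) auto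
      then have "CARD('d) - 1 = Suc (CARD('d) - 1 - 1)" using that by auto
      then show ?thesis using rho by (metis nonzero_mult_div_cancel_left order_less_irrefl power_Suc)
    qed
    also have "ennreal (2 * \<mu>) * (ennreal (2 * r) * ennreal (\<rho> ^ (CARD('d) - 1) / \<rho>)) =
        ennreal (2 * \<mu> * (2 * r) * (\<rho> ^ (CARD('d) - 1) / \<rho>))"
      by (rule ennreal_mult_mult) (use lam r in auto)
    finally show ?thesis .
  qed
  have "emeasure lborel {x \<in> L. \<bar>x $ i\<bar> \<le> r} \<le> emeasure lborel (\<Union>j\<in>UNIV-{i}. Mj j)"
  proof (rule emeasure_mono)
    show "{x \<in> L. \<bar>x $ i\<bar> \<le> r} \<subseteq> (\<Union>j\<in>UNIV-{i}. Mj j)"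
    proof
      fix x assume "x \<in> {x \<in> L. \<bar>x $ i\<bar> \<le> r}"
      then obtain j where x: "x \<in> cube \<rho>" "\<rho> / 2 - \<mu> < \<bar>x $ j\<bar>" "\<bar>x $ i\<bar> \<le> r" by (auto simp: L_def)
      then have "j \<noteq> i" using r by auto
      moreover have "x \<in> Mj j" unfolding Mj_def using inI[OF x(1)] inJ[OF x(1,2)] x(3) by (auto simp: abs_le_iff)
      ultimately show "x \<in> (\<Union>j\<in>UNIV-{i}. Mj j)" by auto
    qed
  qed auto
  also have "\<dots> \<le> (\<Sum>j\<in>UNIV-{i}. emeasure lborel (Mj j))" by (rule emeasure_subadditive_finite) auto
  also have "\<dots> \<le> (\<Sum>j\<in>UNIV-{i}. ennreal (2 * \<mu> * (2 * r) * (\<rho> ^ (CARD('d) - 1) / \<rho>)))" by (intro sum_mono mM) auto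
  also have "\<dots> \<le> (\<Sum>j\<in>(UNIV::'d set). ennreal (2 * \<mu> * (2 * r) * (\<rho> ^ (CARD('d) - 1) / \<rho>)))"
    by (intro sum_mono2) auto
  also have "\<dots> = ennreal (CARD('d) * (2 * \<mu>) * (2 * r) * (\<rho> ^ (CARD('d) - 1) / \<rho>))"
    unfolding sum_const_ennreal by (simp only: mult.assoc)
  finally show "emeasure lborel {x \<in> L. \<bar>x $ i\<bar> \<le> r} \<le>
      ennreal (CARD('d) * (2 * \<mu>) * (2 * r) * (\<rho> ^ (CARD('d) - 1) / \<rho>))" .
qed

section \<open>Continuously differentiable functions and cutoffs\<close>

lemma C1_with_gradient_coordinate:
  fixes i :: "'d::finite"
  assumes "\<And>t. (f has_real_derivative f' t) (at t)" "continuous_on UNIV f'"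
  shows "C1_with_gradient (\<lambda>x :: real^'d. f (x $ i)) (\<lambda>x. f' (x $ i) *\<^sub>R axis i 1)"
  unfolding C1_with_gradient_def
proof (intro conjI allI)
  fix x :: "real^'d"
  have "((\<lambda>x :: real^'d. x $ i) has_derivative (\<lambda>h. h $ i)) (at x)"
    by (rule bounded_linear_imp_has_derivative[OF bounded_linear_vec_nth])
  from has_derivative_compose[OF this assms(1)[of "x $ i", unfolded has_field_derivative_def]]
  show "((\<lambda>x. f (x $ i)) has_derivative (\<lambda>h. f' (x $ i) *\<^sub>R axis i 1 \<bullet> h)) (at x)"
    by (simp add: inner_axis' mult.commute)
  show "continuous_on UNIV (\<lambda>x :: real^'d. f' (x $ i) *\<^sub>R axis i (1::real))"
    by (intro continuous_intros continuous_on_compose2[OF assms(2)]) auto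
qed

lemma C1_with_gradient_continuous: "C1_with_gradient f Df \<Longrightarrow> continuous_on UNIV f"
  unfolding C1_with_gradient_def
  by (intro continuous_at_imp_continuous_on ballI) (blast intro: has_derivative_continuous)

lemma C1_with_gradient_diff:
  assumes "C1_with_gradient f Df" "C1_with_gradient g Dg"
  shows "C1_with_gradient (\<lambda>x. f x - g x) (\<lambda>x. Df x - Dg x)"
  unfolding C1_with_gradient_def
proof (intro conjI allI)
  fix x
  have "((\<lambda>x. f x - g x) has_derivative (\<lambda>h. Df x \<bullet> h - Dg x \<bullet> h)) (at x)"
    using assms unfolding C1_with_gradient_def by (intro has_derivative_diff) auto
  then show "((\<lambda>x. f x - g x) has_derivative (\<lambda>h. (Df x - Dg x) \<bullet> h)) (at x)"
    by (simp only: inner_diff_left)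
  show "continuous_on UNIV (\<lambda>x. Df x - Dg x)"
    using assms unfolding C1_with_gradient_def by (intro continuous_intros) auto
qed

lemma C1_with_gradient_mult:
  assumes f: "C1_with_gradient f Df" and g: "C1_with_gradient g Dg"
  shows "C1_with_gradient (\<lambda>x. f x * g x) (\<lambda>x. f x *\<^sub>R Dg x + g x *\<^sub>R Df x)"
  unfolding C1_with_gradient_def
proof (intro conjI allI)
  fix x
  have "((\<lambda>x. f x * g x) has_derivative (\<lambda>h. f x * (Dg x \<bullet> h) + (Df x \<bullet> h) * g x)) (at x)"
    using f g unfolding C1_with_gradient_def by (intro has_derivative_mult) auto
  then show "((\<lambda>x. f x * g x) has_derivative (\<lambda>h. (f x *\<^sub>R Dg x + g x *\<^sub>R Df x) \<bullet> h)) (at x)"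
    by (simp add: inner_add_left mult.commute)
  show "continuous_on UNIV (\<lambda>x. f x *\<^sub>R Dg x + g x *\<^sub>R Df x)"
    using C1_with_gradient_continuous[OF f] C1_with_gradient_continuous[OF g] f g
    unfolding C1_with_gradient_def by (intro continuous_intros) auto
qed

text \<open>The factor 4 makes the barrier reach 1 at distance l / 2 beyond [-b, b], since
  \<open>pos_sq (1/2)\<close> is 1/4. The cutoff built from it therefore vanishes already in the
  outer half of a layer of width l, which leaves a compact support inside the open cube.\<close>

definition barrier :: "real \<Rightarrow> real \<Rightarrow> real \<Rightarrow> real" where
  "barrier b l t = 4 * (pos_sq ((t - b) / l) + pos_sq ((- t - b) / l))"

definition barrier' :: "real \<Rightarrow> real \<Rightarrow> real \<Rightarrow> real" where
  "barrier' b l t = 8 / l * (max 0 ((t - b) / l) - max 0 ((- t - b) / l))"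

definition cutoff :: "real \<Rightarrow> real \<Rightarrow> real^'d \<Rightarrow> real" where
  "cutoff b l x = pos_sq (1 - (\<Sum>i\<in>UNIV. barrier b l (x $ i)))"

definition cutoff_grad :: "real \<Rightarrow> real \<Rightarrow> real^'d \<Rightarrow> real^'d" where
  "cutoff_grad b l x = (- 2 * max 0 (1 - (\<Sum>i\<in>UNIV. barrier b l (x $ i)))) *\<^sub>R (\<chi> i. barrier' b l (x $ i))"

lemma pos_sq_nonneg: "0 \<le> pos_sq t" by (simp add: pos_sq_def)

lemma barrier_nonneg: "0 \<le> barrier b l t"
  by (simp add: barrier_def pos_sq_nonneg)

lemma DERIV_barrier: "l \<noteq> 0 \<Longrightarrow> (barrier b l has_real_derivative barrier' b l t) (at t)"
  unfolding barrier_def[abs_def] barrier'_def by (auto intro!: derivative_eq_intros simp: field_simps)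

lemma C1_cutoff:
  assumes "l \<noteq> 0"
  shows "C1_with_gradient (cutoff b l :: real^'d::finite \<Rightarrow> real) (cutoff_grad b l)"
  unfolding C1_with_gradient_def
proof (intro conjI allI)
  fix x :: "real^'d"
  have "((\<lambda>x :: real^'d. barrier b l (x $ i)) has_derivative (\<lambda>h. h $ i * barrier' b l (x $ i))) (at x)" for i
    using has_derivative_compose[OF bounded_linear_imp_has_derivative[OF bounded_linear_vec_nth]
        DERIV_barrier[OF assms, unfolded has_field_derivative_def]] by (simp add: mult.commute)
  then have "((\<lambda>x :: real^'d. 1 - (\<Sum>i\<in>UNIV. barrier b l (x $ i))) has_derivative
      (\<lambda>h. - (\<Sum>i\<in>UNIV. h $ i * barrier' b l (x $ i)))) (at x)"
    by (auto intro!: derivative_eq_intros)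
  from has_derivative_compose[OF this DERIV_pos_sq[unfolded has_field_derivative_def]]
  show "(cutoff b l has_derivative (\<lambda>h. cutoff_grad b l x \<bullet> h)) (at x)"
    unfolding cutoff_def[abs_def] cutoff_grad_def
    by (simp add: inner_vec_def sum_distrib_left sum_distrib_right mult_ac sum_negf)
  show "continuous_on UNIV (cutoff_grad b l :: real^'d \<Rightarrow> real^'d)"
    unfolding cutoff_grad_def[abs_def] barrier_def barrier'_def pos_sq_def using assms
    by (intro continuous_intros continuous_on_vec_lambda) auto
qed

lemma cutoff_range:
  fixes x :: "real^'d::finite"
  shows "0 \<le> cutoff b l x" "cutoff b l x \<le> 1"
proof -
  have "0 \<le> (\<Sum>i\<in>UNIV. barrier b l (x $ i))" by (intro sum_nonneg barrier_nonneg)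
  then show "cutoff b l x \<le> 1" unfolding cutoff_def pos_sq_def by (intro power_le_one) auto
qed (simp add: cutoff_def pos_sq_nonneg)

lemma cutoff_inside:
  fixes x :: "real^'d::finite"
  assumes "0 < l" "\<And>i. \<bar>x $ i\<bar> \<le> b"
  shows "cutoff b l x = 1" "cutoff_grad b l x = 0"
proof -
  have "(x $ i - b) / l \<le> 0" "(- x $ i - b) / l \<le> 0" for i
    using assms(1) assms(2)[of i] by (auto simp: divide_le_0_iff)
  then have "barrier b l (x $ i) = 0" "barrier' b l (x $ i) = 0" for i
    by (simp_all add: barrier_def barrier'_def pos_sq_def)
  then show "cutoff b l x = 1" "cutoff_grad b l x = 0"
    by (simp_all add: cutoff_def cutoff_grad_def pos_sq_def vec_eq_iff)
qed

lemma cutoff_outside: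
  fixes x :: "real^'d::finite"
  assumes "0 < l" "b + l / 2 \<le> \<bar>x $ i\<bar>"
  shows "cutoff b l x = 0"
proof -
  have "1/2 \<le> (x $ i - b) / l \<or> 1/2 \<le> (- x $ i - b) / l"
    using assms by (auto simp: field_simps abs_if split: if_splits)
  moreover have "1/4 \<le> pos_sq t" if "1/2 \<le> t" for t
    using power_mono[of "1/2" "max 0 t" 2] that by (simp add: pos_sq_def power2_eq_square)
  ultimately have "1/4 \<le> pos_sq ((x $ i - b) / l) \<or> 1/4 \<le> pos_sq ((- x $ i - b) / l)"
    by blast
  then have "1 \<le> barrier b l (x $ i)"
    unfolding barrier_def
    using pos_sq_nonneg[of "(x $ i - b) / l"] pos_sq_nonneg[of "(- x $ i - b) / l"]
    by (auto simp: distrib_left)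
  also have "\<dots> \<le> (\<Sum>i\<in>UNIV. barrier b l (x $ i))"
    by (rule member_le_sum) (auto simp: barrier_nonneg)
  finally show ?thesis by (simp add: cutoff_def pos_sq_def)
qed

text \<open>The outer square contributes a factor 2, each barrier a slope of at most 8 / l up to
  distance l, and the comparison with the l1 norm a factor d.\<close>

lemma norm_cutoff_grad:
  fixes x :: "real^'d::finite"
  assumes "0 < l" "0 \<le> b" "\<And>i. \<bar>x $ i\<bar> \<le> b + l"
  shows "norm (cutoff_grad b l x) \<le> 16 * real CARD('d) / l"
proof -
  have "\<bar>barrier' b l (x $ i)\<bar> \<le> 8 / l" for i
  proof -
    have "(x $ i - b) / l \<le> 1" "(- x $ i - b) / l \<le> 1"
      using assms(1) assms(3)[of i] by (auto simp: divide_le_eq_1)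
    then have "\<bar>max 0 ((x $ i - b) / l) - max 0 ((- x $ i - b) / l)\<bar> \<le> 1" by linarith
    then show ?thesis unfolding barrier'_def abs_mult
      using assms(1) mult_left_mono[of "\<bar>max 0 ((x $ i - b) / l) - max 0 ((- x $ i - b) / l)\<bar>" 1 "8 / l"] by simp
  qed
  then have "norm (\<chi> i. barrier' b l (x $ i)) \<le> (\<Sum>i\<in>(UNIV::'d set). 8 / l)"
    by (intro order_trans[OF norm_le_l1_cart] sum_mono) auto
  then have *: "norm (\<chi> i. barrier' b l (x $ i)) \<le> CARD('d) * (8 / l)" by simp
  have "0 \<le> (\<Sum>i\<in>UNIV. barrier b l (x $ i))" by (intro sum_nonneg barrier_nonneg)
  then have "\<bar>- 2 * max 0 (1 - (\<Sum>i\<in>UNIV. barrier b l (x $ i)))\<bar> \<le> 2" by (auto simp: abs_mult)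
  from mult_mono[OF this *] show ?thesis by (simp add: cutoff_grad_def)
qed

lemma interior_cube: "interior (cube \<rho> :: (real^'d) set) = {x. \<forall>i. \<bar>x $ i\<bar> < \<rho> / 2}"
proof -
  have "\<bar>t\<bar> < \<rho> / 2 \<longleftrightarrow> -\<rho> / 2 < t \<and> t < \<rho> / 2" for t :: real by auto
  then show ?thesis by (simp add: cube_def interior_cbox mem_box_cart set_eq_iff)
qed

lemma glued_in_dirichlet_class:
  fixes w U :: "real^'d::finite \<Rightarrow> real"
  assumes w: "C1_with_gradient w Dw" and U: "C1_with_gradient U DU"
    and l: "0 < l" "l \<le> \<rho> / 2"
  defines "\<psi> \<equiv> cutoff (\<rho> / 2 - l) l" and "D\<psi> \<equiv> cutoff_grad (\<rho> / 2 - l) l"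
  shows "(\<lambda>x. w x + \<psi> x * (U x - w x),
      \<lambda>x. Dw x + (\<psi> x *\<^sub>R (DU x - Dw x) + (U x - w x) *\<^sub>R D\<psi> x)) \<in> dirichlet_class (interior (cube \<rho>)) w"
proof -
  define v where "v = (\<lambda>x. \<psi> x * (U x - w x))"
  define h where "h = (\<lambda>x. \<psi> x *\<^sub>R (DU x - Dw x) + (U x - w x) *\<^sub>R D\<psi> x)"
  have vh: "C1_with_gradient v h"
    unfolding v_def h_def \<psi>_def D\<psi>_def
    by (intro C1_with_gradient_mult C1_with_gradient_diff C1_cutoff U w) (use l in auto)
  let ?K = "cube (\<rho> - l) :: (real^'d) set"
  have "compact ?K" by (simp add: cube_def)
  moreover have "?K \<subseteq> interior (cube \<rho>)"
  proof
    fix x assume "x \<in> ?K"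
    then have "\<bar>x $ i\<bar> \<le> (\<rho> - l) / 2" for i by (simp add: mem_cube)
    moreover have "(\<rho> - l) / 2 < \<rho> / 2" using l by simp
    ultimately show "x \<in> interior (cube \<rho>)" unfolding interior_cube using le_less_trans by blast
  qed
  moreover have "v x = 0" if "x \<notin> ?K" for x
  proof -
    from that obtain i where "(\<rho> - l) / 2 < \<bar>x $ i\<bar>" by (auto simp: mem_cube not_le)
    then have "cutoff (\<rho> / 2 - l) l x = 0" by (intro cutoff_outside[of _ _ _ i]) (use l in \<open>auto simp: field_simps\<close>)
    then show ?thesis by (simp add: v_def \<psi>_def)
  qed
  ultimately have "C1_compact_support (interior (cube \<rho>)) v h"
    unfolding C1_compact_support_def using vh by blast
  moreover have "v \<in> borel_measurable borel" "h \<in> borel_measurable borel"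
    using C1_with_gradient_continuous[OF vh] vh unfolding C1_with_gradient_def
    by (auto intro: borel_measurable_continuous_onI)
  \<comment> \<open>The perturbation is itself an admissible test function, so the constant sequence
    witnesses membership in the closure.\<close>
  ultimately have "H10 (interior (cube \<rho>)) v h"
    unfolding H10_def by (intro conjI exI[of _ "\<lambda>_. v"] exI[of _ "\<lambda>_. h"]) auto
  then show ?thesis unfolding dirichlet_class_def using w by (auto simp: v_def h_def)
qed

section \<open>Energy of the profile glued to the boundary datum\<close>

lemma boundary_profileD:
  assumes "boundary_profile q"
  shows "(q has_real_derivative deriv q t) (at t)" "continuous_on UNIV (deriv q)"
    "bounded (range (deriv q))" "\<bar>q t\<bar> \<le> 1" "(q \<longlongrightarrow> 1) at_top" "(q \<longlongrightarrow> -1) at_bot"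
proof -
  have d: "((deriv ^^ k) q) differentiable (at x)" for k x
    using assms by (auto simp: boundary_profile_def)
  show "(q has_real_derivative deriv q t) (at t)"
    using d[of 0 t] by (simp add: DERIV_deriv_iff_real_differentiable)
  show "continuous_on UNIV (deriv q)"
    using d[of 1] by (intro continuous_at_imp_continuous_on) (auto intro: differentiable_imp_continuous_within)
  have "q t \<in> {-1..1}" using assms unfolding boundary_profile_def by blast
  then show "\<bar>q t\<bar> \<le> 1" by auto
qed (use assms in \<open>auto simp: boundary_profile_def\<close>)

lemma surface_tension_le_energy:
  assumes "(u, g) \<in> dirichlet_class (interior Q) (\<lambda>x. q ((x \<bullet> e) / \<epsilon>))"
  shows "surface_tension W q \<theta> \<epsilon> \<delta> e Q \<le> energy W \<theta> \<epsilon> \<delta> Q u g"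
  unfolding surface_tension_def using INF_lower[OF assms, of "\<lambda>(u, g). energy W \<theta> \<epsilon> \<delta> Q u g"] by simp

lemma abs_convex_combination_le:
  fixes a b t :: real
  assumes "\<bar>a\<bar> \<le> 1" "\<bar>b\<bar> \<le> 1" "0 \<le> t" "t \<le> 1"
  shows "\<bar>a + t * (b - a)\<bar> \<le> 1"
proof -
  have "\<bar>(1 - t) * a + t * b\<bar> \<le> (1 - t) * \<bar>a\<bar> + t * \<bar>b\<bar>"
    using assms by (intro order_trans[OF abs_triangle_ineq]) (simp add: abs_mult)
  also have "\<dots> \<le> (1 - t) * 1 + t * 1" using assms by (intro add_mono mult_left_mono) auto
  finally show ?thesis by (simp add: algebra_simps)
qed

text \<open>The competitor is w + \<psi> (U - w), with the datum w, the planar profile U and the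
  cutoff \<psi> of the layer of width \<kappa> \<epsilon>. Inside it equals U, which gives the
  integral. In the layer the energy density is 1 / \<epsilon> times a constant, and the volume is of
  order \<kappa> \<epsilon>, so powers of \<epsilon> cancel. The number 256 is the square of the 16
  from the cutoff gradient. The number 4096 is 256 times 4 from (U - w)^2 \<le> 4 near the midplane,
  times 4 from the two widths 2 \<kappa> \<epsilon> and 2 r of the volume bound.\<close>

lemma surface_tension_le_profile_energy:
  fixes i :: "'d::finite" and \<theta> :: "real^'d \<Rightarrow> real" and \<epsilon> \<kappa> \<tau> r \<rho> :: real
  assumes W: "double_well W" "\<And>u. \<bar>u\<bar> \<le> 1 \<Longrightarrow> W u \<le> m"
    and q: "boundary_profile q" "\<And>s. \<bar>deriv q s\<bar> \<le> m1"
    and P: "\<And>s. (P has_real_derivative P' s) (at s)" "continuous_on UNIV P'" "\<And>s. \<bar>P s\<bar> \<le> 1"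
      "\<And>s. \<bar>P' s\<bar> \<le> m1"
    and \<theta>[measurable]: "\<theta> \<in> borel_measurable borel" and \<theta>b: "\<And>y. 0 \<le> \<theta> y" "\<And>y. \<theta> y \<le> B"
    and pos: "0 < \<epsilon>" "0 < \<kappa>" "0 \<le> r" "0 \<le> \<tau>" "0 < \<rho>" "r \<le> \<rho> / 2 - \<kappa> * \<epsilon>"
    and close: "\<And>t. r < \<bar>t\<bar> \<Longrightarrow> \<bar>t\<bar> \<le> \<rho> / 2 \<Longrightarrow> \<bar>P ((t - x0) / \<epsilon>) - q (t / \<epsilon>)\<bar> \<le> \<tau>"
  shows "surface_tension W q \<theta> \<epsilon> \<delta> (axis i 1) (cube \<rho>) \<le>
    (\<integral>\<^sup>+x\<in>cube \<rho>. ennreal (\<epsilon> / 2 * (P' ((x $ i - x0) / \<epsilon>) / \<epsilon>)\<^sup>2 +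
       1 / \<epsilon> * \<theta> ((1 / \<delta>) *\<^sub>R x) * W (P ((x $ i - x0) / \<epsilon>))) \<partial>lborel) +
    ennreal (\<rho> ^ (CARD('d) - 1) * (2 * real CARD('d) * \<kappa> * (m1\<^sup>2 + B * m + 256 * (real CARD('d))\<^sup>2 * \<tau>\<^sup>2 / \<kappa>\<^sup>2) +
       4096 * real CARD('d) ^ 3 * r / (\<kappa> * \<rho>)))"
proof -
  define n where "n = real CARD('d)"
  have n: "1 \<le> n" unfolding n_def using zero_less_card_finite[where 'a='d] by linarith
  define l where "l = \<kappa> * \<epsilon>"
  have l: "0 < l" "l \<le> \<rho> / 2" "r \<le> \<rho> / 2 - l" using pos by (auto simp: l_def)
  define w Dw where "w = (\<lambda>x :: real^'d. q (x $ i / \<epsilon>))" and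
    "Dw = (\<lambda>x :: real^'d. (deriv q (x $ i / \<epsilon>) / \<epsilon>) *\<^sub>R axis i (1::real))"
  define U DU where "U = (\<lambda>x :: real^'d. P ((x $ i - x0) / \<epsilon>))" and
    "DU = (\<lambda>x :: real^'d. (P' ((x $ i - x0) / \<epsilon>) / \<epsilon>) *\<^sub>R axis i (1::real))"
  define \<psi> D\<psi> where "\<psi> = (cutoff (\<rho> / 2 - l) l :: real^'d \<Rightarrow> real)" and
    "D\<psi> = (cutoff_grad (\<rho> / 2 - l) l :: real^'d \<Rightarrow> real^'d)"
  have w: "C1_with_gradient w Dw"
    unfolding w_def Dw_def
  proof (rule C1_with_gradient_coordinate)
    show "((\<lambda>t. q (t / \<epsilon>)) has_real_derivative deriv q (t / \<epsilon>) / \<epsilon>) (at t)" for t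
      by (rule DERIV_chain2[OF boundary_profileD(1)[OF q(1)], THEN DERIV_cong]) (use pos in \<open>auto intro!: derivative_eq_intros\<close>)
    show "continuous_on UNIV (\<lambda>t. deriv q (t / \<epsilon>) / \<epsilon>)"
      using pos by (intro continuous_intros continuous_on_compose2[OF boundary_profileD(2)[OF q(1)]]) auto
  qed
  have U: "C1_with_gradient U DU"
    unfolding U_def DU_def
  proof (rule C1_with_gradient_coordinate)
    show "((\<lambda>t. P ((t - x0) / \<epsilon>)) has_real_derivative P' ((t - x0) / \<epsilon>) / \<epsilon>) (at t)" for t
      by (rule DERIV_chain2[OF P(1), THEN DERIV_cong]) (use pos in \<open>auto intro!: derivative_eq_intros\<close>)
    show "continuous_on UNIV (\<lambda>t. P' ((t - x0) / \<epsilon>) / \<epsilon>)"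
      using pos by (intro continuous_intros continuous_on_compose2[OF P(2)]) auto
  qed
  define u g where "u = (\<lambda>x. w x + \<psi> x * (U x - w x))" and
    "g = (\<lambda>x. Dw x + (\<psi> x *\<^sub>R (DU x - Dw x) + (U x - w x) *\<^sub>R D\<psi> x))"
  have "(u, g) \<in> dirichlet_class (interior (cube \<rho>)) w"
    unfolding u_def g_def \<psi>_def D\<psi>_def by (rule glued_in_dirichlet_class[OF w U l(1,2)])
  then have "surface_tension W q \<theta> \<epsilon> \<delta> (axis i 1) (cube \<rho>) \<le> energy W \<theta> \<epsilon> \<delta> (cube \<rho>) u g"
    by (intro surface_tension_le_energy) (simp add: w_def inner_axis)
  also have "\<dots> \<le> (\<integral>\<^sup>+x\<in>cube \<rho>. ennreal (\<epsilon> / 2 * (P' ((x $ i - x0) / \<epsilon>) / \<epsilon>)\<^sup>2 +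
       1 / \<epsilon> * \<theta> ((1 / \<delta>) *\<^sub>R x) * W (P ((x $ i - x0) / \<epsilon>))) \<partial>lborel) +
    ennreal (\<rho> ^ (CARD('d) - 1) * (2 * n * \<kappa> * (m1\<^sup>2 + B * m + 256 * n\<^sup>2 * \<tau>\<^sup>2 / \<kappa>\<^sup>2) +
       4096 * n ^ 3 * r / (\<kappa> * \<rho>)))"
  proof -
    define F where "F = (\<lambda>x :: real^'d. \<epsilon> / 2 * (P' ((x $ i - x0) / \<epsilon>) / \<epsilon>)\<^sup>2 +
       1 / \<epsilon> * \<theta> ((1 / \<delta>) *\<^sub>R x) * W (P ((x $ i - x0) / \<epsilon>)))"
    define L where "L = {x :: real^'d. x \<in> cube \<rho> \<and> (\<exists>j. \<rho> / 2 - l < \<bar>x $ j\<bar>)}"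
    define L2 where "L2 = {x \<in> L. \<bar>x $ i\<bar> \<le> r}"
    note LL = emeasure_boundary_layer[OF pos(5) l(1,2), where 'd = 'd, folded L_def]
    have [measurable]: "L \<in> sets borel" by (rule LL(1))
    have [measurable]: "L2 \<in> sets borel" unfolding L2_def by measurable
    have [measurable]: "W \<in> borel_measurable borel" "P \<in> borel_measurable borel" "P' \<in> borel_measurable borel"
      using double_wellD(1)[OF W(1)] P(2) DERIV_continuous_on[of UNIV P P'] P(1)
      by (auto intro!: borel_measurable_continuous_onI)
    have [measurable]: "F \<in> borel_measurable borel" unfolding F_def by measurable
    define c1 c2 where "c1 = 1 / \<epsilon> * (m1\<^sup>2 + B * m + 256 * n\<^sup>2 * \<tau>\<^sup>2 / \<kappa>\<^sup>2)" and
      "c2 = 1 / \<epsilon> * (1024 * n\<^sup>2 / \<kappa>\<^sup>2)"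
    have Bm: "0 \<le> B" "0 \<le> m" using \<theta>b[of 0] W(2)[of 0] double_wellD(2)[OF W(1), of 0] by auto
    have c: "0 \<le> c1" "0 \<le> c2" using pos Bm by (auto simp: c1_def c2_def)
    \<comment> \<open>As a pointwise convex combination of values in [-1, 1], the competitor never
      sees \<open>W\<close> outside this interval, where its growth is not controlled.\<close>
    have u1: "\<bar>u x\<bar> \<le> 1" for x
      unfolding u_def w_def U_def \<psi>_def
      by (rule abs_convex_combination_le) (auto simp: P(3) boundary_profileD(4)[OF q(1)] cutoff_range)
    have F0: "0 \<le> F x" for x unfolding F_def using pos \<theta>b double_wellD(2)[OF W(1)] by auto
    have *: "\<epsilon> / 2 * (norm (g x))\<^sup>2 + 1 / \<epsilon> * \<theta> ((1 / \<delta>) *\<^sub>R x) * W (u x) \<le>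
        F x + c1 * indicator L x + c2 * indicator L2 x" if x: "x \<in> cube \<rho>" for x
    proof (cases "x \<in> L")
      case False
      then have "\<And>j. \<bar>x $ j\<bar> \<le> \<rho> / 2 - l" using x by (auto simp: L_def not_less)
      then have "\<psi> x = 1" "D\<psi> x = 0" unfolding \<psi>_def D\<psi>_def using cutoff_inside[OF l(1), of x "\<rho> / 2 - l"] by auto
      then have "u x = U x" "g x = DU x" by (auto simp: u_def g_def)
      then show ?thesis using False by (simp add: F_def U_def DU_def L2_def power_mult_distrib power2_abs power_divide)
    next
      case True
      define d where "d = \<bar>U x - w x\<bar>"
      have d: "d\<^sup>2 \<le> 4 * indicator L2 x + \<tau>\<^sup>2"
      proof (cases "\<bar>x $ i\<bar> \<le> r")
        case le: True
        have "d \<le> 2" unfolding d_def U_def w_def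
          using P(3)[of "(x $ i - x0) / \<epsilon>"] boundary_profileD(4)[OF q(1), of "x $ i / \<epsilon>"] by linarith
        then have "d\<^sup>2 \<le> 2\<^sup>2" unfolding d_def by (intro power_mono) auto
        then show ?thesis using True le by (simp add: L2_def add_increasing2)
      next
        case False
        then have "d \<le> \<tau>" unfolding d_def U_def w_def using close[of "x $ i"] x by (auto simp: mem_cube)
        then have "d\<^sup>2 \<le> \<tau>\<^sup>2" unfolding d_def by (intro power_mono) auto
        then show ?thesis by (simp add: add_increasing)
      qed
      have nw: "norm (Dw x) \<le> m1 / \<epsilon>" "norm (DU x) \<le> m1 / \<epsilon>"
        unfolding Dw_def DU_def using pos q(2) P(4) by (auto simp: divide_right_mono)
      have nD: "norm (D\<psi> x) \<le> 16 * n / l"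
        unfolding D\<psi>_def n_def using l x by (intro norm_cutoff_grad) (auto simp: mem_cube)
      \<comment> \<open>In this grouping the gradients of datum and profile form a convex
        combination, and only the last term carries the large gradient of the cutoff, weighted by
        the difference d.\<close>
      have "g x = (1 - \<psi> x) *\<^sub>R Dw x + \<psi> x *\<^sub>R DU x + (U x - w x) *\<^sub>R D\<psi> x"
        by (simp add: g_def algebra_simps)
      then have "norm (g x) \<le> (1 - \<psi> x) * norm (Dw x) + \<psi> x * norm (DU x) + d * norm (D\<psi> x)"
        using norm_triangle_ineq[of "(1 - \<psi> x) *\<^sub>R Dw x + \<psi> x *\<^sub>R DU x" "(U x - w x) *\<^sub>R D\<psi> x"]
          norm_triangle_ineq[of "(1 - \<psi> x) *\<^sub>R Dw x" "\<psi> x *\<^sub>R DU x"] cutoff_range[of "\<rho> / 2 - l" l x]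
        by (simp add: d_def \<psi>_def)
      also have "\<dots> \<le> (1 - \<psi> x) * (m1 / \<epsilon>) + \<psi> x * (m1 / \<epsilon>) + d * (16 * n / l)"
        using nw nD cutoff_range[of "\<rho> / 2 - l" l x]
        by (intro add_mono mult_left_mono) (auto simp: d_def \<psi>_def)
      also have "\<dots> = m1 / \<epsilon> + d * (16 * n / l)" by (simp add: algebra_simps)
      finally have "(norm (g x))\<^sup>2 \<le> (m1 / \<epsilon> + d * (16 * n / l))\<^sup>2" by (intro power_mono) auto
      also have "\<dots> \<le> 2 * (m1 / \<epsilon>)\<^sup>2 + 2 * (d * (16 * n / l))\<^sup>2"
        using sum_squares_bound[of "m1 / \<epsilon>" "d * (16 * n / l)"] by (simp add: power2_sum)
      finally have "\<epsilon> / 2 * (norm (g x))\<^sup>2 \<le> \<epsilon> / 2 * (2 * (m1 / \<epsilon>)\<^sup>2 + 2 * (d * (16 * n / l))\<^sup>2)"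
        using pos by (intro mult_left_mono) auto
      also have "\<dots> = 1 / \<epsilon> * (m1\<^sup>2 + 256 * n\<^sup>2 / \<kappa>\<^sup>2 * d\<^sup>2)"
        unfolding l_def using pos by (simp add: field_simps power2_eq_square)
      also have "\<dots> \<le> 1 / \<epsilon> * (m1\<^sup>2 + 256 * n\<^sup>2 / \<kappa>\<^sup>2 * (4 * indicator L2 x + \<tau>\<^sup>2))"
        using pos d by (intro mult_left_mono add_left_mono) auto
      finally have a: "\<epsilon> / 2 * (norm (g x))\<^sup>2 \<le> \<dots>" .
      have "\<theta> ((1 / \<delta>) *\<^sub>R x) * W (u x) \<le> B * m"
        using \<theta>b W(2)[OF u1] Bm double_wellD(2)[OF W(1)] by (intro mult_mono) auto
      then have b: "1 / \<epsilon> * \<theta> ((1 / \<delta>) *\<^sub>R x) * W (u x) \<le> 1 / \<epsilon> * (B * m)"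
        using pos by (simp add: divide_right_mono)
      have "1 / \<epsilon> * (m1\<^sup>2 + 256 * n\<^sup>2 / \<kappa>\<^sup>2 * (4 * indicator L2 x + \<tau>\<^sup>2)) + 1 / \<epsilon> * (B * m) = c1 + c2 * indicator L2 x"
        by (simp add: c1_def c2_def algebra_simps add_divide_distrib)
      then have "\<epsilon> / 2 * (norm (g x))\<^sup>2 + 1 / \<epsilon> * \<theta> ((1 / \<delta>) *\<^sub>R x) * W (u x) \<le> c1 + c2 * indicator L2 x"
        using a b by linarith
      then show ?thesis using F0[of x] True by simp
    qed
    have "energy W \<theta> \<epsilon> \<delta> (cube \<rho>) u g \<le>
        (\<integral>\<^sup>+x. ennreal (F x) * indicator (cube \<rho>) x + (ennreal c1 * indicator L x + ennreal c2 * indicator L2 x) \<partial>lborel)"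
      unfolding energy_def
    proof (rule nn_integral_mono)
      fix x
      show "ennreal (\<epsilon> / 2 * (norm (g x))\<^sup>2 + 1 / \<epsilon> * \<theta> ((1 / \<delta>) *\<^sub>R x) * W (u x)) * indicator (cube \<rho>) x \<le>
        ennreal (F x) * indicator (cube \<rho>) x + (ennreal c1 * indicator L x + ennreal c2 * indicator L2 x)"
      proof (cases "x \<in> cube \<rho>")
        case True
        have "ennreal (F x + c1 * indicator L x + c2 * indicator L2 x) =
            ennreal (F x) + (ennreal c1 * indicator L x + ennreal c2 * indicator L2 x)"
          using F0[of x] c by (auto simp: indicator_def ennreal_plus add.assoc)
        then show ?thesis using ennreal_leI[OF *[OF True]] True by simp
      qed simp
    qed
    also have "\<dots> = (\<integral>\<^sup>+x\<in>cube \<rho>. ennreal (F x) \<partial>lborel) + (ennreal c1 * emeasure lborel L + ennreal c2 * emeasure lborel L2)"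
      by (simp add: nn_integral_add nn_integral_cmult_indicator)
    also have "\<dots> \<le> (\<integral>\<^sup>+x\<in>cube \<rho>. ennreal (F x) \<partial>lborel) +
        (ennreal c1 * ennreal (n * (2 * l) * \<rho> ^ (CARD('d) - 1)) +
         ennreal c2 * ennreal (n * (2 * l) * (2 * r) * (\<rho> ^ (CARD('d) - 1) / \<rho>)))"
      unfolding n_def L2_def using LL(2) LL(3)[OF pos(3) l(3)] by (intro add_left_mono add_mono mult_left_mono) auto
    also have "ennreal c1 * ennreal (n * (2 * l) * \<rho> ^ (CARD('d) - 1)) +
         ennreal c2 * ennreal (n * (2 * l) * (2 * r) * (\<rho> ^ (CARD('d) - 1) / \<rho>)) =
        ennreal (c1 * (n * (2 * l) * \<rho> ^ (CARD('d) - 1)) + c2 * (n * (2 * l) * (2 * r) * (\<rho> ^ (CARD('d) - 1) / \<rho>)))"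
    proof -
      have "0 \<le> n * (2 * l) * \<rho> ^ (CARD('d) - 1)" "0 \<le> n * (2 * l) * (2 * r) * (\<rho> ^ (CARD('d) - 1) / \<rho>)"
        using n l pos by auto
      then show ?thesis using c by (simp only: ennreal_mult ennreal_plus mult_nonneg_nonneg)
    qed
    also have "c1 * (n * (2 * l) * \<rho> ^ (CARD('d) - 1)) + c2 * (n * (2 * l) * (2 * r) * (\<rho> ^ (CARD('d) - 1) / \<rho>)) =
       \<rho> ^ (CARD('d) - 1) * (2 * n * \<kappa> * (m1\<^sup>2 + B * m + 256 * n\<^sup>2 * \<tau>\<^sup>2 / \<kappa>\<^sup>2) + 4096 * n ^ 3 * r / (\<kappa> * \<rho>))"
      unfolding c1_def c2_def l_def using pos
      by (simp add: divide_simps power2_eq_square power3_eq_cube) (simp add: algebra_simps)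
    finally show ?thesis unfolding F_def .
  qed
  finally show ?thesis unfolding n_def by simp
qed

section \<open>Averaging of the checkerboard\<close>

text \<open>Serves twice: for the variance of the averaged checkerboard and for the mean ergodic
  argument about the shift. In both, independence enters only through vanishing
  correlations.\<close>

lemma (in prob_space) expectation_uncorrelated_sum_square:
  fixes X :: "'i \<Rightarrow> 'a \<Rightarrow> real"
  assumes "finite I" and [measurable]: "\<And>i. i \<in> I \<Longrightarrow> X i \<in> borel_measurable M"
    and bd: "\<And>i \<omega>. i \<in> I \<Longrightarrow> \<omega> \<in> space M \<Longrightarrow> \<bar>X i \<omega>\<bar> \<le> K i"
    and uncorr: "\<And>i j. i \<in> I \<Longrightarrow> j \<in> I \<Longrightarrow> i \<noteq> j \<Longrightarrow> expectation (\<lambda>\<omega>. X i \<omega> * X j \<omega>) = 0"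
  shows "expectation (\<lambda>\<omega>. (\<Sum>i\<in>I. X i \<omega>)\<^sup>2) = (\<Sum>i\<in>I. expectation (\<lambda>\<omega>. (X i \<omega>)\<^sup>2))"
proof -
  have int: "integrable M (\<lambda>\<omega>. X i \<omega> * X j \<omega>)" if "i \<in> I" "j \<in> I" for i j
  proof (rule integrable_const_bound[of _ "K i * K j"])
    show "AE \<omega> in M. norm (X i \<omega> * X j \<omega>) \<le> K i * K j"
      using bd that by (auto simp: abs_mult intro!: mult_mono order_trans[OF abs_ge_zero] AE_I2)
    show "(\<lambda>\<omega>. X i \<omega> * X j \<omega>) \<in> borel_measurable M" using that by measurable
  qed
  have "expectation (\<lambda>\<omega>. (\<Sum>i\<in>I. X i \<omega>)\<^sup>2) = expectation (\<lambda>\<omega>. \<Sum>i\<in>I. \<Sum>j\<in>I. X i \<omega> * X j \<omega>)"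
    by (simp add: power2_eq_square sum_product)
  also have "\<dots> = (\<Sum>i\<in>I. \<Sum>j\<in>I. expectation (\<lambda>\<omega>. X i \<omega> * X j \<omega>))"
    using int by (subst Bochner_Integration.integral_sum)
      (auto intro!: Bochner_Integration.integrable_sum sum.cong Bochner_Integration.integral_sum)
  also have "\<dots> = (\<Sum>i\<in>I. \<Sum>j\<in>I. if i = j then expectation (\<lambda>\<omega>. (X i \<omega>)\<^sup>2) else 0)"
    using uncorr by (intro sum.cong) (auto simp: power2_eq_square)
  finally show ?thesis using assms(1) by simp
qed

definition cell_index :: "real^'d \<Rightarrow> int^'d" where
  "cell_index x = (\<chi> i. \<lfloor>x $ i + 1 / 2\<rfloor>)"

definition unit_cell :: "int^'d \<Rightarrow> (real^'d) set" where
  "unit_cell z = box (\<chi> i. of_int (z $ i) - 1 / 2) (\<chi> i. of_int (z $ i) + 1 / 2)"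

lemma mem_unit_cell: "x \<in> unit_cell z \<longleftrightarrow> (\<forall>i. of_int (z $ i) - 1 / 2 < x $ i \<and> x $ i < of_int (z $ i) + 1 / 2)"
  by (simp add: unit_cell_def mem_box_cart)

lemma unit_cell_index:
  assumes "x \<in> unit_cell z"
  shows "cell_index x = z"
proof -
  have "\<lfloor>x $ i + 1 / 2\<rfloor> = z $ i" for i
  proof -
    have "of_int (z $ i) - 1 / 2 < x $ i" "x $ i < of_int (z $ i) + 1 / 2"
      using assms by (auto simp: mem_unit_cell)
    then show ?thesis by linarith
  qed
  then show ?thesis by (simp add: cell_index_def vec_eq_iff)
qed

text \<open>The open cells are disjoint, so at most one term of the sum survives. On the faces
  between cells none does and the field is 0, whereas \<open>cell_index\<close> still assigns a cell
  there; hence the membership test.\<close>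

lemma checkerboard_field_eq:
  fixes x :: "real^'d::finite"
  shows "checkerboard_field \<Theta> x \<omega> = (if x \<in> unit_cell (cell_index x) then \<Theta> (cell_index x) \<omega> else 0)"
proof -
  have "checkerboard_field \<Theta> x \<omega> = (\<Sum>\<^sub>\<infinity>z\<in>{cell_index x}. \<Theta> z \<omega> * indicator (unit_cell z) x)"
    unfolding checkerboard_field_def unit_cell_def[symmetric]
    by (rule infsum_cong_neutral) (auto simp: indicator_def dest: unit_cell_index)
  moreover have "(\<Sum>\<^sub>\<infinity>z\<in>{a}. f z) = f a" for a and f :: "int^'d \<Rightarrow> real" by (subst infsum_finite) simp_all
  ultimately show ?thesis by simp
qed

text \<open>Only finitely many cells meet the cube. This makes the sums in the variance estimate
  finite and the family of rational cell values in the measurability proof countable. The summand 1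
  absorbs the rounding.\<close>

lemma cell_index_scaled_cube:
  fixes x :: "real^'d::finite"
  assumes "x \<in> cube \<rho>" "0 < \<delta>"
  shows "cell_index ((1 / \<delta>) *\<^sub>R x) \<in> {z. \<forall>i. z $ i \<in> {-\<lceil>\<rho> / (2 * \<delta>) + 1\<rceil>..\<lceil>\<rho> / (2 * \<delta>) + 1\<rceil>}}"
proof -
  have "-\<lceil>\<rho> / (2 * \<delta>) + 1\<rceil> \<le> \<lfloor>x $ i / \<delta> + 1 / 2\<rfloor> \<and> \<lfloor>x $ i / \<delta> + 1 / 2\<rfloor> \<le> \<lceil>\<rho> / (2 * \<delta>) + 1\<rceil>" for i
  proof -
    have "\<bar>x $ i / \<delta>\<bar> \<le> \<rho> / (2 * \<delta>)"
      using assms by (auto simp: mem_cube abs_divide divide_simps)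
    then show ?thesis by linarith
  qed
  then show ?thesis by (simp add: cell_index_def)
qed

lemma finite_int_vec_box: "finite {z :: int^'d::finite. \<forall>i. z $ i \<in> {-k..k}}"
proof -
  have "finite (vec_lambda ` (PiE UNIV (\<lambda>_::'d. {-k..k})))" by (intro finite_imageI finite_PiE) auto
  moreover have "{z :: int^'d. \<forall>i. z $ i \<in> {-k..k}} \<subseteq> vec_lambda ` (PiE UNIV (\<lambda>_::'d. {-k..k}))"
  proof
    fix z :: "int^'d" assume "z \<in> {z. \<forall>i. z $ i \<in> {-k..k}}"
    then have "vec_nth z \<in> PiE UNIV (\<lambda>_. {-k..k})" by auto
    then show "z \<in> vec_lambda ` (PiE UNIV (\<lambda>_::'d. {-k..k}))" by (metis image_eqI vec_nth_inverse)
  qed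
  ultimately show ?thesis by (rule rev_finite_subset)
qed

lemma emeasure_scaled_unit_cell:
  fixes z :: "int^'d::finite"
  assumes "0 < \<delta>"
  shows "emeasure lborel {x. (1 / \<delta>) *\<^sub>R x \<in> unit_cell z} = ennreal (\<delta> ^ CARD('d))"
proof -
  have "{x. (1 / \<delta>) *\<^sub>R x \<in> unit_cell z} = {x :: real^'d. \<forall>i. x $ i \<in> {\<delta> * (of_int (z $ i) - 1/2)<..<\<delta> * (of_int (z $ i) + 1/2)}}"
    using assms by (auto simp: mem_unit_cell field_simps)
  also have "emeasure lborel \<dots> = (\<Prod>i\<in>(UNIV :: 'd set). ennreal \<delta>)"
    using assms by (subst emeasure_vec_box) (auto intro!: prod.cong simp: algebra_simps)
  finally show ?thesis using assms by (simp add: ennreal_power)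
qed

lemma open_unit_cell: "open (unit_cell z :: (real^'d::finite) set)"
  unfolding unit_cell_def by (rule open_box)

lemma sets_scaled_unit_cell [measurable]: "{x :: real^'d::finite. c *\<^sub>R x \<in> unit_cell z} \<in> sets borel"
proof -
  have [measurable]: "unit_cell z \<in> sets borel" using open_unit_cell by (rule borel_open)
  show ?thesis by measurable
qed

text \<open>Chebyshev's inequality. The integral equals the sum of \<Theta>_z C_z, where C_z is the
  mass that \<open>F\<close> gives to the scaled cell z. These masses add up to at most
  \<open>I\<close>, and each is at most H \<delta>^d, so the sum of their squares, and with it the
  variance, is small although \<open>H\<close> will be of order 1 / \<epsilon>.\<close>

lemma checkerboard_integral_concentration:
  fixes \<Theta> :: "int^'d::finite \<Rightarrow> 'w \<Rightarrow> real" and F :: "real^'d \<Rightarrow> real"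
  assumes "prob_space N"
    and indep: "prob_space.indep_vars N (\<lambda>_. borel) \<Theta> UNIV"
    and bd: "\<And>z \<omega>. 0 \<le> \<Theta> z \<omega> \<and> \<Theta> z \<omega> \<le> b"
    and mean: "\<And>z. prob_space.expectation N (\<Theta> z) = 1"
    and [measurable]: "F \<in> borel_measurable borel" and F: "\<And>x. 0 \<le> F x" "\<And>x. F x \<le> H"
    and I: "(\<integral>\<^sup>+x\<in>cube \<rho>. ennreal (F x) \<partial>lborel) \<le> ennreal I" "0 \<le> I" and pos: "0 < \<delta>" "0 < t"
  obtains G where "G \<in> sets N" "measure N G \<ge> 1 - (b + 1)\<^sup>2 * H * \<delta> ^ CARD('d) * I / t\<^sup>2"
    "\<And>\<omega>. \<omega> \<in> G \<Longrightarrow> (\<integral>\<^sup>+x\<in>cube \<rho>. ennreal (checkerboard_field \<Theta> ((1 / \<delta>) *\<^sub>R x) \<omega> * F x) \<partial>lborel) \<le> ennreal (I + t)"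
proof -
  interpret N: prob_space N by fact
  have [measurable]: "\<Theta> z \<in> borel_measurable N" for z using indep unfolding N.indep_vars_def by auto
  define Z where "Z = {z :: int^'d. \<forall>i. z $ i \<in> {-\<lceil>\<rho> / (2 * \<delta>) + 1\<rceil>..\<lceil>\<rho> / (2 * \<delta>) + 1\<rceil>}}"
  have Z: "finite Z" unfolding Z_def by (rule finite_int_vec_box)
  define D where "D z = {x :: real^'d. (1 / \<delta>) *\<^sub>R x \<in> unit_cell z}" for z
  have [measurable]: "D z \<in> sets borel" for z unfolding D_def by (rule sets_scaled_unit_cell)
  have H: "0 \<le> H" using F[of 0] by linarith
  have b: "0 \<le> b" using bd[of 0 undefined] by linarith
  define c where "c z = (\<integral>\<^sup>+x\<in>cube \<rho>. ennreal (F x) * indicator (D z) x \<partial>lborel)" for z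
  have c_le: "c z \<le> ennreal (H * \<delta> ^ CARD('d))" for z
  proof -
    have "c z \<le> (\<integral>\<^sup>+x. ennreal H * indicator (D z) x \<partial>lborel)"
      unfolding c_def by (intro nn_integral_mono) (auto simp: indicator_def F ennreal_leI)
    also have "\<dots> = ennreal (H * \<delta> ^ CARD('d))"
      using H by (simp add: nn_integral_cmult_indicator D_def emeasure_scaled_unit_cell[OF pos(1)] ennreal_mult')
    finally show ?thesis .
  qed
  define C where "C z = enn2real (c z)" for z
  have cC: "c z = ennreal (C z)" for z
    unfolding C_def using le_less_trans[OF c_le[of z] ennreal_less_top] by simp
  have C0: "0 \<le> C z" for z by (simp add: C_def)
  have C1: "C z \<le> H * \<delta> ^ CARD('d)" for z
    using c_le[of z] H pos unfolding cC by (subst (asm) ennreal_le_iff) auto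
  have disj: "(\<Sum>z\<in>Z. f z * indicator (D z) x) = (if x \<in> D (cell_index ((1 / \<delta>) *\<^sub>R x)) then f (cell_index ((1 / \<delta>) *\<^sub>R x)) else 0)"
    if "x \<in> cube \<rho>" for x and f :: "int^'d \<Rightarrow> ennreal"
  proof -
    have "(\<Sum>z\<in>Z. f z * indicator (D z) x) = (\<Sum>z\<in>{cell_index ((1 / \<delta>) *\<^sub>R x)}. f z * indicator (D z) x)"
      using cell_index_scaled_cube[OF that pos(1)] Z
      by (intro sum.mono_neutral_right) (auto simp: Z_def D_def indicator_def dest: unit_cell_index split: if_splits)
    moreover have "sum g {a} = g a" for g :: "int^'d \<Rightarrow> ennreal" and a by simp
    ultimately show ?thesis by simp
  qed
  have sumC: "(\<Sum>z\<in>Z. C z) \<le> I"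
  proof -
    have "ennreal (\<Sum>z\<in>Z. C z) = (\<Sum>z\<in>Z. c z)" unfolding cC using C0 by simp
    also have "\<dots> = (\<integral>\<^sup>+x. (\<Sum>z\<in>Z. ennreal (F x) * indicator (D z) x * indicator (cube \<rho>) x) \<partial>lborel)"
      unfolding c_def by (subst nn_integral_sum) auto
    also have "\<dots> \<le> (\<integral>\<^sup>+x\<in>cube \<rho>. ennreal (F x) \<partial>lborel)"
      by (intro nn_integral_mono) (auto simp: sum_distrib_right[symmetric] disj indicator_def[of "cube \<rho>"])
    also note I(1)
    finally show ?thesis using I(2) by (subst (asm) ennreal_le_iff) auto
  qed
  define X where "X z \<omega> = (\<Theta> z \<omega> - 1) * C z" for z \<omega>
  have [measurable]: "X z \<in> borel_measurable N" for z unfolding X_def by measurable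
  have \<Theta>1: "\<bar>\<Theta> z \<omega> - 1\<bar> \<le> b + 1" for z \<omega> using bd[of z \<omega>] by (auto simp: abs_le_iff)
  have Xb: "\<bar>X z \<omega>\<bar> \<le> (b + 1) * C z" for z \<omega>
    unfolding X_def abs_mult using \<Theta>1 C0 by (auto intro!: mult_right_mono)
  have int: "integrable N (\<Theta> z)" for z
    by (rule N.integrable_const_bound[of _ b]) (use bd in auto)
  have intX: "integrable N (X z)" for z
    by (rule N.integrable_const_bound[of _ "(b + 1) * C z"]) (use Xb in auto)
  have EX: "N.expectation (X z) = 0" for z
    unfolding X_def using int mean N.prob_space by simp
  have uncorr: "N.expectation (\<lambda>\<omega>. X z \<omega> * X z' \<omega>) = 0" if "z \<noteq> z'" for z z'
  proof -
    have "N.indep_vars (\<lambda>_. borel) (\<lambda>z. (\<lambda>u. (u - 1) * C z) \<circ> \<Theta> z) UNIV"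
      by (rule N.indep_vars_compose[OF indep]) auto
    then have "N.indep_vars (\<lambda>_. borel) X {z, z'}"
      using N.indep_vars_subset by (fastforce simp: X_def[abs_def] comp_def)
    then have "N.expectation (\<lambda>\<omega>. \<Prod>y\<in>{z, z'}. X y \<omega>) = (\<Prod>y\<in>{z, z'}. N.expectation (X y))"
      by (intro N.indep_vars_lebesgue_integral intX) auto
    then show ?thesis using that EX by simp
  qed
  define Y where "Y \<omega> = (\<Sum>z\<in>Z. X z \<omega>)" for \<omega>
  have [measurable]: "Y \<in> borel_measurable N" unfolding Y_def by measurable
  have "N.expectation (\<lambda>\<omega>. (Y \<omega>)\<^sup>2) = (\<Sum>z\<in>Z. N.expectation (\<lambda>\<omega>. (X z \<omega>)\<^sup>2))"
    unfolding Y_def by (rule N.expectation_uncorrelated_sum_square[OF Z _ Xb uncorr]) auto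
  also have "\<dots> \<le> (\<Sum>z\<in>Z. (b + 1)\<^sup>2 * (H * \<delta> ^ CARD('d)) * C z)"
  proof (rule sum_mono)
    fix z
    have sq: "(X z \<omega>)\<^sup>2 \<le> (b + 1)\<^sup>2 * (H * \<delta> ^ CARD('d)) * C z" for \<omega>
    proof -
      have "(X z \<omega>)\<^sup>2 \<le> ((b + 1) * C z)\<^sup>2" using Xb[of z \<omega>] by (metis abs_ge_zero power2_abs power_mono)
      also have "\<dots> = (b + 1)\<^sup>2 * C z * C z" by (simp add: power2_eq_square)
      \<comment> \<open>One of the two factors \<open>C z\<close> is bounded by the largest cell
        mass; the other is kept for the summation.\<close>
      also have "\<dots> \<le> (b + 1)\<^sup>2 * (H * \<delta> ^ CARD('d)) * C z"
        using C0 C1 by (intro mult_right_mono mult_left_mono) auto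
      finally show ?thesis .
    qed
    have "N.expectation (\<lambda>\<omega>. (X z \<omega>)\<^sup>2) \<le> N.expectation (\<lambda>_. (b + 1)\<^sup>2 * (H * \<delta> ^ CARD('d)) * C z)"
      by (intro integral_mono N.integrable_const_bound[of _ "(b + 1)\<^sup>2 * (H * \<delta> ^ CARD('d)) * C z"]) (use sq H C0 pos in auto)
    then show "N.expectation (\<lambda>\<omega>. (X z \<omega>)\<^sup>2) \<le> (b + 1)\<^sup>2 * (H * \<delta> ^ CARD('d)) * C z"
      by (simp add: N.prob_space)
  qed
  also have "\<dots> \<le> (b + 1)\<^sup>2 * (H * \<delta> ^ CARD('d)) * I"
    using sumC H pos by (simp add: sum_distrib_left[symmetric] mult_left_mono)
  finally have EY2: "N.expectation (\<lambda>\<omega>. (Y \<omega>)\<^sup>2) \<le> (b + 1)\<^sup>2 * H * \<delta> ^ CARD('d) * I" by (simp add: mult.assoc)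
  define K where "K = (\<Sum>z\<in>Z. (b + 1) * C z)"
  have YK: "\<bar>Y \<omega>\<bar> \<le> K" for \<omega> unfolding Y_def K_def by (intro order_trans[OF sum_abs] sum_mono Xb)
  have intY: "integrable N Y" by (rule N.integrable_const_bound[of _ K]) (use YK in auto)
  have intY2: "integrable N (\<lambda>\<omega>. (Y \<omega>)\<^sup>2)"
    by (rule N.integrable_const_bound[of _ "K\<^sup>2"]) (use YK in \<open>auto simp: abs_le_square_iff[symmetric] intro!: AE_I2 order_trans[OF _ abs_ge_self]\<close>)
  have EY: "N.expectation Y = 0" unfolding Y_def
    by (subst Bochner_Integration.integral_sum) (auto simp: EX intX)
  have cheb: "N.prob {\<omega> \<in> space N. t \<le> \<bar>Y \<omega>\<bar>} \<le> N.variance Y / t\<^sup>2"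
    using N.Chebyshev_inequality[of Y t] intY2 pos EY by simp
  define G where "G = {\<omega> \<in> space N. \<bar>Y \<omega>\<bar> < t}"
  have [measurable]: "G \<in> sets N" unfolding G_def by measurable
  have "N.prob G = 1 - N.prob {\<omega> \<in> space N. t \<le> \<bar>Y \<omega>\<bar>}"
    unfolding G_def by (subst N.prob_neg[symmetric]) (auto simp: not_le)
  also have "\<dots> \<ge> 1 - (b + 1)\<^sup>2 * H * \<delta> ^ CARD('d) * I / t\<^sup>2"
    using cheb EY EY2 divide_right_mono[OF EY2, of "t\<^sup>2"] by simp
  finally have "1 - (b + 1)\<^sup>2 * H * \<delta> ^ CARD('d) * I / t\<^sup>2 \<le> N.prob G" .
  moreover have "(\<integral>\<^sup>+x\<in>cube \<rho>. ennreal (checkerboard_field \<Theta> ((1 / \<delta>) *\<^sub>R x) \<omega> * F x) \<partial>lborel) \<le> ennreal (I + t)"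
    if "\<omega> \<in> G" for \<omega>
  proof -
    have "(\<integral>\<^sup>+x\<in>cube \<rho>. ennreal (checkerboard_field \<Theta> ((1 / \<delta>) *\<^sub>R x) \<omega> * F x) \<partial>lborel) =
        (\<integral>\<^sup>+x. (\<Sum>z\<in>Z. ennreal (\<Theta> z \<omega>) * (ennreal (F x) * indicator (D z) x * indicator (cube \<rho>) x)) \<partial>lborel)"
    proof (rule nn_integral_cong)
      fix x :: "real^'d"
      have "(\<Sum>z\<in>Z. ennreal (\<Theta> z \<omega>) * (ennreal (F x) * indicator (D z) x * indicator (cube \<rho>) x)) =
          (\<Sum>z\<in>Z. ennreal (\<Theta> z \<omega>) * indicator (D z) x) * (ennreal (F x) * indicator (cube \<rho>) x)"
        by (simp add: sum_distrib_right sum_distrib_left mult_ac)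
      then show "ennreal (checkerboard_field \<Theta> ((1 / \<delta>) *\<^sub>R x) \<omega> * F x) * indicator (cube \<rho>) x =
          (\<Sum>z\<in>Z. ennreal (\<Theta> z \<omega>) * (ennreal (F x) * indicator (D z) x * indicator (cube \<rho>) x))"
        using disj[of x "\<lambda>z. ennreal (\<Theta> z \<omega>)"] bd F
        by (cases "x \<in> cube \<rho>") (auto simp: checkerboard_field_eq ennreal_mult D_def[of "cell_index _"])
    qed
    also have "\<dots> = (\<Sum>z\<in>Z. ennreal (\<Theta> z \<omega>) * c z)"
      unfolding c_def by (subst nn_integral_sum) (auto simp: nn_integral_cmult)
    also have "\<dots> = ennreal (\<Sum>z\<in>Z. \<Theta> z \<omega> * C z)"
      unfolding cC using bd C0 by (simp add: ennreal_mult[symmetric] sum_nonneg)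
    also have "(\<Sum>z\<in>Z. \<Theta> z \<omega> * C z) = (\<Sum>z\<in>Z. C z) + Y \<omega>"
      unfolding Y_def X_def by (simp add: left_diff_distrib sum_subtractf)
    also have "\<dots> \<le> I + t" using sumC that by (auto simp: G_def)
    finally show ?thesis by (simp add: ennreal_leI)
  qed
  ultimately show ?thesis by (intro that[of G]) auto
qed

section \<open>Measurability of the surface tension\<close>

text \<open>Common form of the checkerboard and the product field at a frozen sample point: all
  randomness sits in the cell values \<open>p\<close>.\<close>

definition cellwise :: "(int^'d \<Rightarrow> real) \<Rightarrow> real^'d \<Rightarrow> real" where
  "cellwise p y = (if y \<in> unit_cell (cell_index y) then p (cell_index y) else 0)"

lemma measurable_cell_index [measurable]:
  "(cell_index :: real^'d::finite \<Rightarrow> _) \<in> measurable borel (count_space UNIV)"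
proof -
  have "cell_index -` {z} \<inter> space borel \<in> sets borel" for z :: "int^'d"
  proof -
    have "cell_index -` {z} = {x :: real^'d. \<forall>i. x $ i \<in> {of_int (z $ i) - 1/2 ..< of_int (z $ i) + 1/2}}"
    proof -
      have "\<lfloor>t + 1/2\<rfloor> = j \<longleftrightarrow> t \<in> {of_int j - 1/2 ..< of_int j + 1/2}" for t :: real and j
        unfolding floor_eq_iff atLeastLessThan_iff by linarith
      then show ?thesis by (simp add: cell_index_def vec_eq_iff vimage_def)
    qed
    then show ?thesis using sets_vec_box[of "\<lambda>i. {of_int (z $ i) - 1/2 ..< of_int (z $ i) + 1/2}"] by simp
  qed
  then show ?thesis by (intro measurable_count_space_eq_countable[THEN iffD2]) auto
qed

lemma borel_measurable_cellwise [measurable]: "cellwise p \<in> borel_measurable (borel :: (real^'d::finite) measure)"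
proof -
  have "{y :: real^'d. y \<in> unit_cell (cell_index y)} = (\<Union>z. unit_cell z)"
    by (auto dest: unit_cell_index)
  then have "open {y :: real^'d. y \<in> unit_cell (cell_index y)}" using open_unit_cell by auto
  then have [measurable]: "Measurable.pred borel (\<lambda>y :: real^'d. y \<in> unit_cell (cell_index y))"
    by (simp add: pred_def)
  have [measurable]: "(\<lambda>y :: real^'d. p (cell_index y)) \<in> borel_measurable borel"
    by (rule measurable_compose[OF measurable_cell_index]) auto
  show ?thesis unfolding cellwise_def[abs_def] by measurable
qed

lemma energy_mono:
  assumes "0 < \<epsilon>" "\<And>u. 0 \<le> W u" "\<And>x. x \<in> Q \<Longrightarrow> \<theta> ((1 / \<delta>) *\<^sub>R x) \<le> \<theta>' ((1 / \<delta>) *\<^sub>R x)"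
  shows "energy W \<theta> \<epsilon> \<delta> Q u g \<le> energy W \<theta>' \<epsilon> \<delta> Q u g"
  unfolding energy_def
  using assms by (intro nn_integral_mono) (auto simp: indicator_def intro!: ennreal_leI add_left_mono mult_right_mono divide_right_mono)

lemma dirichlet_class_measurable:
  assumes "(u, g) \<in> dirichlet_class U w"
  shows "u \<in> borel_measurable borel" "g \<in> borel_measurable borel"
proof -
  from assms obtain Dw v h where *: "C1_with_gradient w Dw" "H10 U v h"
    "u = (\<lambda>x. w x + v x)" "g = (\<lambda>x. Dw x + h x)" by (auto simp: dirichlet_class_def)
  have [measurable]: "w \<in> borel_measurable borel" "Dw \<in> borel_measurable borel"
    using C1_with_gradient_continuous[OF *(1)] *(1) unfolding C1_with_gradient_def
    by (auto intro: borel_measurable_continuous_onI)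
  have [measurable]: "v \<in> borel_measurable borel" "h \<in> borel_measurable borel"
    using *(2) by (auto simp: H10_def)
  show "u \<in> borel_measurable borel" "g \<in> borel_measurable borel" unfolding * by measurable
qed

text \<open>The gradient term is nonnegative and \<open>k\<close> is at least 1, so multiplying that
  term by \<open>k\<close> as well only increases the right-hand side.\<close>

lemma energy_scale_le:
  fixes \<theta> :: "real^'d::finite \<Rightarrow> real"
  assumes "0 < \<epsilon>" "\<And>u. 0 \<le> W u" "1 \<le> k" "\<And>y. 0 \<le> \<theta> y"
    and [measurable]: "u \<in> borel_measurable borel" "g \<in> borel_measurable borel" "W \<in> borel_measurable borel"
      "\<theta> \<in> borel_measurable borel" "Q \<in> sets borel"
  shows "energy W (\<lambda>y. k * \<theta> y) \<epsilon> \<delta> Q u g \<le> ennreal k * energy W \<theta> \<epsilon> \<delta> Q u g"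
proof -
  have "energy W (\<lambda>y. k * \<theta> y) \<epsilon> \<delta> Q u g \<le>
    (\<integral>\<^sup>+x. ennreal k * (ennreal (\<epsilon> / 2 * (norm (g x))\<^sup>2 + 1 / \<epsilon> * \<theta> ((1 / \<delta>) *\<^sub>R x) * W (u x)) * indicator Q x) \<partial>lborel)"
    unfolding energy_def
  proof (rule nn_integral_mono)
    fix x
    have "\<epsilon> / 2 * (norm (g x))\<^sup>2 \<le> k * (\<epsilon> / 2 * (norm (g x))\<^sup>2)"
      using assms(1,3) mult_right_mono[of 1 k "\<epsilon> / 2 * (norm (g x))\<^sup>2"] by simp
    then have "\<epsilon> / 2 * (norm (g x))\<^sup>2 + 1 / \<epsilon> * (k * \<theta> ((1 / \<delta>) *\<^sub>R x)) * W (u x) \<le>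
        k * (\<epsilon> / 2 * (norm (g x))\<^sup>2 + 1 / \<epsilon> * \<theta> ((1 / \<delta>) *\<^sub>R x) * W (u x))"
      by (simp add: distrib_left mult_ac)
    then show "ennreal (\<epsilon> / 2 * (norm (g x))\<^sup>2 + 1 / \<epsilon> * (k * \<theta> ((1 / \<delta>) *\<^sub>R x)) * W (u x)) * indicator Q x \<le>
        ennreal k * (ennreal (\<epsilon> / 2 * (norm (g x))\<^sup>2 + 1 / \<epsilon> * \<theta> ((1 / \<delta>) *\<^sub>R x) * W (u x)) * indicator Q x)"
      using assms(3) by (simp add: indicator_def ennreal_mult'[symmetric] ennreal_leI)
  qed
  also have "\<dots> = ennreal k * energy W \<theta> \<epsilon> \<delta> Q u g"
    unfolding energy_def by (rule nn_integral_cmult) measurable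
  finally show ?thesis .
qed

text \<open>
  The infimum runs over an uncountable class, but it depends only on finitely many cell values, is
  monotone in them, and \<open>energy_scale_le\<close> makes it continuous from the right at positive values;
  so rational upper approximations of the cell values suffice.
\<close>

lemma surface_tension_measurable:
  fixes p :: "int^'d::finite \<Rightarrow> 'w \<Rightarrow> real"
  assumes [measurable]: "\<And>z. p z \<in> borel_measurable M" and p0: "\<And>z \<omega>. 0 < p z \<omega>"
    and W: "double_well W" and pos: "0 < \<epsilon>" "0 < \<delta>"
  shows "(\<lambda>\<omega>. surface_tension W q (cellwise (\<lambda>z. p z \<omega>)) \<epsilon> \<delta> e (cube \<rho>)) \<in> borel_measurable M"
proof (rule borel_measurableI_less)
  fix t :: ennreal
  define X where "X r = surface_tension W q (cellwise r) \<epsilon> \<delta> e (cube \<rho>)" for r :: "int^'d \<Rightarrow> real"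
  define Z where "Z = {z :: int^'d. \<forall>i. z $ i \<in> {-\<lceil>\<rho> / (2 * \<delta>) + 1\<rceil>..\<lceil>\<rho> / (2 * \<delta>) + 1\<rceil>}}"
  have Z: "finite Z" unfolding Z_def by (rule finite_int_vec_box)
  have W0: "\<And>u. 0 \<le> W u" and [measurable]: "W \<in> borel_measurable borel"
    using double_wellD[OF W] by (auto intro: borel_measurable_continuous_onI)
  have inZ: "cell_index ((1 / \<delta>) *\<^sub>R x) \<in> Z" if "x \<in> cube \<rho>" for x :: "real^'d"
    unfolding Z_def by (rule cell_index_scaled_cube[OF that pos(2)])
  have emono: "energy W (cellwise r) \<epsilon> \<delta> (cube \<rho>) u g \<le> energy W (cellwise r') \<epsilon> \<delta> (cube \<rho>) u g"
    if "\<And>z. z \<in> Z \<Longrightarrow> r z \<le> r' z" for r r' u g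
    using inZ that by (intro energy_mono pos W0) (simp add: cellwise_def)
  define R where "R = {r \<in> PiE Z (\<lambda>_. \<rat>). X r < t}"
  have "countable (PiE Z (\<lambda>_. \<rat> :: real set))" by (intro countable_PiE Z countable_rat)
  then have R: "countable R" unfolding R_def by (rule countable_subset[rotated]) auto
  have "{\<omega> \<in> space M. X (\<lambda>z. p z \<omega>) < t} = (\<Union>r\<in>R. {\<omega> \<in> space M. \<forall>z\<in>Z. p z \<omega> \<le> r z})"
  proof (intro equalityI subsetI)
    fix \<omega> assume "\<omega> \<in> {\<omega> \<in> space M. X (\<lambda>z. p z \<omega>) < t}"
    then have \<omega>: "\<omega> \<in> space M" and "X (\<lambda>z. p z \<omega>) < t" by auto
    then obtain u g where ug: "(u, g) \<in> dirichlet_class (interior (cube \<rho>)) (\<lambda>x. q ((x \<bullet> e) / \<epsilon>))"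
      and lt: "energy W (cellwise (\<lambda>z. p z \<omega>)) \<epsilon> \<delta> (cube \<rho>) u g < t"
      unfolding X_def surface_tension_def by (auto simp: INF_less_iff)
    define E where "E = energy W (cellwise (\<lambda>z. p z \<omega>)) \<epsilon> \<delta> (cube \<rho>) u g"
    \<comment> \<open>A finite level strictly between the energy and \<open>t\<close>, which may be
      infinite; the gap leaves room to raise the coefficients.\<close>
    obtain t1 where t1: "E < ennreal t1" "ennreal t1 < t" "0 \<le> t1"
    proof -
      obtain t' where "E < t'" "t' < t" using lt dense unfolding E_def by blast
      then have "ennreal (enn2real t') = t'" by (simp add: order.strict_trans2[OF _ top_greatest])
      then show ?thesis using that[of "enn2real t'"] \<open>E < t'\<close> \<open>t' < t\<close> by simp
    qed
    obtain E0 where E0: "E = ennreal E0" "0 \<le> E0" using t1(1) by (cases E) auto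
    \<comment> \<open>Adding 1 to numerator and denominator covers an energy equal to 0; both 1 < k
      and k * E0 \<le> t1 then follow from E0 < t1.\<close>
    define k where "k = (1 + t1) / (1 + E0)"
    have "E0 < t1" using t1 E0 by (simp add: ennreal_less_iff)
    then have k: "1 < k" "k * E0 \<le> t1" using E0(2) t1(3) by (auto simp: k_def field_simps)
    have "\<exists>c\<in>\<rat>. p z \<omega> < c \<and> c < k * p z \<omega>" for z
      using Rats_dense_in_real[of "p z \<omega>" "k * p z \<omega>"] k(1) p0[of z \<omega>] by auto
    then obtain c where c: "\<And>z. c z \<in> \<rat>" "\<And>z. p z \<omega> < c z" "\<And>z. c z < k * p z \<omega>" by metis
    define r where "r = restrict c Z"
    have c0: "0 \<le> cellwise (\<lambda>z. p z \<omega>) y" for y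
      using p0 by (simp add: cellwise_def less_imp_le)
    note [measurable] = dirichlet_class_measurable[OF ug]
    have "X r \<le> energy W (cellwise r) \<epsilon> \<delta> (cube \<rho>) u g"
      unfolding X_def by (rule surface_tension_le_energy[OF ug])
    also have "\<dots> \<le> energy W (cellwise (\<lambda>z. k * p z \<omega>)) \<epsilon> \<delta> (cube \<rho>) u g"
      by (rule emono) (auto simp: r_def intro: less_imp_le c)
    also have "cellwise (\<lambda>z. k * p z \<omega>) = (\<lambda>y. k * cellwise (\<lambda>z. p z \<omega>) y)" by (auto simp: cellwise_def)
    also have "energy W (\<lambda>y. k * cellwise (\<lambda>z. p z \<omega>) y) \<epsilon> \<delta> (cube \<rho>) u g \<le> ennreal k * E"
      unfolding E_def using k c0 by (intro energy_scale_le pos W0) auto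
    also have "\<dots> \<le> ennreal t1" using k E0 by (simp add: ennreal_mult'[symmetric] ennreal_leI)
    also note t1(2)
    finally have "X r < t" .
    moreover have "r \<in> PiE Z (\<lambda>_. \<rat>)" using c(1) by (auto simp: r_def)
    ultimately have "r \<in> R" by (simp add: R_def)
    moreover have "\<forall>z\<in>Z. p z \<omega> \<le> r z" using c(2) by (auto simp: r_def less_imp_le)
    ultimately show "\<omega> \<in> (\<Union>r\<in>R. {\<omega> \<in> space M. \<forall>z\<in>Z. p z \<omega> \<le> r z})" using \<omega> by blast
  next
    fix \<omega> assume "\<omega> \<in> (\<Union>r\<in>R. {\<omega> \<in> space M. \<forall>z\<in>Z. p z \<omega> \<le> r z})"
    then obtain r where r: "X r < t" "\<omega> \<in> space M" "\<forall>z\<in>Z. p z \<omega> \<le> r z" by (auto simp: R_def)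
    have "X (\<lambda>z. p z \<omega>) \<le> X r"
      unfolding X_def surface_tension_def using r(3) by (intro INF_mono') (auto intro: emono)
    then show "\<omega> \<in> {\<omega> \<in> space M. X (\<lambda>z. p z \<omega>) < t}" using r by auto
  qed
  also have "\<dots> \<in> sets M"
    using R Z by (intro sets.countable_UN'' ) measurable
  finally show "{\<omega> \<in> space M. surface_tension W q (cellwise (\<lambda>z. p z \<omega>)) \<epsilon> \<delta> e (cube \<rho>) < t} \<in> sets M"
    unfolding X_def .
qed

section \<open>Ergodicity of the Bernoulli shift\<close>

definition shift :: "real \<Rightarrow> (real \<Rightarrow> 'a) \<Rightarrow> real \<Rightarrow> 'a" where
  "shift c s = (\<lambda>x. s (x + c))"

text \<open>The coordinates are indexed by the reals, in accordance with the sample space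
  \<open>real \<Rightarrow> real\<close> of the theorem; the stripe field will read only those at
  integers.\<close>

locale iid_field = prob_space \<mu> for \<mu> :: "real measure" +
  assumes sets_mu [measurable_cong]: "sets \<mu> = sets borel"
begin

sublocale P: product_prob_space "\<lambda>_ :: real. \<mu>" UNIV
  by unfold_locales

abbreviation "N \<equiv> PiM (UNIV :: real set) (\<lambda>_. \<mu>)"

lemma space_mu: "space \<mu> = UNIV" using sets_eq_imp_space_eq[OF sets_mu] by simp

lemma space_N: "space N = UNIV" by (simp add: space_PiM space_mu)

lemma prob_N_UNIV: "measure N UNIV = 1"
  using prob_space.prob_space[OF P.P.prob_space_axioms] by (simp add: space_N)

lemma shift_measurable [measurable]: "shift c \<in> measurable N N"
  unfolding shift_def[abs_def] by (rule measurable_PiM_single') (auto simp: space_mu)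

lemma distr_shift: "distr N N (shift c) = N"
proof -
  have "distr N (PiM UNIV (\<lambda>i. \<mu>)) (\<lambda>\<omega>. \<lambda>n\<in>UNIV. \<omega> (n + c)) = N"
    by (rule distr_PiM_reindex) (auto intro: prob_space_axioms simp: inj_on_def)
  then show ?thesis by (simp add: shift_def[abs_def] restrict_UNIV)
qed

lemma prob_shift: "A \<in> sets N \<Longrightarrow> P.prob (shift c -` A) = P.prob A"
  using measure_distr[of "shift c" N N A] by (simp add: distr_shift space_N)

lemma prob_cylinder:
  assumes "finite J" "\<And>j. j \<in> J \<Longrightarrow> A j \<in> sets borel"
  shows "P.prob {s. \<forall>j\<in>J. s j \<in> A j} = (\<Prod>j\<in>J. prob (A j))"
  using P.measure_PiM_emb[of J A] assms
  by (simp add: prod_emb_def space_N sets_mu PiE_iff vimage_def Int_def space_mu)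

text \<open>
  Translates of a cylinder event far apart are independent, hence the sum \<open>Y\<close> of \<open>m\<close> centred
  translates has second moment at most \<open>m\<close>; integrating \<open>Y\<close> over an invariant event gives
  \<open>m\<close> times the covariance of the two events.
\<close>

lemma invariant_event_independent_of_cylinder:
  assumes E: "E \<in> sets N" "\<And>k::int. shift (of_int k) -` E = E"
    and J: "finite J" "\<And>j. j \<in> J \<Longrightarrow> A j \<in> sets borel"
  defines "C \<equiv> {s. \<forall>j\<in>J. s j \<in> A j}"
  shows "P.prob (E \<inter> C) = P.prob E * P.prob C"
proof -
  have C[measurable]: "C \<in> sets N"
  proof -
    have "{s \<in> space N. \<forall>j\<in>J. s j \<in> A j} \<in> sets N" using J by measurable
    then show ?thesis by (simp add: C_def space_N)
  qed
  note [measurable] = E(1)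
  obtain b where b: "\<And>j. j \<in> J \<Longrightarrow> \<bar>j\<bar> \<le> b"
    using finite_imp_bounded[OF J(1)] by (auto simp: bounded_real)
  \<comment> \<open>Translations by distinct multiples of \<open>L\<close> move the index set
    \<open>J\<close> to disjoint sets, since \<open>J\<close> has diameter at most 2 * b.\<close>
  define L where "L = \<lceil>2 * \<bar>b\<bar> + 1\<rceil>"
  have L: "2 * \<bar>b\<bar> + 1 \<le> of_int L" by (simp add: L_def)
  define c where "c k = (of_int (L * int k) :: real)" for k :: nat
  have far: "2 * \<bar>b\<bar> < \<bar>c k - c k'\<bar>" if "k \<noteq> k'" for k k'
  proof -
    have "1 \<le> \<bar>int k - int k'\<bar>" using that by auto
    then have "1 \<le> \<bar>of_int (int k - int k') :: real\<bar>" by linarith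
    then have "of_int L * 1 \<le> of_int L * \<bar>of_int (int k - int k') :: real\<bar>"
      using L by (intro mult_left_mono) auto
    also have "\<dots> = \<bar>c k - c k'\<bar>" using L by (simp add: c_def abs_mult flip: right_diff_distrib)
    finally show ?thesis using L by linarith
  qed
  define Ck where "Ck k = shift (c k) -` C" for k
  have [measurable]: "Ck k \<in> sets N" for k
    using measurable_sets[OF shift_measurable C, of "c k"] by (simp add: Ck_def space_N)
  have PCk: "P.prob (Ck k) = P.prob C" for k unfolding Ck_def by (rule prob_shift[OF C])
  \<comment> \<open>As \<open>E\<close> is invariant, E \<inter> Ck is the preimage of E \<inter> C
    under a measure preserving map.\<close>
  have PECk: "P.prob (E \<inter> Ck k) = P.prob (E \<inter> C)" for k
    using prob_shift[of "E \<inter> C" "c k"] E(2)[of "L * int k"] by (simp add: Ck_def c_def)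
  have PCC: "P.prob (Ck k \<inter> Ck k') = P.prob C * P.prob C" if "k \<noteq> k'" for k k'
  proof -
    define K where "K k = (\<lambda>j. j + c k) ` J" for k
    have disj: "K k \<inter> K k' = {}"
    proof (rule ccontr)
      assume "K k \<inter> K k' \<noteq> {}"
      then obtain j j' where "j \<in> J" "j' \<in> J" "j + c k = j' + c k'" by (auto simp: K_def)
      then show False using far[OF that] b[of j] b[of j'] by linarith
    qed
    \<comment> \<open>Disjointness of the two translated index sets lets one family of sides
      describe both events, so their intersection is again a cylinder.\<close>
    define B where "B j = (if j \<in> K k then A (j - c k) else A (j - c k'))" for j
    have "Ck k \<inter> Ck k' = {s. \<forall>j\<in>K k \<union> K k'. s j \<in> B j}"
    proof -
      have B1: "B (j + c k) = A j" if "j \<in> J" for j using that by (simp add: B_def K_def)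
      have "j + c k' \<notin> K k" if "j \<in> J" for j using that disj by (auto simp: K_def)
      then have B2: "B (j + c k') = A j" if "j \<in> J" for j using that by (simp add: B_def)
      show ?thesis by (auto simp: Ck_def C_def K_def shift_def ball_Un B1 B2)
    qed
    also have "P.prob \<dots> = (\<Prod>j\<in>K k \<union> K k'. prob (B j))"
      by (rule prob_cylinder) (use J in \<open>auto simp: K_def B_def\<close>)
    also have "\<dots> = (\<Prod>j\<in>K k. prob (B j)) * (\<Prod>j\<in>K k'. prob (B j))"
      using disj J by (intro prod.union_disjoint) (auto simp: K_def)
    also have "(\<Prod>j\<in>K k. prob (B j)) = (\<Prod>j\<in>K k. prob (A (j - c k)))"
      by (intro prod.cong) (auto simp: B_def)
    also have "(\<Prod>j\<in>K k'. prob (B j)) = (\<Prod>j\<in>K k'. prob (A (j - c k')))"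
      using disj by (intro prod.cong) (auto simp: B_def)
    finally have "P.prob (Ck k \<inter> Ck k') = (\<Prod>j\<in>K k. prob (A (j - c k))) * (\<Prod>j\<in>K k'. prob (A (j - c k')))" .
    moreover have "(\<Prod>j\<in>K k. prob (A (j - c k))) = P.prob C" for k
      using prob_cylinder[OF J] unfolding K_def C_def by (subst prod.reindex) (auto simp: inj_on_def)
    ultimately show ?thesis by simp
  qed
  define X where "X k s = indicator (Ck k) s - P.prob C" for k and s :: "real \<Rightarrow> real"
  have [measurable]: "X k \<in> borel_measurable N" for k unfolding X_def by measurable
  have Xb: "\<bar>X k s\<bar> \<le> 1" for k s
    unfolding X_def using P.prob_le_1[of C] measure_nonneg[of N C] by (auto simp: indicator_def)
  have uncorr: "P.expectation (\<lambda>s. X k s * X k' s) = 0" if "k \<noteq> k'" for k k'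
  proof -
    have "P.expectation (\<lambda>s. X k s * X k' s) = P.expectation (\<lambda>s. indicator (Ck k \<inter> Ck k') s
        - P.prob C * indicator (Ck k) s - P.prob C * indicator (Ck k') s + P.prob C * P.prob C)"
      by (intro Bochner_Integration.integral_cong) (auto simp: X_def indicator_def algebra_simps)
    also have "\<dots> = 0"
      using PCC[OF that] by (simp add: PCk space_N P.emeasure_eq_measure prob_N_UNIV)
    finally show ?thesis .
  qed
  define d where "d = P.prob (E \<inter> C) - P.prob E * P.prob C"
  have EX: "P.expectation (\<lambda>s. indicator E s * X k s) = d" for k
  proof -
    have "P.expectation (\<lambda>s. indicator E s * X k s) = P.expectation (\<lambda>s. indicator (E \<inter> Ck k) s - P.prob C * indicator E s)"
      by (intro Bochner_Integration.integral_cong) (auto simp: X_def indicator_def)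
    also have "\<dots> = d" by (simp add: PECk d_def P.emeasure_eq_measure space_N mult.commute)
    finally show ?thesis .
  qed
  \<comment> \<open>The inequality 2 a |Y| \<le> Y^2 + a^2 takes the place of the Cauchy-Schwarz
    inequality.\<close>
  have bound: "real m * \<bar>d\<bar> * (2 * a) \<le> real m + a\<^sup>2" if "0 < a" for m a
  proof -
    define Y where "Y s = (\<Sum>k<m. X k s)" for s
    have [measurable]: "Y \<in> borel_measurable N" unfolding Y_def by measurable
    have Yb: "\<bar>Y s\<bar> \<le> real m" for s
    proof -
      have "\<bar>Y s\<bar> \<le> (\<Sum>k<m. \<bar>X k s\<bar>)" unfolding Y_def by (rule sum_abs)
      also have "\<dots> \<le> (\<Sum>k<m. 1)" by (intro sum_mono Xb)
      finally show ?thesis by simp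
    qed
    have "P.expectation (\<lambda>s. (Y s)\<^sup>2) = (\<Sum>k<m. P.expectation (\<lambda>s. (X k s)\<^sup>2))"
      unfolding Y_def by (rule P.expectation_uncorrelated_sum_square[of _ _ "\<lambda>_. 1"]) (use Xb uncorr in auto)
    also have "\<dots> \<le> (\<Sum>k<m. P.expectation (\<lambda>s. 1))"
      using Xb by (intro sum_mono integral_mono P.integrable_const_bound[of _ 1])
        (auto simp: abs_square_le_1)
    finally have Y2: "P.expectation (\<lambda>s. (Y s)\<^sup>2) \<le> real m" by (simp add: space_N prob_N_UNIV)
    have "integrable N (\<lambda>s. indicator E s * X k s)" for k
      by (rule P.integrable_const_bound[of _ 1]) (use Xb in \<open>auto simp: indicator_def\<close>)
    then have "P.expectation (\<lambda>s. \<Sum>k<m. indicator E s * X k s) = (\<Sum>k<m. P.expectation (\<lambda>s. indicator E s * X k s))"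
      by (rule Bochner_Integration.integral_sum)
    then have "real m * d = P.expectation (\<lambda>s. \<Sum>k<m. indicator E s * X k s)"
      unfolding EX by simp
    then have md: "real m * d = P.expectation (\<lambda>s. indicator E s * Y s)"
      by (simp add: Y_def sum_distrib_left)
    have "real m * \<bar>d\<bar> * (2 * a) = \<bar>P.expectation (\<lambda>s. indicator E s * Y s)\<bar> * (2 * a)"
      by (simp add: md[symmetric] abs_mult)
    also have "\<dots> \<le> P.expectation (\<lambda>s. \<bar>indicator E s * Y s\<bar>) * (2 * a)"
      using that integral_norm_bound[of N "\<lambda>s. indicator E s * Y s"] by (intro mult_right_mono) auto
    also have "\<dots> = P.expectation (\<lambda>s. \<bar>indicator E s * Y s\<bar> * (2 * a))" by simp
    also have "\<dots> \<le> P.expectation (\<lambda>s. (Y s)\<^sup>2 + a\<^sup>2)"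
    proof (intro integral_mono)
      show "integrable N (\<lambda>s. \<bar>indicator E s * Y s\<bar> * (2 * a))"
        by (rule P.integrable_const_bound[of _ "real m * (2 * a)"])
          (use Yb that in \<open>auto simp: indicator_def abs_mult intro!: mult_right_mono\<close>)
      show "integrable N (\<lambda>s. (Y s)\<^sup>2 + a\<^sup>2)"
        by (rule P.integrable_const_bound[of _ "(real m)\<^sup>2 + a\<^sup>2"])
          (use Yb in \<open>auto simp: abs_le_square_iff[symmetric] intro!: AE_I2 order_trans[OF Yb]\<close>)
      show "\<bar>indicator E s * Y s\<bar> * (2 * a) \<le> (Y s)\<^sup>2 + a\<^sup>2" for s
      proof -
        have "\<bar>indicator E s * Y s\<bar> * (2 * a) \<le> \<bar>Y s\<bar> * (2 * a)"
          using that by (intro mult_right_mono) (auto simp: indicator_def)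
        also have "\<dots> \<le> (Y s)\<^sup>2 + a\<^sup>2" using sum_squares_bound[of "\<bar>Y s\<bar>" a] by simp
        finally show ?thesis .
      qed
    qed
    also have "\<dots> = P.expectation (\<lambda>s. (Y s)\<^sup>2) + a\<^sup>2"
      using Yb by (subst Bochner_Integration.integral_add)
        (auto simp: space_N prob_N_UNIV abs_le_square_iff[symmetric] intro!: P.integrable_const_bound[of _ "(real m)\<^sup>2"] AE_I2 order_trans[OF Yb])
    finally show ?thesis using Y2 by linarith
  qed
  have "d = 0"
  proof (rule ccontr)
    assume "d \<noteq> 0"
    \<comment> \<open>With m = n^2 and a = n the bound reads 2 n^3 |d| \<le> 2 n^2, that is n |d|
      \<le> 1, which fails for large n.\<close>
    obtain n :: nat where n: "1 / \<bar>d\<bar> < real n" using reals_Archimedean2 by blast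
    then have n0: "0 < real n" using \<open>d \<noteq> 0\<close> by (smt (verit) zero_le_divide_1_iff abs_ge_zero)
    have "real (n * n) * \<bar>d\<bar> * (2 * real n) \<le> real (n * n) + (real n)\<^sup>2" by (rule bound[OF n0])
    then have "2 * (real n)\<^sup>2 * (\<bar>d\<bar> * real n) \<le> 2 * (real n)\<^sup>2 * 1" by (simp add: power2_eq_square algebra_simps)
    then have "\<bar>d\<bar> * real n \<le> 1" using n0 by (simp only: mult_le_cancel_left_pos zero_less_power mult_pos_pos zero_less_numeral)
    then show False using n \<open>d \<noteq> 0\<close> by (simp add: field_simps)
  qed
  then show ?thesis by (simp add: d_def)
qed

text \<open>Conditioning on an invariant event of positive probability does not change the
  probability of any cylinder, hence not the measure. But the conditional measure gives
  \<open>E\<close> itself probability 1.\<close>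

lemma ergodic_shift:
  assumes E: "E \<in> sets N" "\<And>k::int. shift (of_int k) -` E = E"
  shows "P.prob E \<in> {0, 1}"
proof (cases "P.prob E = 0")
  case False
  have ne: "emeasure N E \<noteq> 0" using False by (simp add: P.emeasure_eq_measure)
  have "uniform_measure N E = N"
  proof (rule measure_eqI_PiM_infinite)
    show "finite_measure (uniform_measure N E)"
      by (intro prob_space.finite_measure prob_space_uniform_measure ne) auto
    fix A and J :: "real set" assume J: "finite J" "J \<subseteq> UNIV" "\<And>i. i \<in> J \<Longrightarrow> A i \<in> sets \<mu>"
    define C where "C = {s :: real \<Rightarrow> real. \<forall>j\<in>J. s j \<in> A j}"
    have C: "prod_emb UNIV (\<lambda>_. \<mu>) J (Pi\<^sub>E J A) = C"
      by (auto simp: C_def prod_emb_def space_N PiE_iff space_mu)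
    have [measurable]: "C \<in> sets N" unfolding C[symmetric] using J by (intro sets_PiM_I) auto
    have "P.prob (E \<inter> C) = P.prob E * P.prob C"
      unfolding C_def by (rule invariant_event_independent_of_cylinder[OF E J(1)]) (use J sets_mu in auto)
    then show "emeasure (uniform_measure N E) (prod_emb UNIV (\<lambda>_. \<mu>) J (Pi\<^sub>E J A)) = emeasure N (prod_emb UNIV (\<lambda>_. \<mu>) J (Pi\<^sub>E J A))"
      unfolding C using E(1) False measure_nonneg[of N E]
      by (simp add: P.emeasure_eq_measure divide_ennreal less_le)
  qed simp_all
  then have "emeasure N E = 1" using emeasure_uniform_measure_1[OF ne] by simp
  then show ?thesis by (simp add: P.emeasure_eq_measure)
qed simp

end

section \<open>The stripe field\<close>

text \<open>The value 1 prevails wherever influences of several sites overlap. A single site with a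
  small variable thus produces a full run of ones around it, whatever the other sites do.\<close>

definition stripe :: "(int \<Rightarrow> real) \<Rightarrow> (real \<Rightarrow> real) \<Rightarrow> int \<Rightarrow> real" where
  "stripe h s j = (if \<exists>k. s (of_int k) < h (j - k) then 1 else 2)"

definition stripe_field :: "(int \<Rightarrow> real) \<Rightarrow> real \<Rightarrow> (real \<Rightarrow> real) \<Rightarrow> real" where
  "stripe_field h x s = stripe h s \<lfloor>x + 1 / 2\<rfloor>"

lemma stripe_range: "stripe h s j \<in> {1, 2}"
  by (simp add: stripe_def)

lemma stripe_shift: "stripe h (shift (of_int m) s) j = stripe h s (j + m)"
proof -
  have "(\<exists>k. s (of_int k + of_int m) < h (j - k)) \<longleftrightarrow> (\<exists>k. s (of_int k) < h (j + m - k))"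
  proof (intro iffI; elim exE)
    fix k assume "s (of_int k + of_int m) < h (j - k)"
    then show "\<exists>k. s (of_int k) < h (j + m - k)" by (intro exI[of _ "k + m"]) simp
  next
    fix k assume "s (of_int k) < h (j + m - k)"
    then show "\<exists>k. s (of_int k + of_int m) < h (j - k)" by (intro exI[of _ "k - m"]) (simp add: algebra_simps)
  qed
  then show ?thesis by (simp add: stripe_def shift_def)
qed

lemma stripe_field_shift: "stripe_field h x (shift (of_int m) s) = stripe_field h (x + of_int m) s"
proof -
  have "\<lfloor>x + of_int m + 1 / 2\<rfloor> = \<lfloor>x + 1 / 2\<rfloor> + m" by linarith
  then show ?thesis by (simp add: stripe_field_def stripe_shift)
qed

context iid_field
begin

lemma stripe_measurable [measurable]: "(\<lambda>s. stripe h s j) \<in> borel_measurable N"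
proof -
  have [measurable]: "(\<lambda>s. s (of_int k)) \<in> borel_measurable N" for k
    using measurable_component_singleton[of "of_int k" UNIV "\<lambda>_. \<mu>"] by (simp add: measurable_cong_sets[OF refl sets_mu])
  show ?thesis unfolding stripe_def by measurable
qed

lemma stripe_field_measurable [measurable]: "(\<lambda>(x, s). stripe_field h x s) \<in> borel_measurable (borel \<Otimes>\<^sub>M N)"
  unfolding stripe_field_def case_prod_beta
  by (rule measurable_compose_countable[where g = "\<lambda>p. \<lfloor>fst p + 1 / 2\<rfloor>"]) measurable

lemma stripe_field_measurable_path: "(\<lambda>s x. stripe_field h x s) \<in> measurable N (PiM UNIV (\<lambda>_. borel))"
  by (rule measurable_PiM_single') (auto simp: stripe_field_def)

text \<open>The field is a factor of the Bernoulli shift: it intertwines integer translations in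
  space with shifts of the variables. Stationarity is then invariance of the product measure, and an
  invariant set of paths pulls back to a shift invariant event.\<close>

lemma stripe_field_stationary_ergodic: "stationary_ergodic_field N (stripe_field h)"
  unfolding stationary_ergodic_field_def
proof (intro conjI allI ballI impI)
  show "prob_space N" by (rule P.prob_space_axioms)
  show "case_prod (stripe_field h) \<in> borel_measurable (borel \<Otimes>\<^sub>M N)" by (rule stripe_field_measurable)
  show "\<exists>a b. 0 < a \<and> (AE \<omega> in N. \<forall>x. a \<le> stripe_field h x \<omega> \<and> stripe_field h x \<omega> \<le> b)"
    by (intro exI[of _ 1] exI[of _ 2]) (auto simp: stripe_field_def stripe_def)
next
  fix k :: int
  have "distr N (PiM UNIV (\<lambda>_. borel)) (\<lambda>s x. stripe_field h x s) =
      distr (distr N N (shift (of_int k))) (PiM UNIV (\<lambda>_. borel)) (\<lambda>s x. stripe_field h x s)"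
    by (simp add: distr_shift)
  also have "\<dots> = distr N (PiM UNIV (\<lambda>_. borel)) (\<lambda>s x. stripe_field h (x + of_int k) s)"
    by (subst distr_distr[OF stripe_field_measurable_path shift_measurable]) (simp add: comp_def stripe_field_shift)
  finally show "distr N (PiM UNIV (\<lambda>_. borel)) (\<lambda>\<omega> x. stripe_field h (x + of_int k) \<omega>) =
      distr N (PiM UNIV (\<lambda>_. borel)) (\<lambda>\<omega> x. stripe_field h x \<omega>)" ..
next
  fix A :: "(real \<Rightarrow> real) set"
  assume A: "A \<in> sets (PiM UNIV (\<lambda>_. borel))" "\<forall>(k::int) f. ((\<lambda>x. f (x + of_int k)) \<in> A) = (f \<in> A)"
  define E where "E = {\<omega> \<in> space N. (\<lambda>x. stripe_field h x \<omega>) \<in> A}"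
  have "E \<in> sets N" using measurable_sets[OF stripe_field_measurable_path A(1), of h] by (simp add: E_def vimage_def Int_def conj_commute)
  moreover have "shift (of_int k) -` E = E" for k :: int
  proof (rule set_eqI)
    fix s
    show "s \<in> shift (of_int k) -` E \<longleftrightarrow> s \<in> E"
      using A(2)[THEN spec, of k, THEN spec, of "\<lambda>x. stripe_field h x s"] by (simp add: E_def space_N stripe_field_shift)
  qed
  ultimately show "P.prob {\<omega> \<in> space N. (\<lambda>x. stripe_field h x \<omega>) \<in> A} \<in> {0, 1}"
    unfolding E_def[symmetric] by (rule ergodic_shift)
qed

end

text \<open>Both properties concern only the law of the path, which is unchanged when an independent
  second component is adjoined.\<close>

lemma stationary_ergodic_field_fst:
  assumes S: "stationary_ergodic_field N1 S" and "prob_space N2"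
    and path: "(\<lambda>s x. S x s) \<in> measurable N1 (PiM UNIV (\<lambda>_. borel))"
  shows "stationary_ergodic_field (N1 \<Otimes>\<^sub>M N2) (\<lambda>x \<omega>. S x (fst \<omega>))"
proof -
  interpret N1: prob_space N1 using S by (simp add: stationary_ergodic_field_def)
  interpret N2: prob_space N2 by fact
  interpret N12: pair_prob_space N1 N2 by unfold_locales
  note S' = S[unfolded stationary_ergodic_field_def]
  have [measurable]: "case_prod S \<in> borel_measurable (borel \<Otimes>\<^sub>M N1)" using S' by auto
  have dfst: "distr (N1 \<Otimes>\<^sub>M N2) N1 fst = N1" by (rule N2.distr_pair_fst)
  have Sx[measurable]: "S x \<in> borel_measurable N1" for x
    using measurable_component_singleton[of x UNIV "\<lambda>_. borel"] path by (auto dest: measurable_compose)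
  have law: "distr (N1 \<Otimes>\<^sub>M N2) (PiM UNIV (\<lambda>_. borel)) (\<lambda>\<omega> x. S (f x) (fst \<omega>)) =
      distr N1 (PiM UNIV (\<lambda>_. borel)) (\<lambda>s x. S (f x) s)" for f :: "real \<Rightarrow> real"
  proof -
    have "(\<lambda>s x. S (f x) s) \<in> measurable N1 (PiM UNIV (\<lambda>_. borel))"
      by (rule measurable_PiM_single') auto
    from distr_distr[OF this, of fst "N1 \<Otimes>\<^sub>M N2"] show ?thesis by (simp add: dfst comp_def)
  qed
  show ?thesis
    unfolding stationary_ergodic_field_def
  proof (intro conjI allI ballI impI)
    show "prob_space (N1 \<Otimes>\<^sub>M N2)" by unfold_locales
    have "(\<lambda>p. case_prod S (fst p, fst (snd p))) \<in> borel_measurable (borel \<Otimes>\<^sub>M (N1 \<Otimes>\<^sub>M N2))" by measurable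
    then show "case_prod (\<lambda>x \<omega>. S x (fst \<omega>)) \<in> borel_measurable (borel \<Otimes>\<^sub>M (N1 \<Otimes>\<^sub>M N2))"
      by (simp add: case_prod_beta)
    obtain a b where ab: "0 < a" "AE \<omega> in N1. \<forall>x. a \<le> S x \<omega> \<and> S x \<omega> \<le> b" using S' by auto
    have "AE \<omega> in distr (N1 \<Otimes>\<^sub>M N2) N1 fst. \<forall>x. a \<le> S x \<omega> \<and> S x \<omega> \<le> b" unfolding dfst by (rule ab(2))
    then have "AE \<omega> in N1 \<Otimes>\<^sub>M N2. \<forall>x. a \<le> S x (fst \<omega>) \<and> S x (fst \<omega>) \<le> b"
      by (rule AE_distrD[rotated]) auto
    then show "\<exists>a b. 0 < a \<and> (AE \<omega> in N1 \<Otimes>\<^sub>M N2. \<forall>x. a \<le> S x (fst \<omega>) \<and> S x (fst \<omega>) \<le> b)"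
      using ab by blast
  next
    fix k :: int
    show "distr (N1 \<Otimes>\<^sub>M N2) (PiM UNIV (\<lambda>_. borel)) (\<lambda>\<omega> x. S (x + of_int k) (fst \<omega>)) =
      distr (N1 \<Otimes>\<^sub>M N2) (PiM UNIV (\<lambda>_. borel)) (\<lambda>\<omega> x. S x (fst \<omega>))"
      using law[of "\<lambda>x. x + of_int k"] law[of "\<lambda>x. x"] S' by simp
  next
    fix A :: "(real \<Rightarrow> real) set"
    assume A: "A \<in> sets (PiM UNIV (\<lambda>_. borel))" "\<forall>(k::int) f. ((\<lambda>x. f (x + of_int k)) \<in> A) = (f \<in> A)"
    have E: "{\<omega> \<in> space N1. (\<lambda>x. S x \<omega>) \<in> A} \<in> sets N1"
      using measurable_sets[OF path A(1)] by (simp add: vimage_def Int_def conj_commute)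
    have "measure (N1 \<Otimes>\<^sub>M N2) {\<omega> \<in> space (N1 \<Otimes>\<^sub>M N2). (\<lambda>x. S x (fst \<omega>)) \<in> A} =
        measure (distr (N1 \<Otimes>\<^sub>M N2) N1 fst) {\<omega> \<in> space N1. (\<lambda>x. S x \<omega>) \<in> A}"
      by (subst measure_distr[OF measurable_fst E]) (auto intro!: arg_cong[where f = "measure _"] simp: space_pair_measure)
    also have "\<dots> = measure N1 {\<omega> \<in> space N1. (\<lambda>x. S x \<omega>) \<in> A}" by (simp add: dfst)
    finally show "measure (N1 \<Otimes>\<^sub>M N2) {\<omega> \<in> space (N1 \<Otimes>\<^sub>M N2). (\<lambda>x. S x (fst \<omega>)) \<in> A} \<in> {0, 1}"
      using S' A by simp
  qed
qed

section \<open>Frequency of ones and long runs\<close>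

definition unit_uniform :: "real measure" where
  "unit_uniform = uniform_measure lborel {0..1}"

interpretation U: iid_field unit_uniform
proof -
  interpret prob_space unit_uniform
    unfolding unit_uniform_def by (rule prob_space_uniform_measure) auto
  show "iid_field unit_uniform" by unfold_locales (simp add: unit_uniform_def)
qed

lemma unit_uniform_lessThan: "0 \<le> t \<Longrightarrow> t \<le> 1 \<Longrightarrow> measure unit_uniform {..<t} = t"
proof -
  assume t: "0 \<le> t" "t \<le> 1"
  then have "{0..1} \<inter> {..<t} = (if t = 1 then {0..<1} else {0..<t})" by auto
  then show ?thesis using t by (auto simp: unit_uniform_def measure_uniform_measure)
qed

lemma unit_uniform_atLeast: "0 \<le> t \<Longrightarrow> t \<le> 1 \<Longrightarrow> measure unit_uniform {t..} = 1 - t"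
  using U.prob_compl[of "{..<t}"] unit_uniform_lessThan[of t] by (simp add: U.sets_mu U.space_mu Compl_eq_Diff_UNIV[symmetric])

text \<open>What is demanded of the influence of a site at distance |k|. Monotonicity in the
  distance makes the cells switched by a site an interval around it; positivity makes runs of any
  length possible; and the bound on the sum keeps the value 1 from having full probability at a
  cell.\<close>

locale stripe_profile =
  fixes h :: "int \<Rightarrow> real"
  assumes h_pos: "0 < h k" and h_le_1: "h k \<le> 1" and h_antimono: "\<bar>k\<bar> \<le> \<bar>l\<bar> \<Longrightarrow> h l \<le> h k"
    and h_summable: "summable (\<lambda>n. h (int n))" and h_sum: "2 * (\<Sum>n. h (int n)) < 1"
begin

lemma prob_coordinate_less: "U.P.prob {s. s x < h k} = h k"
  using U.prob_cylinder[of "{x}" "\<lambda>_. {..<h k}"] unit_uniform_lessThan[of "h k"] h_pos[of k] h_le_1[of k] by simp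

lemma sets_coordinate_less [measurable]: "{s. s x < h k} \<in> sets U.N"
proof -
  have "{s \<in> space U.N. s x < h k} \<in> sets U.N" by measurable
  then show ?thesis by (simp add: U.space_N)
qed

lemma prob_stripe_one: "U.P.prob {s. stripe h s j = 1} < 1"
proof -
  \<comment> \<open>The sites at distance n on either side. For n = 0 they coincide, and counting
    this site twice is allowed for by the factor 2 in \<open>h_sum\<close>.\<close>
  define A where "A n = {s :: real \<Rightarrow> real. s (of_int (j + int n)) < h (- int n)} \<union> {s. s (of_int (j - int n)) < h (int n)}" for n
  have [measurable]: "A n \<in> sets U.N" for n unfolding A_def by (intro sets.Un sets_coordinate_less)
  have PA: "U.P.prob (A n) \<le> 2 * h (int n)" for n
  proof -
    have "U.P.prob (A n) \<le> h (- int n) + h (int n)"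
      unfolding A_def by (intro order_trans[OF measure_Un_le]) (auto simp: prob_coordinate_less intro: sets_coordinate_less)
    also have "h (- int n) \<le> h (int n)" by (rule h_antimono) simp
    finally show ?thesis by simp
  qed
  have sA: "summable (\<lambda>n. U.P.prob (A n))"
    by (rule summable_comparison_test'[OF summable_mult[OF h_summable, of 2]]) (use PA in simp)
  have "{s. stripe h s j = 1} \<subseteq> (\<Union>n. A n)"
  proof
    fix s assume "s \<in> {s. stripe h s j = 1}"
    then obtain k where k: "s (of_int k) < h (j - k)" by (auto simp: stripe_def split: if_splits)
    show "s \<in> (\<Union>n. A n)"
    proof (cases "j \<le> k")
      case True then show ?thesis using k by (intro UN_I[of "nat (k - j)"]) (auto simp: A_def)
    next
      case False then show ?thesis using k by (intro UN_I[of "nat (j - k)"]) (auto simp: A_def)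
    qed
  qed
  then have "U.P.prob {s. stripe h s j = 1} \<le> U.P.prob (\<Union>n. A n)"
    by (intro U.P.finite_measure_mono) auto
  also have "\<dots> \<le> (\<Sum>n. U.P.prob (A n))"
    by (rule U.P.finite_measure_subadditive_countably[OF _ sA]) auto
  also have "\<dots> \<le> (\<Sum>n. 2 * h (int n))"
    by (rule suminf_le[OF PA sA summable_mult[OF h_summable]])
  also have "\<dots> < 1" using h_sum suminf_mult[OF h_summable, of 2] by simp
  finally show ?thesis .
qed

text \<open>Each of the 2 m + 1 sites in [-m, m] starts a run of radius l with probability h(l),
  independently of the others; all of them fail with probability (1 - h(l))^(2 m + 1), and 1 - x
  \<le> exp (- x).\<close>

lemma long_stripe:
  fixes m l :: nat
  obtains G where "G \<in> sets U.N" "1 - exp (- (2 * real m + 1) * h (int l)) \<le> U.P.prob G"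
    "\<And>s. s \<in> G \<Longrightarrow> \<exists>k. \<bar>k\<bar> \<le> int m \<and> (\<forall>j. \<bar>j - k\<bar> \<le> int l \<longrightarrow> stripe h s j = 1)"
proof -
  define J where "J = (of_int ` {- int m..int m} :: real set)"
  define B where "B = {s :: real \<Rightarrow> real. \<forall>x\<in>J. s x \<in> {h (int l)..}}"
  have J: "finite J" "card J = 2 * m + 1"
    unfolding J_def by (simp_all add: card_image inj_on_def)
  have [measurable]: "B \<in> sets U.N"
  proof -
    have "{s \<in> space U.N. \<forall>x\<in>J. s x \<in> {h (int l)..}} \<in> sets U.N" using J(1) by measurable
    then show ?thesis by (simp add: B_def U.space_N)
  qed
  have "U.P.prob B = (1 - h (int l)) ^ (2 * m + 1)"
    unfolding B_def using h_pos h_le_1 J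
    by (subst U.prob_cylinder) (auto simp: unit_uniform_atLeast less_imp_le)
  also have "\<dots> \<le> exp (- h (int l)) ^ (2 * m + 1)"
    using exp_ge_add_one_self[of "- h (int l)"] h_le_1 by (intro power_mono) auto
  also have "\<dots> = exp (- (2 * real m + 1) * h (int l))"
    unfolding exp_of_nat_mult[symmetric] by (simp add: algebra_simps)
  finally have "1 - exp (- (2 * real m + 1) * h (int l)) \<le> U.P.prob (- B)"
    using U.P.prob_compl[of B] by (simp add: U.space_N Compl_eq_Diff_UNIV)
  moreover have "\<exists>k. \<bar>k\<bar> \<le> int m \<and> (\<forall>j. \<bar>j - k\<bar> \<le> int l \<longrightarrow> stripe h s j = 1)" if s: "s \<in> - B" for s
  proof -
    from s obtain k where k: "k \<in> {- int m..int m}" "s (of_int k) < h (int l)"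
      by (auto simp: B_def J_def not_le)
    have "stripe h s j = 1" if "\<bar>j - k\<bar> \<le> int l" for j
      using k(2) h_antimono[of "j - k" "int l"] that by (auto simp: stripe_def intro!: exI[of _ k])
    then show ?thesis using k(1) by (intro exI[of _ k]) auto
  qed
  moreover have "- B \<in> sets U.N" using sets.compl_sets[of B U.N] by (simp add: U.space_N Compl_eq_Diff_UNIV)
  ultimately show ?thesis by (intro that[of "- B"])
qed

end

section \<open>Laws, means and essential infimum of the two fields\<close>

lemma random_checkerboard_same_law:
  fixes \<Theta> :: "int^'d::finite \<Rightarrow> 'w \<Rightarrow> real" and \<Theta>\<^sub>0 :: "int^'d \<Rightarrow> 'v \<Rightarrow> real"
  assumes R: "random_checkerboard M\<^sub>0 \<Theta>\<^sub>0" and "prob_space M"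
    and m[measurable]: "\<And>z. \<Theta> z \<in> borel_measurable M"
    and law: "distr M (PiM UNIV (\<lambda>_. borel)) (\<lambda>\<omega> z. \<Theta> z \<omega>) =
      distr M\<^sub>0 (PiM UNIV (\<lambda>_. borel)) (\<lambda>\<omega> z. \<Theta>\<^sub>0 z \<omega>)"
  shows "distr M borel (\<Theta> z) = distr M\<^sub>0 borel (\<Theta>\<^sub>0 z)" and "random_checkerboard M \<Theta>"
proof -
  interpret M: prob_space M by fact
  interpret M0: prob_space M\<^sub>0 using R by (simp add: random_checkerboard_def)
  have indep: "M0.indep_vars (\<lambda>_. borel) \<Theta>\<^sub>0 UNIV" using R by (simp add: random_checkerboard_def)
  then have m0[measurable]: "\<Theta>\<^sub>0 z \<in> borel_measurable M\<^sub>0" for z unfolding M0.indep_vars_def by auto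
  have path: "(\<lambda>\<omega> z. \<Theta> z \<omega>) \<in> measurable M (PiM UNIV (\<lambda>_. borel))"
    "(\<lambda>\<omega> z. \<Theta>\<^sub>0 z \<omega>) \<in> measurable M\<^sub>0 (PiM UNIV (\<lambda>_. borel))"
    by (rule measurable_PiM_single'; auto)+
  have c: "(\<lambda>f. f z) \<in> borel_measurable (PiM UNIV (\<lambda>_. borel :: real measure))" for z :: "int^'d"
    by (rule measurable_component_singleton) auto
  show marg: "distr M borel (\<Theta> z) = distr M\<^sub>0 borel (\<Theta>\<^sub>0 z)" for z
    using distr_distr[OF c[of z] path(1)] distr_distr[OF c[of z] path(2)] by (simp add: comp_def law)
  \<comment> \<open>Independence says that the joint law is the product of the marginals, so it
    passes to any family with the same joint law.\<close>
  have "M.indep_vars (\<lambda>_. borel) \<Theta> UNIV"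
    using indep m m0
    by (simp add: M.indep_vars_iff_distr_eq_PiM M0.indep_vars_iff_distr_eq_PiM restrict_UNIV law marg)
  moreover have "distr M borel (\<Theta> z) = distr M borel (\<Theta> z')" for z z'
    using R unfolding marg random_checkerboard_def by blast
  moreover obtain a b where ab: "0 < a" "\<And>z. AE \<omega> in M\<^sub>0. a \<le> \<Theta>\<^sub>0 z \<omega> \<and> \<Theta>\<^sub>0 z \<omega> \<le> b"
    using R by (auto simp: random_checkerboard_def)
  moreover have "AE \<omega> in M. a \<le> \<Theta> z \<omega> \<and> \<Theta> z \<omega> \<le> b" for z
  proof -
    have *: "{x \<in> space borel. a \<le> x \<and> x \<le> b} \<in> sets (borel :: real measure)" by measurable
    have "AE x in distr M\<^sub>0 borel (\<Theta>\<^sub>0 z). a \<le> x \<and> x \<le> b"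
      using ab(2)[of z] by (subst AE_distr_iff[OF m0 *])
    then have "AE x in distr M borel (\<Theta> z). a \<le> x \<and> x \<le> b" by (simp only: marg)
    then show ?thesis by (subst (asm) AE_distr_iff[OF m *])
  qed
  ultimately show "random_checkerboard M \<Theta>"
    unfolding random_checkerboard_def using M.prob_space_axioms by blast
qed

text \<open>Serves to replace almost sure bounds on the cell values by bounds at every sample point,
  as the energy estimates require, without changing the law of the checkerboard.\<close>

lemma distr_clamped_id:
  fixes N :: "(int^'d::finite \<Rightarrow> real) measure"
  assumes sets_N: "sets N = sets (PiM UNIV (\<lambda>_. borel))"
    and ab: "AE t in N. \<forall>z. a \<le> t z \<and> t z \<le> b"
  shows "distr N (PiM UNIV (\<lambda>_. borel)) (\<lambda>t z. max a (min b (t z))) = N"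
proof -
  note [measurable_cong] = sets_N
  have [measurable]: "(\<lambda>t. t z) \<in> borel_measurable N" for z
    using measurable_component_singleton[of z UNIV "\<lambda>_. borel :: real measure"]
    by (simp add: measurable_cong_sets[OF sets_N refl])
  have "distr N (PiM UNIV (\<lambda>_. borel)) (\<lambda>t z. max a (min b (t z))) = distr N N (\<lambda>t. t)"
  proof (rule distr_cong_AE)
    show "AE t in N. (\<lambda>z. max a (min b (t z))) = t"
      using ab by eventually_elim (simp add: fun_eq_iff min_absorb2 max_absorb2)
    show "(\<lambda>t z. max a (min b (t z))) \<in> measurable N (PiM UNIV (\<lambda>_. borel))"
      by (rule measurable_PiM_single') auto
  qed (auto simp: sets_N)
  then show ?thesis by (simp add: distr_id)
qed

lemma distr_pair_snd_prob:
  assumes "prob_space N1" "prob_space N2"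
  shows "distr (N1 \<Otimes>\<^sub>M N2) N2 snd = N2"
proof (rule measure_eqI)
  interpret N1: prob_space N1 by fact
  interpret N2: prob_space N2 by fact
  fix A assume "A \<in> sets (distr (N1 \<Otimes>\<^sub>M N2) N2 snd)"
  then have A: "A \<in> sets N2" by simp
  then have "snd -` A \<inter> space (N1 \<Otimes>\<^sub>M N2) = space N1 \<times> A"
    using sets.sets_into_space[OF A] by (auto simp: space_pair_measure)
  then show "emeasure (distr (N1 \<Otimes>\<^sub>M N2) N2 snd) A = emeasure N2 A"
    using A by (simp add: emeasure_distr N2.emeasure_pair_measure_Times N1.emeasure_space_1)
qed simp

text \<open>The exceptional points lie in countably many hyperplanes. As \<open>cell_index\<close>
  rounds down after adding 1/2, the upper inequality of a cell is always strict, and only its lower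
  faces can be hit.\<close>

lemma AE_unit_cell: "AE y :: real^'d::finite in lborel. y \<in> unit_cell (cell_index y)"
proof (rule AE_I')
  define H where "H = (\<lambda>(i::'d, j::int). {y :: real^'d. \<forall>k. y $ k \<in> (if k = i then {of_int j - 1/2} else UNIV)})"
  have "H p \<in> null_sets lborel" for p
  proof -
    obtain i j where p: "p = (i, j)" by (cases p)
    have s: "(if k = i then {of_int j - 1/2} else UNIV :: real set) \<in> sets borel" for k by simp
    have "emeasure lborel (H p) = (\<Prod>k\<in>UNIV. emeasure lborel (if k = i then {of_int j - 1/2 :: real} else UNIV))"
      unfolding H_def p prod.case by (rule emeasure_vec_box[OF s])
    also have "\<dots> = 0" by (intro prod_zero bexI[of _ i]) auto
    finally show ?thesis using sets_vec_box[OF s] by (simp add: null_sets_def H_def p)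
  qed
  then show "(\<Union>p. H p) \<in> null_sets lborel" by (intro null_sets_UN') auto
  show "{y \<in> space lborel. y \<notin> unit_cell (cell_index y)} \<subseteq> (\<Union>p. H p)"
  proof
    fix y :: "real^'d" assume "y \<in> {y \<in> space lborel. y \<notin> unit_cell (cell_index y)}"
    then obtain i where "\<not> (of_int \<lfloor>y $ i + 1 / 2\<rfloor> - 1 / 2 < y $ i \<and> y $ i < of_int \<lfloor>y $ i + 1 / 2\<rfloor> + 1 / 2)"
      by (auto simp: mem_unit_cell cell_index_def)
    then have "y $ i = of_int \<lfloor>y $ i + 1 / 2\<rfloor> - 1 / 2" by linarith
    then have "y \<in> H (i, \<lfloor>y $ i + 1 / 2\<rfloor>)" by (auto simp: H_def)
    then show "y \<in> (\<Union>p. H p)" by blast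
  qed
qed

lemma product_field_cellwise:
  "product_field i (\<lambda>x \<omega>. stripe_field h x (fst \<omega>)) (\<lambda>z \<omega>. \<Theta> z (snd \<omega>)) y \<omega> =
    cellwise (\<lambda>z. stripe h (fst \<omega>) (z $ i) * \<Theta> z (snd \<omega>)) (y :: real^'d::finite)"
  by (simp add: product_field_def checkerboard_field_eq cellwise_def stripe_field_def cell_index_def)

lemma sigma_W_pos:
  assumes "double_well W"
  shows "0 < sigma_W W"
proof -
  note W = double_wellD[OF assms]
  have c: "continuous_on {-1..1} (\<lambda>u. sqrt (2 * W u))"
    by (intro continuous_intros continuous_on_subset[OF W(1)]) auto
  have "sqrt (2 * W 0) \<noteq> 0" using W(3)[of 0] by simp
  then have "sigma_W W \<noteq> 0" unfolding sigma_W_def using integral_eq_0_iff[OF c] W(2) by force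
  moreover have "0 \<le> sigma_W W" unfolding sigma_W_def by (intro integral_nonneg integrable_continuous_real c) (simp add: W(2))
  ultimately show ?thesis by linarith
qed

context stripe_profile
begin

lemma expectation_stripe: "U.P.expectation (\<lambda>s. stripe h s j) = U.P.expectation (\<lambda>s. stripe h s 0)"
proof -
  have "U.P.expectation (\<lambda>s. stripe h s 0) = integral\<^sup>L (distr U.N U.N (shift (of_int j))) (\<lambda>s. stripe h s 0)"
    by (simp add: U.distr_shift)
  also have "\<dots> = U.P.expectation (\<lambda>s. stripe h s j)"
    by (subst integral_distr) (auto simp: stripe_shift)
  finally show ?thesis ..
qed

lemma expectation_stripe_gt_1: "1 < U.P.expectation (\<lambda>s. stripe h s j)"
proof -
  have m: "{s \<in> space U.N. stripe h s j = 1} \<in> sets U.N" by measurable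
  then have m': "{s. stripe h s j = 1} \<in> sets U.N" by (simp add: U.space_N)
  have eq: "stripe h s j = 2 - indicator {s. stripe h s j = 1} s" for s
    using stripe_range[of h s j] by (auto simp: indicator_def)
  have "U.P.expectation (\<lambda>s. stripe h s j) = U.P.expectation (\<lambda>s. 2 - indicator {s. stripe h s j = 1} s)"
    by (rule Bochner_Integration.integral_cong[OF refl eq])
  also have "\<dots> = 2 - U.P.prob {s. stripe h s j = 1}"
  proof -
    have "integrable U.N (indicator {s. stripe h s j = 1} :: _ \<Rightarrow> real)"
      by (rule integrable_real_indicator[OF m']) (simp add: U.P.emeasure_eq_measure)
    from Bochner_Integration.integral_diff[OF U.P.integrable_const this, of 2]
    show ?thesis by (simp add: U.space_N U.prob_N_UNIV)
  qed
  finally show ?thesis using prob_stripe_one[of j] by linarith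
qed

lemma ess_inf_stripe_field:
  assumes "prob_space N2"
  shows "ess_inf_field (U.N \<Otimes>\<^sub>M N2) (\<lambda>x \<omega>. stripe_field h x (fst \<omega>)) = 1"
proof -
  interpret N2: prob_space N2 by fact
  interpret N12: pair_prob_space U.N N2 by unfold_locales
  let ?M = "lborel \<Otimes>\<^sub>M (U.N \<Otimes>\<^sub>M N2)"
  let ?f = "\<lambda>(x :: real, \<omega>). - ereal (stripe_field h x (fst \<omega>))"
  have [measurable]: "?f \<in> borel_measurable ?M"
  proof -
    have "(\<lambda>p. (case (fst p, fst (snd p)) of (x, s) \<Rightarrow> stripe_field h x s)) \<in> borel_measurable ?M" by measurable
    then have [measurable]: "(\<lambda>p. stripe_field h (fst p) (fst (snd p))) \<in> borel_measurable ?M" by simp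
    show ?thesis unfolding case_prod_beta by measurable
  qed
  have "esssup ?M ?f \<le> -1"
    by (rule esssup_I) (auto simp: stripe_field_def stripe_def one_ereal_def)
  moreover have "-1 \<le> esssup ?M ?f"
  proof (rule ccontr)
    assume lt: "\<not> -1 \<le> esssup ?M ?f"
    have "AE p in ?M. ?f p \<le> esssup ?M ?f" by (rule esssup_AE)
    then have "AE p in ?M. ?f p \<noteq> -1" using lt by (elim eventually_mono) auto
    \<comment> \<open>On \<open>R\<close> the site 0 switches its own cell, so the field equals 1.
      The measure of \<open>R\<close> is h 0 / 2 and hence positive, which excludes an almost
      everywhere bound below -1 for the negated field.\<close>
    moreover define R where "R = {0<..<1/2::real} \<times> ({s :: real \<Rightarrow> real. s 0 < h 0} \<times> space N2)"
    have "?f p = -1" if "p \<in> R" for p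
    proof -
      obtain x s t where p: "p = (x, s, t)" "0 < x" "x < 1/2" "s 0 < h 0" using \<open>p \<in> R\<close> by (auto simp: R_def)
      have "\<lfloor>x + 1 / 2\<rfloor> = 0" using p by linarith
      moreover have "\<exists>k. s (of_int k) < h (0 - k)" using p by (intro exI[of _ 0]) simp
      ultimately show ?thesis using p by (simp add: stripe_field_def stripe_def one_ereal_def)
    qed
    ultimately have "AE p in ?M. p \<notin> R" by (elim eventually_mono) auto
    moreover have R: "R \<in> sets ?M" unfolding R_def by (intro pair_measureI sets_coordinate_less) auto
    ultimately have "emeasure ?M R = 0" by (subst (asm) AE_iff_measurable[OF R]) (auto dest: sets.sets_into_space[OF R, THEN subsetD])
    moreover have "emeasure ?M R = emeasure lborel {0<..<1/2::real} * (emeasure U.N {s. s 0 < h 0} * emeasure N2 (space N2))"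
      unfolding R_def using sets_coordinate_less
      by (subst N12.P.emeasure_pair_measure_Times) (auto simp: N2.emeasure_pair_measure_Times)
    ultimately show False using h_pos[of 0] by (simp add: N2.emeasure_space_1 U.P.emeasure_eq_measure prob_coordinate_less)
  qed
  ultimately have "esssup ?M ?f = -1" by (rule antisym)
  then show ?thesis unfolding ess_inf_field_def by simp
qed

end

section \<open>Energy estimate and limit\<close>

text \<open>The substitution t = x0 + \<epsilon> s absorbs the factor 1 / \<epsilon>. Extending the
  integral in direction \<open>i\<close> from the side of the cube to the whole line makes the bound
  uniform in \<open>x0\<close>.\<close>

lemma scaled_profile_integral:
  fixes i :: "'d::finite" and g :: "real \<Rightarrow> real"
  assumes g: "continuous_on UNIV g" "\<And>s. 0 \<le> g s" "\<And>s. s \<notin> {a..b} \<Longrightarrow> g s = 0" and pos: "0 < \<epsilon>" "0 < \<rho>"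
  shows "(\<integral>\<^sup>+x\<in>cube \<rho>. ennreal (1 / \<epsilon> * g ((x $ i - x0) / \<epsilon>)) \<partial>(lborel :: (real^'d) measure)) \<le>
    ennreal (\<rho> ^ (CARD('d) - 1) * integral {a..b} g)"
proof -
  have [measurable]: "g \<in> borel_measurable borel" using g(1) by (rule borel_measurable_continuous_onI)
  have I: "(g has_integral integral {a..b} g) {a..b}"
    by (intro integrable_integral integrable_continuous_real continuous_on_subset[OF g(1)]) auto
  have "(\<integral>\<^sup>+x\<in>cube \<rho>. ennreal (1 / \<epsilon> * g ((x $ i - x0) / \<epsilon>)) \<partial>(lborel :: (real^'d) measure)) =
      ennreal (\<rho> ^ (CARD('d) - 1)) * (\<integral>\<^sup>+t\<in>{-\<rho>/2..\<rho>/2}. ennreal (1 / \<epsilon> * g ((t - x0) / \<epsilon>)) \<partial>lborel)"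
    by (rule nn_integral_cube_coordinate[OF _ pos(2)]) measurable
  also have "(\<integral>\<^sup>+t\<in>{-\<rho>/2..\<rho>/2}. ennreal (1 / \<epsilon> * g ((t - x0) / \<epsilon>)) \<partial>lborel) \<le>
      (\<integral>\<^sup>+t. ennreal (1 / \<epsilon> * g ((t - x0) / \<epsilon>)) \<partial>lborel)"
    by (intro nn_integral_mono) (auto simp: indicator_def)
  also have "\<dots> = ennreal \<epsilon> * (\<integral>\<^sup>+t. ennreal (1 / \<epsilon> * g t) \<partial>lborel)"
    using pos by (subst nn_integral_real_affine[where c = \<epsilon> and t = x0]) auto
  also have "\<dots> = (\<integral>\<^sup>+t. ennreal \<epsilon> * ennreal (1 / \<epsilon> * g t) \<partial>lborel)"
    by (rule nn_integral_cmult[symmetric]) measurable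
  also have "\<dots> = (\<integral>\<^sup>+t. ennreal (g t) * indicator {a..b} t \<partial>lborel)"
    using pos g(3) by (intro nn_integral_cong) (auto simp: ennreal_mult'[symmetric] indicator_def)
  also have "\<dots> = ennreal (integral {a..b} g)"
    by (rule nn_integral_has_integral_lebesgue'[OF _ I]) (auto simp: g(2))
  finally show ?thesis
    using pos by (simp add: ennreal_mult' mult_left_mono)
qed

context stripe_profile
begin

text \<open>The potential of the profile vanishes outside the transition zone, and the zone lies
  within the run. The stripe factor may therefore be replaced by 1 everywhere, and only the
  checkerboard is left in the potential term.\<close>

lemma profile_energy_on_stripe:
  fixes i :: "'d::finite" and \<Theta> :: "int^'d \<Rightarrow> 'w \<Rightarrow> real" and k l :: int
    and a b K \<epsilon> \<delta> \<rho> :: real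
  assumes W: "double_well W"
    and P: "continuous_on UNIV P'" "\<And>s. s \<le> a \<Longrightarrow> P s = -1" "\<And>s. b \<le> s \<Longrightarrow> P s = 1"
      "\<And>s. s \<notin> {a..b} \<Longrightarrow> P' s = 0" "continuous_on UNIV P"
    and K: "\<bar>a\<bar> \<le> K" "\<bar>b\<bar> \<le> K" and pos: "0 < \<epsilon>" "0 < \<delta>" "0 < \<rho>" and \<Theta>0: "\<And>z \<omega>. 0 \<le> \<Theta> z \<omega>"
    and l: "K * \<epsilon> / \<delta> + 1 \<le> l" and stripe: "\<And>j. \<bar>j - k\<bar> \<le> l \<Longrightarrow> stripe h s j = 1"
  shows "(\<integral>\<^sup>+x\<in>cube \<rho>. ennreal (\<epsilon> / 2 * (P' ((x $ i - \<delta> * k) / \<epsilon>) / \<epsilon>)\<^sup>2 +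
      1 / \<epsilon> * cellwise (\<lambda>z. stripe h s (z $ i) * \<Theta> z \<omega>) ((1 / \<delta>) *\<^sub>R x) * W (P ((x $ i - \<delta> * k) / \<epsilon>))) \<partial>lborel) \<le>
    ennreal (\<rho> ^ (CARD('d) - 1) * integral {a..b} (\<lambda>s. (P' s)\<^sup>2 / 2)) +
    (\<integral>\<^sup>+x\<in>cube \<rho>. ennreal (checkerboard_field \<Theta> ((1 / \<delta>) *\<^sub>R x) \<omega> * (1 / \<epsilon> * W (P ((x $ i - \<delta> * k) / \<epsilon>)))) \<partial>lborel)"
proof -
  have [measurable]: "W \<in> borel_measurable borel" "P \<in> borel_measurable borel" "P' \<in> borel_measurable borel"
    using double_wellD(1)[OF W] P(1,5) by (auto intro!: borel_measurable_continuous_onI)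
  have cb: "checkerboard_field \<Theta> y \<omega> = cellwise (\<lambda>z. \<Theta> z \<omega>) y" for y
    by (simp add: checkerboard_field_eq cellwise_def)
  \<comment> \<open>In the transition zone x_i / \<delta> is within K \<epsilon> / \<delta> of the
    centre \<open>k\<close>; the additional 1 in the hypothesis on \<open>l\<close> covers the
    rounding to cells.\<close>
  have eq: "cellwise (\<lambda>z. stripe h s (z $ i) * \<Theta> z \<omega>) ((1 / \<delta>) *\<^sub>R x) * W (P ((x $ i - \<delta> * k) / \<epsilon>)) =
      checkerboard_field \<Theta> ((1 / \<delta>) *\<^sub>R x) \<omega> * W (P ((x $ i - \<delta> * k) / \<epsilon>))" for x
  proof (cases "a < (x $ i - \<delta> * k) / \<epsilon> \<and> (x $ i - \<delta> * k) / \<epsilon> < b")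
    case True
    then have "\<bar>(x $ i - \<delta> * k) / \<epsilon>\<bar> \<le> K" using K by linarith
    then have "\<bar>x $ i - \<delta> * k\<bar> \<le> K * \<epsilon>" using pos by (simp add: abs_divide pos_divide_le_eq)
    then have "\<bar>x $ i - \<delta> * k\<bar> / \<delta> \<le> K * \<epsilon> / \<delta>" using pos by (intro divide_right_mono) auto
    also have "\<bar>x $ i - \<delta> * k\<bar> / \<delta> = \<bar>x $ i / \<delta> - k\<bar>"
    proof -
      have "\<bar>x $ i - \<delta> * k\<bar> / \<delta> = \<bar>(x $ i - \<delta> * k) / \<delta>\<bar>" using pos by (simp add: abs_divide)
      then show ?thesis using pos by (simp add: diff_divide_distrib)
    qed
    finally have "\<bar>\<lfloor>x $ i / \<delta> + 1 / 2\<rfloor> - k\<bar> \<le> l" using l by linarith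
    then have "stripe h s \<lfloor>x $ i / \<delta> + 1 / 2\<rfloor> = 1" by (rule stripe)
    then show ?thesis by (simp add: checkerboard_field_eq cellwise_def cell_index_def)
  next
    case False
    then have "W (P ((x $ i - \<delta> * k) / \<epsilon>)) = 0"
      using P(2,3)[of "(x $ i - \<delta> * k) / \<epsilon>"] double_wellD(3)[OF W] by (auto simp: not_less)
    then show ?thesis by simp
  qed
  have "(\<integral>\<^sup>+x\<in>cube \<rho>. ennreal (\<epsilon> / 2 * (P' ((x $ i - \<delta> * k) / \<epsilon>) / \<epsilon>)\<^sup>2 +
      1 / \<epsilon> * cellwise (\<lambda>z. stripe h s (z $ i) * \<Theta> z \<omega>) ((1 / \<delta>) *\<^sub>R x) * W (P ((x $ i - \<delta> * k) / \<epsilon>))) \<partial>lborel) =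
    (\<integral>\<^sup>+x. ennreal (1 / \<epsilon> * ((P' ((x $ i - \<delta> * k) / \<epsilon>))\<^sup>2 / 2)) * indicator (cube \<rho>) x +
      ennreal (checkerboard_field \<Theta> ((1 / \<delta>) *\<^sub>R x) \<omega> * (1 / \<epsilon> * W (P ((x $ i - \<delta> * k) / \<epsilon>)))) * indicator (cube \<rho>) x \<partial>lborel)"
  proof (rule nn_integral_cong)
    fix x :: "real^'d"
    have "\<epsilon> / 2 * (P' ((x $ i - \<delta> * k) / \<epsilon>) / \<epsilon>)\<^sup>2 +
        1 / \<epsilon> * cellwise (\<lambda>z. stripe h s (z $ i) * \<Theta> z \<omega>) ((1 / \<delta>) *\<^sub>R x) * W (P ((x $ i - \<delta> * k) / \<epsilon>)) =
      1 / \<epsilon> * ((P' ((x $ i - \<delta> * k) / \<epsilon>))\<^sup>2 / 2) +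
        checkerboard_field \<Theta> ((1 / \<delta>) *\<^sub>R x) \<omega> * (1 / \<epsilon> * W (P ((x $ i - \<delta> * k) / \<epsilon>)))"
    proof -
      have "1 / \<epsilon> * cellwise (\<lambda>z. stripe h s (z $ i) * \<Theta> z \<omega>) ((1 / \<delta>) *\<^sub>R x) * W (P ((x $ i - \<delta> * k) / \<epsilon>)) =
          checkerboard_field \<Theta> ((1 / \<delta>) *\<^sub>R x) \<omega> * (1 / \<epsilon> * W (P ((x $ i - \<delta> * k) / \<epsilon>)))"
        using eq[of x] by (simp add: mult.assoc mult.left_commute)
      moreover have "\<epsilon> / 2 * (P' ((x $ i - \<delta> * k) / \<epsilon>) / \<epsilon>)\<^sup>2 = 1 / \<epsilon> * ((P' ((x $ i - \<delta> * k) / \<epsilon>))\<^sup>2 / 2)"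
        using pos by (simp add: power_divide power2_eq_square)
      ultimately show ?thesis by linarith
    qed
    then show "ennreal (\<epsilon> / 2 * (P' ((x $ i - \<delta> * k) / \<epsilon>) / \<epsilon>)\<^sup>2 +
        1 / \<epsilon> * cellwise (\<lambda>z. stripe h s (z $ i) * \<Theta> z \<omega>) ((1 / \<delta>) *\<^sub>R x) * W (P ((x $ i - \<delta> * k) / \<epsilon>))) * indicator (cube \<rho>) x =
      ennreal (1 / \<epsilon> * ((P' ((x $ i - \<delta> * k) / \<epsilon>))\<^sup>2 / 2)) * indicator (cube \<rho>) x +
        ennreal (checkerboard_field \<Theta> ((1 / \<delta>) *\<^sub>R x) \<omega> * (1 / \<epsilon> * W (P ((x $ i - \<delta> * k) / \<epsilon>)))) * indicator (cube \<rho>) x"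
      using pos \<Theta>0 double_wellD(2)[OF W]
      by (simp add: ennreal_plus cb cellwise_def distrib_right)
  qed
  also have "\<dots> = (\<integral>\<^sup>+x\<in>cube \<rho>. ennreal (1 / \<epsilon> * ((P' ((x $ i - \<delta> * k) / \<epsilon>))\<^sup>2 / 2)) \<partial>lborel) +
      (\<integral>\<^sup>+x\<in>cube \<rho>. ennreal (checkerboard_field \<Theta> ((1 / \<delta>) *\<^sub>R x) \<omega> * (1 / \<epsilon> * W (P ((x $ i - \<delta> * k) / \<epsilon>)))) \<partial>lborel)"
    unfolding cb by (rule nn_integral_add) measurable
  also have "(\<integral>\<^sup>+x\<in>cube \<rho>. ennreal (1 / \<epsilon> * ((P' ((x $ i - \<delta> * k) / \<epsilon>))\<^sup>2 / 2)) \<partial>(lborel :: (real^'d) measure)) \<le>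
      ennreal (\<rho> ^ (CARD('d) - 1) * integral {a..b} (\<lambda>s. (P' s)\<^sup>2 / 2))"
    by (rule scaled_profile_integral) (use P pos in \<open>auto intro!: continuous_intros\<close>)
  finally show ?thesis by (simp add: add_right_mono)
qed

text \<open>Fubini's theorem: for every stripe configuration in the event \<open>G\<close> of a long
  run, the checkerboard behaves well with probability at least the second factor, and
  \<open>G\<close> has probability at least the first. Integrating the slices over \<open>G\<close>
  gives the product.\<close>

lemma surface_tension_probability:
  fixes i :: "'d::finite" and \<Theta> :: "int^'d \<Rightarrow> 'w \<Rightarrow> real" and n l :: nat
    and a b K \<epsilon> \<delta> \<kappa> r \<tau> \<rho> t :: real
  assumes W: "double_well W" "\<And>u. \<bar>u\<bar> \<le> 1 \<Longrightarrow> W u \<le> m"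
    and q: "boundary_profile q" "\<And>s. \<bar>deriv q s\<bar> \<le> m1"
    and P: "\<And>s. (P has_real_derivative P' s) (at s)" "continuous_on UNIV P'" "\<And>s. \<bar>P s\<bar> \<le> 1"
      "\<And>s. \<bar>P' s\<bar> \<le> m1" "\<And>s. s \<le> a \<Longrightarrow> P s = -1" "\<And>s. b \<le> s \<Longrightarrow> P s = 1" "\<And>s. s \<notin> {a..b} \<Longrightarrow> P' s = 0"
    and K: "\<bar>a\<bar> \<le> K" "\<bar>b\<bar> \<le> K"
    and N2: "prob_space N2" "prob_space.indep_vars N2 (\<lambda>_. borel) \<Theta> UNIV"
    and \<Theta>: "\<And>z \<omega>. 0 < \<Theta> z \<omega> \<and> \<Theta> z \<omega> \<le> B" "\<And>z. prob_space.expectation N2 (\<Theta> z) = 1"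
    and pos: "0 < \<epsilon>" "0 < \<delta>" "0 < \<kappa>" "0 < r" "0 \<le> \<tau>" "0 < \<rho>" "0 < t" and r: "r \<le> \<rho> / 2 - \<kappa> * \<epsilon>" "K * \<epsilon> \<le> r / 2"
    and close: "\<And>u. r / \<epsilon> \<le> u \<Longrightarrow> \<bar>1 - q u\<bar> \<le> \<tau>" "\<And>u. u \<le> - r / \<epsilon> \<Longrightarrow> \<bar>- 1 - q u\<bar> \<le> \<tau>"
    and n: "\<delta> * n \<le> r / 2" and l: "K * \<epsilon> / \<delta> + 1 \<le> l"
    and I: "integral {a..b} (\<lambda>s. (P' s)\<^sup>2 / 2 + W (P s)) + t + (2 * real CARD('d) * \<kappa> * (m1\<^sup>2 + 2 * B * m + 256 * (real CARD('d))\<^sup>2 * \<tau>\<^sup>2 / \<kappa>\<^sup>2) +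
       4096 * real CARD('d) ^ 3 * r / (\<kappa> * \<rho>)) \<le> c"
  shows "(1 - exp (- (2 * real n + 1) * h (int l))) *
      (1 - (B + 1)\<^sup>2 * (m / \<epsilon>) * \<delta> ^ CARD('d) * (\<rho> ^ (CARD('d) - 1) * integral {a..b} (\<lambda>s. W (P s))) / (\<rho> ^ (CARD('d) - 1) * t)\<^sup>2) \<le>
    measure (U.N \<Otimes>\<^sub>M N2) {\<omega> \<in> space (U.N \<Otimes>\<^sub>M N2). ennreal (1 / \<rho> ^ (CARD('d) - 1)) *
      surface_tension W q (cellwise (\<lambda>z. stripe h (fst \<omega>) (z $ i) * \<Theta> z (snd \<omega>))) \<epsilon> \<delta> (axis i 1) (cube \<rho>) \<le> ennreal c}"
    (is "?p * ?q \<le> measure ?M ?T")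
proof -
  interpret N2: prob_space N2 by fact
  interpret N12: pair_prob_space U.N N2 by unfold_locales
  have [measurable]: "\<Theta> z \<in> borel_measurable N2" for z using N2(2) unfolding N2.indep_vars_def by auto
  have Pc: "continuous_on UNIV P" using P(1) DERIV_continuous_on[of UNIV P P'] by blast
  have Wc: "continuous_on UNIV W" by (rule double_wellD(1)[OF W(1)])
  have WPc: "continuous_on UNIV (\<lambda>s. W (P s))" by (rule continuous_on_compose2[OF Wc Pc]) auto
  have [measurable]: "W \<in> borel_measurable borel" "P \<in> borel_measurable borel"
    using Wc Pc by (auto intro!: borel_measurable_continuous_onI)
  define I1 I2 where "I1 = integral {a..b} (\<lambda>s. (P' s)\<^sup>2 / 2)" and "I2 = integral {a..b} (\<lambda>s. W (P s))"
  have I12: "integral {a..b} (\<lambda>s. (P' s)\<^sup>2 / 2 + W (P s)) = I1 + I2"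
    unfolding I1_def I2_def
    by (intro Henstock_Kurzweil_Integration.integral_add integrable_continuous_real continuous_intros
        continuous_on_subset[OF P(2)] continuous_on_subset[OF WPc]) auto
  have I2: "0 \<le> I2" unfolding I2_def
    by (intro integral_nonneg integrable_continuous_real continuous_on_subset[OF WPc]) (auto simp: double_wellD(2)[OF W(1)])
  have I1: "0 \<le> I1" unfolding I1_def
    by (intro integral_nonneg integrable_continuous_real continuous_intros continuous_on_subset[OF P(2)]) auto
  define v where "v = \<rho> ^ (CARD('d) - 1)"
  have v: "0 < v" using pos by (simp add: v_def)
  have m: "0 \<le> m" using W(2)[of 0] double_wellD(2)[OF W(1), of 0] by auto
  define X where "X \<omega> = surface_tension W q (cellwise (\<lambda>z. stripe h (fst \<omega>) (z $ i) * \<Theta> z (snd \<omega>))) \<epsilon> \<delta> (axis i 1) (cube \<rho>)" for \<omega>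
  have p0: "0 < stripe h s j * \<Theta> z \<omega>" for s j z \<omega> using \<Theta>(1)[of z \<omega>] stripe_range[of h s j] by auto
  have [measurable]: "X \<in> borel_measurable ?M"
    unfolding X_def
    by (rule surface_tension_measurable[where p = "\<lambda>z \<omega>. stripe h (fst \<omega>) (z $ i) * \<Theta> z (snd \<omega>)", OF _ p0 W(1) pos(1,2)]) measurable
  have T[measurable]: "?T \<in> sets ?M"
    unfolding X_def[symmetric] by measurable
  obtain G where G: "G \<in> sets U.N" "1 - exp (- (2 * real n + 1) * h (int l)) \<le> U.P.prob G"
    "\<And>s. s \<in> G \<Longrightarrow> \<exists>k. \<bar>k\<bar> \<le> int n \<and> (\<forall>j. \<bar>j - k\<bar> \<le> int l \<longrightarrow> stripe h s j = 1)"
    using long_stripe[of n l] by blast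
  have slice: "?q \<le> N2.prob (Pair s -` ?T)" if s: "s \<in> G" for s
  proof -
    obtain k where k: "\<bar>k\<bar> \<le> int n" "\<And>j. \<bar>j - k\<bar> \<le> int l \<Longrightarrow> stripe h s j = 1" using G(3)[OF s] by blast
    \<comment> \<open>The centre \<open>k\<close> is chosen from the stripe configuration
      \<open>s\<close> before the checkerboard is sampled, so this weight is deterministic for the
      concentration bound.\<close>
    define F where "F x = 1 / \<epsilon> * W (P ((x $ i - \<delta> * k) / \<epsilon>))" for x :: "real^'d"
    have Fb: "0 \<le> F x" "F x \<le> m / \<epsilon>" for x
      unfolding F_def using pos W(2)[OF P(3)] double_wellD(2)[OF W(1)] by (auto simp: divide_right_mono)
    have [measurable]: "F \<in> borel_measurable borel" unfolding F_def by measurable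
    have FI: "(\<integral>\<^sup>+x\<in>cube \<rho>. ennreal (F x) \<partial>lborel) \<le> ennreal (v * I2)"
      unfolding F_def v_def I2_def
      by (rule scaled_profile_integral[OF WPc]) (use pos P(5,6) double_wellD[OF W(1)] in \<open>force+\<close>)
    have \<Theta>': "\<And>z \<omega>. 0 \<le> \<Theta> z \<omega> \<and> \<Theta> z \<omega> \<le> B" using \<Theta>(1) less_imp_le by blast
    obtain G2 where G2: "G2 \<in> sets N2"
      "N2.prob G2 \<ge> 1 - (B + 1)\<^sup>2 * (m / \<epsilon>) * \<delta> ^ CARD('d) * (v * I2) / (v * t)\<^sup>2"
      "\<And>\<omega>. \<omega> \<in> G2 \<Longrightarrow> (\<integral>\<^sup>+x\<in>cube \<rho>. ennreal (checkerboard_field \<Theta> ((1 / \<delta>) *\<^sub>R x) \<omega> * F x) \<partial>lborel) \<le> ennreal (v * I2 + v * t)"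
      using checkerboard_integral_concentration[OF N2 \<Theta>' \<Theta>(2) _ Fb FI _ pos(2), of "v * t"] v I2 pos by auto
    have "G2 \<subseteq> Pair s -` ?T"
    proof
      fix \<omega> assume \<omega>: "\<omega> \<in> G2"
      have cw: "0 \<le> cellwise (\<lambda>z. stripe h s (z $ i) * \<Theta> z \<omega>) y" "cellwise (\<lambda>z. stripe h s (z $ i) * \<Theta> z \<omega>) y \<le> 2 * B" for y
        using \<Theta>'[of "cell_index y" \<omega>] stripe_range[of h s "cell_index y $ i"] by (auto simp: cellwise_def)
      \<comment> \<open>The offset of the centre and the half-width K \<epsilon> of the transition
        are each at most r / 2. Beyond distance r from the midplane the profile is thus in a well
        and can be compared with the limit of \<open>q\<close> on that side.\<close>
      have kn: "\<bar>\<delta> * of_int k\<bar> \<le> r / 2"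
      proof -
        have "\<bar>of_int k :: real\<bar> \<le> real n" using k(1) by linarith
        then have "\<delta> * \<bar>of_int k\<bar> \<le> \<delta> * n" using pos by (intro mult_left_mono) auto
        also note n
        finally show ?thesis using pos by (simp add: abs_mult)
      qed
      have cl: "\<bar>P ((u - \<delta> * of_int k) / \<epsilon>) - q (u / \<epsilon>)\<bar> \<le> \<tau>" if u: "r < \<bar>u\<bar>" for u
      proof (cases "0 \<le> u")
        case True
        then have "K * \<epsilon> \<le> u - \<delta> * of_int k" using u kn r by (auto simp: abs_le_iff)
        then have "b \<le> (u - \<delta> * of_int k) / \<epsilon>" using K pos by (simp add: pos_le_divide_eq) (meson K abs_le_D1 mult_right_mono less_imp_le order_trans)
        then have "P ((u - \<delta> * of_int k) / \<epsilon>) = 1" by (rule P(6))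
        moreover have "r / \<epsilon> \<le> u / \<epsilon>" using u True pos by (intro divide_right_mono) auto
        ultimately show ?thesis using close(1) by simp
      next
        case False
        then have "u - \<delta> * of_int k \<le> - K * \<epsilon>" using u kn r by (auto simp: abs_le_iff)
        also have "\<dots> \<le> a * \<epsilon>" using K pos by (intro mult_right_mono) auto
        finally have "(u - \<delta> * of_int k) / \<epsilon> \<le> a" using pos by (simp add: pos_divide_le_eq)
        then have "P ((u - \<delta> * of_int k) / \<epsilon>) = - 1" by (rule P(5))
        moreover have "u / \<epsilon> \<le> - r / \<epsilon>" using u False pos by (intro divide_right_mono) auto
        ultimately show ?thesis using close(2) by simp
      qed
      have "X (s, \<omega>) \<le> (\<integral>\<^sup>+x\<in>cube \<rho>. ennreal (\<epsilon> / 2 * (P' ((x $ i - \<delta> * of_int k) / \<epsilon>) / \<epsilon>)\<^sup>2 +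
          1 / \<epsilon> * cellwise (\<lambda>z. stripe h s (z $ i) * \<Theta> z \<omega>) ((1 / \<delta>) *\<^sub>R x) * W (P ((x $ i - \<delta> * of_int k) / \<epsilon>))) \<partial>lborel) +
        ennreal (v * (2 * real CARD('d) * \<kappa> * (m1\<^sup>2 + 2 * B * m + 256 * (real CARD('d))\<^sup>2 * \<tau>\<^sup>2 / \<kappa>\<^sup>2) +
          4096 * real CARD('d) ^ 3 * r / (\<kappa> * \<rho>)))" (is "_ \<le> _ + ennreal (v * ?err)")
        unfolding X_def v_def fst_conv snd_conv
        by (rule surface_tension_le_profile_energy[OF W q P(1-4) _ cw]) (use pos r cl in auto)
      also have "\<dots> \<le> (ennreal (v * I1) + ennreal (v * I2 + v * t)) + ennreal (v * ?err)"
      proof (intro add_mono order_refl order_trans[OF profile_energy_on_stripe[OF W(1) P(2,5,6,7) Pc K pos(1,2,6) _ _ k(2)]])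
        show "0 \<le> \<Theta> z \<omega>" for z \<omega> using \<Theta>' by blast
        show "K * \<epsilon> / \<delta> + 1 \<le> of_int (int l)" using l by simp
      qed (use G2(3)[OF \<omega>] in \<open>auto simp: F_def v_def I1_def intro!: add_mono\<close>)
      also have "\<dots> = ennreal (v * (I1 + I2 + t + ?err))"
      proof -
        have "0 \<le> B" using \<Theta>'[of 0 \<omega>] by linarith
        then have "0 \<le> ?err" using pos m by (intro add_nonneg_nonneg mult_nonneg_nonneg divide_nonneg_nonneg) auto
        moreover have "(ennreal (v * I1) + ennreal (v * I2 + v * t)) + ennreal (v * y) = ennreal (v * (I1 + I2 + t + y))"
          if "0 \<le> y" for y
          using v I1 I2 pos that by (simp add: ennreal_plus[symmetric] distrib_left del: ennreal_plus)
        ultimately show ?thesis by blast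
      qed
      also have "\<dots> \<le> ennreal (v * c)" using I I12 v by (intro ennreal_leI mult_left_mono) auto
      finally have "ennreal (1 / v) * X (s, \<omega>) \<le> ennreal (1 / v) * ennreal (v * c)" by (rule mult_left_mono) simp
      also have "\<dots> = ennreal c" using v by (simp add: ennreal_mult'[symmetric])
      finally show "\<omega> \<in> Pair s -` ?T"
        using sets.sets_into_space[OF G2(1)] sets.sets_into_space[OF G(1)] s \<omega>
        by (auto simp: X_def v_def space_pair_measure)
    qed
    then have "N2.prob G2 \<le> N2.prob (Pair s -` ?T)"
      by (intro N2.finite_measure_mono sets_Pair1[OF T])
    then show ?thesis using G2(2) unfolding v_def I2_def by linarith
  qed
  have p1: "0 \<le> ?p"
  proof -
    have "0 \<le> (2 * real n + 1) * h (int l)" using h_pos[of "int l"] by simp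
    then have "- (2 * real n + 1) * h (int l) \<le> 0" by linarith
    then have "exp (- (2 * real n + 1) * h (int l)) \<le> 1" by (subst exp_le_one_iff)
    then show ?thesis by linarith
  qed
  show ?thesis
  \<comment> \<open>Chebyshev's bound may be useless, with a negative second factor; the product is
    then at most 0 because the first factor is nonnegative.\<close>
  proof (cases "0 \<le> ?q")
    case True
    have "ennreal (?p * ?q) \<le> ennreal (?q * U.P.prob G)"
      using mult_right_mono[OF G(2) True] by (intro ennreal_leI) (simp only: mult.commute)
    also have "\<dots> = ennreal ?q * emeasure U.N G"
      unfolding U.P.emeasure_eq_measure by (rule ennreal_mult'[OF True])
    also have "\<dots> = (\<integral>\<^sup>+s. ennreal ?q * indicator G s \<partial>U.N)"
      using G(1) by (simp add: nn_integral_cmult_indicator)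
    also have "\<dots> \<le> (\<integral>\<^sup>+s. emeasure N2 (Pair s -` ?T) \<partial>U.N)"
      using slice by (intro nn_integral_mono) (auto simp: indicator_def N2.emeasure_eq_measure intro!: ennreal_leI)
    also have "\<dots> = emeasure ?M ?T" by (rule N2.emeasure_pair_measure_alt[OF T, symmetric])
    finally show ?thesis by (simp add: N12.P.emeasure_eq_measure)
  next
    case False
    then have "?p * ?q \<le> 0" using p1 by (intro mult_nonneg_nonpos) auto
    then show ?thesis using measure_nonneg[of ?M ?T] by linarith
  qed
qed

end

section \<open>The heavy tail and the number of long runs\<close>

lemma stripe_profile_powr:
  assumes "0 < \<alpha>"
  obtains c where "0 < c" "stripe_profile (\<lambda>k. c * (1 + \<bar>real_of_int k\<bar>) powr - (1 + \<alpha>))"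
proof -
  define f where "f n = (1 + real n) powr - (1 + \<alpha>)" for n
  have "summable (\<lambda>n. real (Suc n) powr - (1 + \<alpha>))"
    using assms by (subst summable_Suc_iff) (simp add: summable_real_powr_iff)
  then have f: "summable f" by (simp add: f_def[abs_def] add.commute)
  have "f 0 \<le> suminf f" using sum_le_suminf[OF f, of "{0}"] by (simp add: f_def)
  then have \<sigma>: "1 \<le> suminf f" by (simp add: f_def)
  \<comment> \<open>With this normalisation twice the sum of the profile is 2 \<sigma> / (2 \<sigma>
    + 1) < 1, where \<sigma> is the sum of \<open>f\<close>.\<close>
  define c where "c = 1 / (2 * suminf f + 1)"
  have c: "0 < c" "c \<le> 1" "2 * (c * suminf f) < 1" using \<sigma> by (auto simp: c_def field_simps)
  have "stripe_profile (\<lambda>k. c * (1 + \<bar>real_of_int k\<bar>) powr - (1 + \<alpha>))"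
  proof
    fix k l :: int
    show "0 < c * (1 + \<bar>real_of_int k\<bar>) powr - (1 + \<alpha>)" using c by (simp add: add_pos_nonneg)
    have "(1 + \<bar>real_of_int k\<bar>) powr - (1 + \<alpha>) \<le> 1 powr - (1 + \<alpha>)"
      using assms by (intro powr_mono2') auto
    then show "c * (1 + \<bar>real_of_int k\<bar>) powr - (1 + \<alpha>) \<le> 1" using c by (simp add: mult_le_one)
    show "c * (1 + \<bar>real_of_int l\<bar>) powr - (1 + \<alpha>) \<le> c * (1 + \<bar>real_of_int k\<bar>) powr - (1 + \<alpha>)" if "\<bar>k\<bar> \<le> \<bar>l\<bar>"
    proof -
      have "\<bar>real_of_int k\<bar> \<le> \<bar>real_of_int l\<bar>" using that by linarith
      then show ?thesis using assms c by (intro mult_left_mono powr_mono2') auto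
    qed
  next
    show "summable (\<lambda>n. c * (1 + \<bar>real_of_int (int n)\<bar>) powr - (1 + \<alpha>))"
      using summable_mult[OF f, of c] by (simp add: f_def)
    show "2 * (\<Sum>n. c * (1 + \<bar>real_of_int (int n)\<bar>) powr - (1 + \<alpha>)) < 1"
      using suminf_mult[OF f, of c] c by (simp add: f_def)
  qed
  with c(1) show ?thesis by (rule that)
qed

text \<open>
  There are of order \<open>1 / \<delta>\<close> sites at which a stripe of the required length \<open>\<epsilon> / \<delta>\<close> can start,
  each with probability of order \<open>(\<delta> / \<epsilon>) powr (1 + 1 / \<gamma>)\<close>. As \<open>\<delta>\<close> is at least of order
  \<open>\<epsilon> powr \<gamma>\<close>, their expected number is at least of order \<open>\<epsilon> powr (- 1 / \<gamma>)\<close>.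
\<close>

lemma expected_number_of_stripes_lower_bound:
  fixes \<gamma> c c0 K r \<epsilon> \<delta> :: real
  assumes "0 < \<gamma>" "0 < c" "0 < c0" "0 \<le> K" "0 < r" "0 < \<epsilon>" "c0 * \<epsilon> powr \<gamma> \<le> \<delta>" "\<delta> \<le> \<epsilon>" "\<delta> \<le> r / 2"
  shows "r / 2 * c * (3 + K) powr - (1 + 1 / \<gamma>) * c0 powr (1 / \<gamma>) * \<epsilon> powr - (1 / \<gamma>) \<le>
    (2 * real (nat \<lfloor>r / (2 * \<delta>)\<rfloor>) + 1) * (c * (1 + \<bar>real_of_int (int (nat \<lceil>K * \<epsilon> / \<delta> + 1\<rceil>))\<bar>) powr - (1 + 1 / \<gamma>))"
proof -
  define q where "q = 1 + 1 / \<gamma>"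
  have q: "0 < q" using assms by (simp add: q_def add_pos_pos)
  have \<delta>: "0 < \<delta>" using assms(3,6,7) by (metis less_le_trans mult_pos_pos powr_gt_zero less_irrefl)
  have "r / (2 * \<delta>) \<le> 2 * real (nat \<lfloor>r / (2 * \<delta>)\<rfloor>) + 1"
  proof -
    \<comment> \<open>For x \<ge> 1 the number 2 * floor x + 1 is at least 2 * x - 1, and hence at
      least x.\<close>
    have "1 \<le> r / (2 * \<delta>)" using assms \<delta> by (simp add: field_simps)
    moreover have "r / (2 * \<delta>) - 1 \<le> real (nat \<lfloor>r / (2 * \<delta>)\<rfloor>)" by linarith
    ultimately show ?thesis by linarith
  qed
  moreover have "((3 + K) * (\<epsilon> / \<delta>)) powr - q \<le> (1 + \<bar>real_of_int (int (nat \<lceil>K * \<epsilon> / \<delta> + 1\<rceil>))\<bar>) powr - q"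
  proof (rule powr_mono2')
    have "0 \<le> K * \<epsilon> / \<delta>" using assms \<delta> by simp
    then have "1 + \<bar>real_of_int (int (nat \<lceil>K * \<epsilon> / \<delta> + 1\<rceil>))\<bar> \<le> 3 + K * \<epsilon> / \<delta>" by linarith
    \<comment> \<open>Since \<delta> \<le> \<epsilon>, the additive constant left by rounding is
      absorbed into a multiple of \<epsilon> / \<delta>, so that the power factorises.\<close>
    also have "3 \<le> 3 * (\<epsilon> / \<delta>)" using assms \<delta> by (simp add: field_simps)
    finally show "1 + \<bar>real_of_int (int (nat \<lceil>K * \<epsilon> / \<delta> + 1\<rceil>))\<bar> \<le> (3 + K) * (\<epsilon> / \<delta>)" by (simp add: algebra_simps)
  qed (use q in auto)
  ultimately have f1: "r / (2 * \<delta>) * (c * ((3 + K) * (\<epsilon> / \<delta>)) powr - q) \<le>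
      (2 * real (nat \<lfloor>r / (2 * \<delta>)\<rfloor>) + 1) * (c * (1 + \<bar>real_of_int (int (nat \<lceil>K * \<epsilon> / \<delta> + 1\<rceil>))\<bar>) powr - q)"
    using assms \<delta> by (intro mult_mono mult_left_mono) auto
  have f2: "r / (2 * \<delta>) * (c * ((3 + K) * (\<epsilon> / \<delta>)) powr - q) = r / 2 * c * (3 + K) powr - q * (\<delta> powr (1 / \<gamma>) * \<epsilon> powr - q)"
  proof -
    have "((3 + K) * (\<epsilon> / \<delta>)) powr - q = (3 + K) powr - q * (\<epsilon> powr - q * \<delta> powr q)"
    proof -
      have "((3 + K) * (\<epsilon> / \<delta>)) powr - q = (3 + K) powr - q * (\<epsilon> / \<delta>) powr - q"
        using assms \<delta> by (simp only: powr_mult)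
      also have "(\<epsilon> / \<delta>) powr - q = \<epsilon> powr - q / \<delta> powr - q"
        using assms \<delta> by (simp only: powr_divide)
      also have "\<dots> = \<epsilon> powr - q * \<delta> powr q" by (simp only: powr_minus_divide) simp
      finally show ?thesis .
    qed
    moreover have "\<delta> powr q = \<delta> * \<delta> powr (1 / \<gamma>)" using \<delta> by (simp add: q_def powr_add)
    moreover have "r / (2 * \<delta>) * (c * (u * (v * (\<delta> * w)))) = r / 2 * c * u * (w * v)" for u v w
      using \<delta> by simp
    ultimately show ?thesis by simp
  qed
  have "c0 powr (1 / \<gamma>) * \<epsilon> powr - (1 / \<gamma>) \<le> \<delta> powr (1 / \<gamma>) * \<epsilon> powr - q"
  proof -
    have "(c0 * \<epsilon> powr \<gamma>) powr (1 / \<gamma>) \<le> \<delta> powr (1 / \<gamma>)" using assms by (intro powr_mono2) auto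
    then have "c0 powr (1 / \<gamma>) * \<epsilon> \<le> \<delta> powr (1 / \<gamma>)" using assms by (simp add: powr_mult powr_powr)
    then have "c0 powr (1 / \<gamma>) * \<epsilon> * \<epsilon> powr - q \<le> \<delta> powr (1 / \<gamma>) * \<epsilon> powr - q" by (intro mult_right_mono) auto
    moreover have "\<epsilon> * \<epsilon> powr - q = \<epsilon> powr - (1 / \<gamma>)"
      using assms powr_add[of \<epsilon> 1 "- q"] by (simp add: q_def)
    ultimately show ?thesis by (simp add: mult.assoc)
  qed
  then have f3: "r / 2 * c * (3 + K) powr - q * (c0 powr (1 / \<gamma>) * \<epsilon> powr - (1 / \<gamma>)) \<le>
      r / 2 * c * (3 + K) powr - q * (\<delta> powr (1 / \<gamma>) * \<epsilon> powr - q)"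
    using assms by (intro mult_left_mono) auto
  from order_trans[OF f3[folded f2] f1] show ?thesis unfolding q_def[symmetric] by (simp only: mult.assoc)
qed

lemma expected_number_of_stripes_at_top:
  assumes "1 < \<gamma>" "0 < c" "0 \<le> K" "0 < r"
    and \<delta>: "\<And>\<epsilon>. 0 < \<epsilon> \<Longrightarrow> 0 < \<delta> \<epsilon>" "((\<lambda>\<epsilon>. \<delta> \<epsilon> / \<epsilon>) \<longlongrightarrow> 0) (at_right 0)"
      "Liminf (at_right 0) (\<lambda>\<epsilon>. ereal (\<epsilon> powr (- \<gamma>) * \<delta> \<epsilon>)) > 0"
  shows "filterlim (\<lambda>\<epsilon>. (2 * real (nat \<lfloor>r / (2 * \<delta> \<epsilon>)\<rfloor>) + 1) *
    (c * (1 + \<bar>real_of_int (int (nat \<lceil>K * \<epsilon> / \<delta> \<epsilon> + 1\<rceil>))\<bar>) powr - (1 + 1 / \<gamma>))) at_top (at_right 0)"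
proof -
  \<comment> \<open>The lower limit may be infinite; any real constant strictly between 0 and it
    serves.\<close>
  obtain c0 where c0: "0 < c0" "ereal c0 < Liminf (at_right 0) (\<lambda>\<epsilon>. ereal (\<epsilon> powr (- \<gamma>) * \<delta> \<epsilon>))"
  proof -
    obtain y where "0 < y" "y < Liminf (at_right 0) (\<lambda>\<epsilon>. ereal (\<epsilon> powr (- \<gamma>) * \<delta> \<epsilon>))"
      using dense[OF \<delta>(3)] by blast
    then show ?thesis using that by (cases y) auto
  qed
  have ev0: "\<forall>\<^sub>F \<epsilon> in at_right (0::real). 0 < \<epsilon>" by (simp add: eventually_at_right_less)
  have "\<forall>\<^sub>F \<epsilon> in at_right 0. ereal c0 < ereal (\<epsilon> powr (- \<gamma>) * \<delta> \<epsilon>)"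
    by (rule less_LiminfD[OF c0(2)])
  then have ev1: "\<forall>\<^sub>F \<epsilon> in at_right 0. c0 * \<epsilon> powr \<gamma> \<le> \<delta> \<epsilon>"
    using ev0
  proof eventually_elim
    case (elim \<epsilon>)
    then have "c0 * \<epsilon> powr \<gamma> \<le> \<epsilon> powr (- \<gamma>) * \<delta> \<epsilon> * \<epsilon> powr \<gamma>" by (intro mult_right_mono) auto
    also have "\<dots> = \<delta> \<epsilon>" using elim by (simp add: powr_minus field_simps)
    finally show ?case .
  qed
  have ev2: "\<forall>\<^sub>F \<epsilon> in at_right 0. \<delta> \<epsilon> / \<epsilon> < 1" by (rule order_tendstoD(2)[OF \<delta>(2)]) simp
  have ev3: "\<forall>\<^sub>F \<epsilon> in at_right (0::real). \<epsilon> < r / 2" using assms(4) by (intro order_tendstoD(2)[OF tendsto_ident_at]) simp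
  define C where "C = r / 2 * c * (3 + K) powr - (1 + 1 / \<gamma>) * c0 powr (1 / \<gamma>)"
  have C: "0 < C" using assms c0 by (simp add: C_def)
  have "filterlim (\<lambda>\<epsilon>::real. \<epsilon> powr - a) at_top (at_right 0)" if "0 < a" for a :: real
    using that by real_asymp
  then have "filterlim (\<lambda>\<epsilon>::real. \<epsilon> powr - (1 / \<gamma>)) at_top (at_right 0)" using assms by simp
  then have lim: "filterlim (\<lambda>\<epsilon>. C * \<epsilon> powr - (1 / \<gamma>)) at_top (at_right 0)"
    using C by (intro filterlim_tendsto_pos_mult_at_top[OF tendsto_const]) auto
  show ?thesis
  proof (rule filterlim_at_top_mono[OF lim])
    show "\<forall>\<^sub>F \<epsilon> in at_right 0. C * \<epsilon> powr - (1 / \<gamma>) \<le> (2 * real (nat \<lfloor>r / (2 * \<delta> \<epsilon>)\<rfloor>) + 1) *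
        (c * (1 + \<bar>real_of_int (int (nat \<lceil>K * \<epsilon> / \<delta> \<epsilon> + 1\<rceil>))\<bar>) powr - (1 + 1 / \<gamma>))"
      using ev0 ev1 ev2 ev3
    proof eventually_elim
      case (elim \<epsilon>)
      then have "\<delta> \<epsilon> \<le> \<epsilon>" by (simp add: field_simps)
      with elim show ?case unfolding C_def
        using assms c0 by (intro expected_number_of_stripes_lower_bound) auto
    qed
  qed
qed

section \<open>Choice of the parameters and passage to the limit\<close>

lemma bounded_abs_derivative:
  fixes f' :: "real \<Rightarrow> real"
  assumes "continuous_on UNIV f'" "\<And>s. s \<notin> {a..b} \<Longrightarrow> f' s = 0"
  obtains m where "\<And>s. \<bar>f' s\<bar> \<le> m"
proof -
  have "bounded (f' ` {a..b})"
    by (intro compact_imp_bounded compact_continuous_image continuous_on_subset[OF assms(1)]) auto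
  then obtain m where m: "\<forall>y\<in>f' ` {a..b}. \<bar>y\<bar> \<le> m" by (auto simp: bounded_real)
  have "\<bar>f' s\<bar> \<le> max 0 m" for s
    using m assms(2)[of s] by (cases "s \<in> {a..b}") (auto simp: le_max_iff_disj)
  then show ?thesis by (rule that)
qed

context stripe_profile
begin

text \<open>The excess \<eta> is spent as follows: \<eta> / 4 on the suboptimal profile, \<eta> / 4
  on the fluctuation of the checkerboard, and \<eta> / 8 on each of the three errors of the boundary
  layer. The tail of \<open>h\<close> enters only through \<open>rate\<close>: the expected number
  of sites near the origin that start a long enough run tends to infinity.\<close>

lemma surface_tension_asymptotically_le:
  fixes i :: "'d::finite" and \<Theta> :: "int^'d \<Rightarrow> 'w \<Rightarrow> real"
  assumes W: "double_well W" and q: "boundary_profile q"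
    and N2: "prob_space N2" "prob_space.indep_vars N2 (\<lambda>_. borel) \<Theta> UNIV"
    and \<Theta>: "\<And>z \<omega>. 0 < \<Theta> z \<omega> \<and> \<Theta> z \<omega> \<le> B" "\<And>z. prob_space.expectation N2 (\<Theta> z) = 1"
    and \<delta>: "\<And>\<epsilon>. 0 < \<epsilon> \<Longrightarrow> 0 < \<delta> \<epsilon>" "((\<lambda>\<epsilon>. \<delta> \<epsilon> / \<epsilon>) \<longlongrightarrow> 0) (at_right 0)"
    and rate: "\<And>K r. 0 \<le> K \<Longrightarrow> 0 < r \<Longrightarrow> filterlim (\<lambda>\<epsilon>. (2 * real (nat \<lfloor>r / (2 * \<delta> \<epsilon>)\<rfloor>) + 1) *
        h (int (nat \<lceil>K * \<epsilon> / \<delta> \<epsilon> + 1\<rceil>))) at_top (at_right 0)"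
    and \<rho>: "0 < \<rho>"
  shows "asymptotically_le_in_prob (U.N \<Otimes>\<^sub>M N2)
    (\<lambda>\<epsilon> \<omega>. ennreal (1 / \<rho> ^ (CARD('d) - 1)) *
      surface_tension W q (cellwise (\<lambda>z. stripe h (fst \<omega>) (z $ i) * \<Theta> z (snd \<omega>))) \<epsilon> (\<delta> \<epsilon>) (axis i 1) (cube \<rho>))
    (sigma_W W)"
  unfolding asymptotically_le_in_prob_def
proof (intro allI impI)
  fix \<eta> :: real assume \<eta>: "0 < \<eta>"
  interpret N2: prob_space N2 by fact
  interpret N12: pair_prob_space U.N N2 by unfold_locales
  obtain P P' a b where P: "a \<le> b" "\<And>s. (P has_real_derivative P' s) (at s)" "continuous_on UNIV P'"
    "\<And>s. -1 \<le> P s \<and> P s \<le> 1" "\<And>s. s \<le> a \<Longrightarrow> P s = -1" "\<And>s. b \<le> s \<Longrightarrow> P s = 1"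
    "\<And>s. s \<notin> {a..b} \<Longrightarrow> P' s = 0"
    "integral {a..b} (\<lambda>s. (P' s)\<^sup>2 / 2 + W (P s)) \<le> sigma_W W + \<eta> / 4"
    by (rule optimal_profile[OF W, of "\<eta> / 4"]) (use \<eta> in auto)
  obtain m where m: "0 < m" "\<And>u. \<bar>u\<bar> \<le> 1 \<Longrightarrow> W u \<le> m" using double_well_bounded[OF W] by blast
  obtain mP where mP: "\<And>s. \<bar>P' s\<bar> \<le> mP" using bounded_abs_derivative[OF P(3,7)] by blast
  obtain mq where mq: "\<And>s. \<bar>deriv q s\<bar> \<le> mq" using boundary_profileD(3)[OF q] by (auto simp: bounded_real)
  define m1 where "m1 = max mP mq"
  have m1: "\<bar>P' s\<bar> \<le> m1" "\<bar>deriv q s\<bar> \<le> m1" for s using mP[of s] mq[of s] by (auto simp: m1_def)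
  define K where "K = max \<bar>a\<bar> \<bar>b\<bar>"
  have K: "\<bar>a\<bar> \<le> K" "\<bar>b\<bar> \<le> K" "0 \<le> K" by (auto simp: K_def)
  have B: "0 < B" using \<Theta>(1)[of 0 undefined] by linarith
  define n where "n = real CARD('d)"
  have n: "0 < n" by (simp add: n_def)
  define C1 where "C1 = m1\<^sup>2 + 2 * B * m"
  have C1: "0 < C1" using B m by (simp add: C1_def add_nonneg_pos)
  \<comment> \<open>\<open>C1\<close> does not involve \<kappa>, so \<kappa> can be fixed by the
    error of the layer itself; \<open>r\<close> and \<open>\<tau>\<close> are then chosen relative
    to it, and all three are independent of \<epsilon>.\<close>
  define \<kappa> where "\<kappa> = \<eta> / (16 * n * C1)"
  have \<kappa>: "0 < \<kappa>" "2 * n * \<kappa> * C1 = \<eta> / 8" using \<eta> n C1 by (auto simp: \<kappa>_def)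
  define r where "r = min (\<rho> / 4) (\<eta> * \<kappa> * \<rho> / (32768 * n ^ 3))"
  have r: "0 < r" "r \<le> \<rho> / 4" "4096 * n ^ 3 * r / (\<kappa> * \<rho>) \<le> \<eta> / 8"
  proof -
    show "0 < r" "r \<le> \<rho> / 4" using \<eta> \<kappa> \<rho> n by (auto simp: r_def)
    have "r \<le> \<eta> * \<kappa> * \<rho> / (32768 * n ^ 3)" by (simp add: r_def)
    then show "4096 * n ^ 3 * r / (\<kappa> * \<rho>) \<le> \<eta> / 8" using \<kappa> \<rho> n by (simp add: field_simps)
  qed
  define \<tau> where "\<tau> = sqrt (\<eta> * \<kappa> / (4096 * n ^ 3))"
  have \<tau>: "0 < \<tau>" "2 * n * \<kappa> * (256 * n\<^sup>2 * \<tau>\<^sup>2 / \<kappa>\<^sup>2) = \<eta> / 8"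
    using \<eta> \<kappa> n by (auto simp: \<tau>_def field_simps power2_eq_square power3_eq_cube)
  have total: "integral {a..b} (\<lambda>s. (P' s)\<^sup>2 / 2 + W (P s)) + \<eta> / 4 +
      (2 * n * \<kappa> * (C1 + 256 * n\<^sup>2 * \<tau>\<^sup>2 / \<kappa>\<^sup>2) + 4096 * n ^ 3 * r / (\<kappa> * \<rho>)) \<le> sigma_W W + \<eta>"
  proof -
    have "2 * n * \<kappa> * (C1 + 256 * n\<^sup>2 * \<tau>\<^sup>2 / \<kappa>\<^sup>2) = \<eta> / 8 + \<eta> / 8"
      using \<kappa>(2) \<tau>(2) by (simp only: distrib_left)
    moreover have "u + \<eta> / 4 + (x + y) \<le> s + \<eta>" if "x = \<eta> / 8 + \<eta> / 8" "u \<le> s + \<eta> / 4" "y \<le> \<eta> / 8" for x y u s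
      using that \<eta> by linarith
    ultimately show ?thesis using P(8) r(3) by blast
  qed
  define V where "V = \<rho> ^ (CARD('d) - 1) * integral {a..b} (\<lambda>s. W (P s)) / (\<rho> ^ (CARD('d) - 1) * (\<eta> / 4))\<^sup>2"
  define p where "p \<epsilon> = (2 * real (nat \<lfloor>r / (2 * \<delta> \<epsilon>)\<rfloor>) + 1) * h (int (nat \<lceil>K * \<epsilon> / \<delta> \<epsilon> + 1\<rceil>))" for \<epsilon>
  define Q where "Q \<epsilon> = (1 - exp (- p \<epsilon>)) * (1 - (B + 1)\<^sup>2 * m * V * (\<delta> \<epsilon> ^ CARD('d) / \<epsilon>))" for \<epsilon>
  have ev0: "\<forall>\<^sub>F \<epsilon> in at_right (0::real). 0 < \<epsilon>" by (simp add: eventually_at_right_less)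
  have small: "\<forall>\<^sub>F \<epsilon> in at_right (0::real). c * \<epsilon> < y" if "0 < y" for c y
    by (rule order_tendstoD(2)[of _ 0]) (use that in \<open>auto intro!: tendsto_eq_intros\<close>)
  have inv: "filterlim (\<lambda>\<epsilon>. r / \<epsilon>) at_top (at_right 0)"
    using r(1) by real_asymp
  have \<delta>0: "(\<delta> \<longlongrightarrow> 0) (at_right 0)"
  proof -
    have "((\<lambda>\<epsilon>. \<delta> \<epsilon> / \<epsilon> * \<epsilon>) \<longlongrightarrow> 0 * 0) (at_right 0)" by (intro tendsto_mult \<delta>(2) tendsto_ident_at)
    moreover have "\<forall>\<^sub>F \<epsilon> in at_right 0. \<delta> \<epsilon> / \<epsilon> * \<epsilon> = \<delta> \<epsilon>" using ev0 by eventually_elim simp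
    ultimately show ?thesis unfolding mult_zero_left by (rule Lim_transform_eventually)
  qed
  \<comment> \<open>The variance is of this order. As \<delta> < 1 eventually, the case d = 1, where
    it is \<delta> / \<epsilon>, is the worst.\<close>
  have \<delta>n: "((\<lambda>\<epsilon>. \<delta> \<epsilon> ^ CARD('d) / \<epsilon>) \<longlongrightarrow> 0) (at_right 0)"
  proof (rule tendsto_sandwich[OF _ _ tendsto_const \<delta>(2)])
    show "\<forall>\<^sub>F \<epsilon> in at_right 0. 0 \<le> \<delta> \<epsilon> ^ CARD('d) / \<epsilon>"
      using ev0 by eventually_elim (simp add: \<delta>(1) less_imp_le)
    have "\<forall>\<^sub>F \<epsilon> in at_right 0. \<delta> \<epsilon> < 1" by (rule order_tendstoD(2)[OF \<delta>0]) simp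
    then show "\<forall>\<^sub>F \<epsilon> in at_right 0. \<delta> \<epsilon> ^ CARD('d) / \<epsilon> \<le> \<delta> \<epsilon> / \<epsilon>"
      using ev0
    proof eventually_elim
      case (elim \<epsilon>)
      have "\<delta> \<epsilon> ^ CARD('d) \<le> \<delta> \<epsilon> ^ 1"
        by (rule power_decreasing) (use elim \<delta>(1)[of \<epsilon>] in \<open>auto simp: Suc_le_eq\<close>)
      then show ?case using elim by (intro divide_right_mono) auto
    qed
  qed
  have "((\<lambda>\<epsilon>. exp (- p \<epsilon>)) \<longlongrightarrow> 0) (at_right 0)"
    by (rule filterlim_compose[OF exp_at_bot]) (use rate[OF K(3) r(1)] in \<open>simp add: filterlim_uminus_at_bot p_def[abs_def]\<close>)
  then have "(Q \<longlongrightarrow> (1 - 0) * (1 - (B + 1)\<^sup>2 * m * V * 0)) (at_right 0)"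
    unfolding Q_def[abs_def] by (intro tendsto_mult tendsto_diff tendsto_const \<delta>n)
  then have Qlim: "(Q \<longlongrightarrow> 1) (at_right 0)" by simp
  have q1: "\<forall>\<^sub>F u in at_top. \<bar>1 - q u\<bar> \<le> \<tau>"
  proof -
    have "((\<lambda>u. \<bar>1 - q u\<bar>) \<longlongrightarrow> \<bar>1 - 1\<bar>) at_top" by (intro tendsto_intros boundary_profileD(5)[OF q])
    then have "\<forall>\<^sub>F u in at_top. \<bar>1 - q u\<bar> < \<tau>" by (rule order_tendstoD(2)) (simp add: \<tau>(1))
    then show ?thesis by (rule eventually_mono) simp
  qed
  have q2: "\<forall>\<^sub>F u in at_bot. \<bar>- 1 - q u\<bar> \<le> \<tau>"
  proof -
    have "((\<lambda>u. \<bar>- 1 - q u\<bar>) \<longlongrightarrow> \<bar>- 1 - - 1\<bar>) at_bot" by (intro tendsto_intros boundary_profileD(6)[OF q])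
    then have "\<forall>\<^sub>F u in at_bot. \<bar>- 1 - q u\<bar> < \<tau>" by (rule order_tendstoD(2)) (simp add: \<tau>(1))
    then show ?thesis by (rule eventually_mono) simp
  qed
  obtain u1 where u1: "\<And>u. u1 \<le> u \<Longrightarrow> \<bar>1 - q u\<bar> \<le> \<tau>" using q1 by (auto simp: eventually_at_top_linorder)
  obtain u2 where u2: "\<And>u. u \<le> u2 \<Longrightarrow> \<bar>- 1 - q u\<bar> \<le> \<tau>" using q2 by (auto simp: eventually_at_bot_linorder)
  let ?X = "\<lambda>\<epsilon>. measure (U.N \<Otimes>\<^sub>M N2) {\<omega> \<in> space (U.N \<Otimes>\<^sub>M N2). ennreal (1 / \<rho> ^ (CARD('d) - 1)) *
      surface_tension W q (cellwise (\<lambda>z. stripe h (fst \<omega>) (z $ i) * \<Theta> z (snd \<omega>))) \<epsilon> (\<delta> \<epsilon>) (axis i 1) (cube \<rho>) \<le> ennreal (sigma_W W + \<eta>)}"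
  have "\<forall>\<^sub>F \<epsilon> in at_right 0. max u1 (- u2) \<le> r / \<epsilon>" using inv unfolding filterlim_at_top by blast
  then have lower: "\<forall>\<^sub>F \<epsilon> in at_right 0. Q \<epsilon> \<le> ?X \<epsilon>"
    using ev0 small[OF half_gt_zero[OF r(1)], of K] small[of "\<rho> / 4" \<kappa>, simplified, OF \<rho>]
  proof eventually_elim
    case (elim \<epsilon>)
    have \<delta>\<epsilon>: "0 < \<delta> \<epsilon>" using elim \<delta>(1) by blast
    have "(1 - exp (- (2 * real (nat \<lfloor>r / (2 * \<delta> \<epsilon>)\<rfloor>) + 1) * h (int (nat \<lceil>K * \<epsilon> / \<delta> \<epsilon> + 1\<rceil>)))) *
        (1 - (B + 1)\<^sup>2 * (m / \<epsilon>) * \<delta> \<epsilon> ^ CARD('d) * (\<rho> ^ (CARD('d) - 1) * integral {a..b} (\<lambda>s. W (P s))) / (\<rho> ^ (CARD('d) - 1) * (\<eta> / 4))\<^sup>2) \<le> ?X \<epsilon>"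
    proof (rule surface_tension_probability[OF W m(2) q m1(2) P(2,3) _ m1(1) P(5,6,7) K(1,2) N2 \<Theta> _ \<delta>\<epsilon> \<kappa>(1) r(1) less_imp_le[OF \<tau>(1)] \<rho>])
      show "\<bar>P s\<bar> \<le> 1" for s using P(4)[of s] by auto
      show "r \<le> \<rho> / 2 - \<kappa> * \<epsilon>" using elim r(2) by simp
      show "\<bar>1 - q u\<bar> \<le> \<tau>" if "r / \<epsilon> \<le> u" for u using that elim by (intro u1) auto
      show "\<bar>- 1 - q u\<bar> \<le> \<tau>" if "u \<le> - r / \<epsilon>" for u using that elim by (intro u2) auto
      show "\<delta> \<epsilon> * real (nat \<lfloor>r / (2 * \<delta> \<epsilon>)\<rfloor>) \<le> r / 2"
      proof -
        have "0 \<le> r / (2 * \<delta> \<epsilon>)" using r \<delta>\<epsilon> by simp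
        then have "real (nat \<lfloor>r / (2 * \<delta> \<epsilon>)\<rfloor>) \<le> r / (2 * \<delta> \<epsilon>)" by simp
        then have "\<delta> \<epsilon> * real (nat \<lfloor>r / (2 * \<delta> \<epsilon>)\<rfloor>) \<le> \<delta> \<epsilon> * (r / (2 * \<delta> \<epsilon>))" using \<delta>\<epsilon> by (intro mult_left_mono) auto
        then show ?thesis using \<delta>\<epsilon> by simp
      qed
      show "K * \<epsilon> / \<delta> \<epsilon> + 1 \<le> real (nat \<lceil>K * \<epsilon> / \<delta> \<epsilon> + 1\<rceil>)" by linarith
      show "integral {a..b} (\<lambda>s. (P' s)\<^sup>2 / 2 + W (P s)) + \<eta> / 4 + (2 * real CARD('d) * \<kappa> * (m1\<^sup>2 + 2 * B * m + 256 * (real CARD('d))\<^sup>2 * \<tau>\<^sup>2 / \<kappa>\<^sup>2) +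
          4096 * real CARD('d) ^ 3 * r / (\<kappa> * \<rho>)) \<le> sigma_W W + \<eta>"
        using total unfolding C1_def n_def .
    qed (use elim \<eta> in auto)
    moreover have "A * m * (x / y) * (d / e) = A * (m / e) * d * x / y" for A x y d e :: real
      by (simp add: mult_ac)
    ultimately show ?case unfolding Q_def p_def V_def by (simp only: mult_minus_left)
  qed
  show "(?X \<longlongrightarrow> 1) (at_right 0)"
    by (rule tendsto_sandwich[OF lower _ Qlim tendsto_const]) (simp add: N12.P.prob_le_1)
qed

end

section \<open>The coupling as a product space\<close>

theorem theorem2:
  fixes W q :: "real \<Rightarrow> real"
    and \<gamma> :: real
    and i\<^sub>1 :: "'d::finite"
    and M\<^sub>0 :: "'a measure"
    and \<Theta>\<^sub>0 :: "int^'d \<Rightarrow> 'a \<Rightarrow> real"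
  assumes W: "double_well W"
    and q: "boundary_profile q"
    and gamma: "\<gamma> > 1"
    and checkerboard: "random_checkerboard M\<^sub>0 \<Theta>\<^sub>0"
    and mean: "field_mean M\<^sub>0 (checkerboard_field \<Theta>\<^sub>0) = 1"
  shows "\<exists>(M :: ((real \<Rightarrow> real) \<times> (int^'d \<Rightarrow> real)) measure) S \<Theta>.
    stationary_ergodic_field M S \<and>
    random_checkerboard M \<Theta> \<and>
    distr M (PiM UNIV (\<lambda>_. borel)) (\<lambda>\<omega> z. \<Theta> z \<omega>) =
      distr M\<^sub>0 (PiM UNIV (\<lambda>_. borel)) (\<lambda>\<omega> z. \<Theta>\<^sub>0 z \<omega>) \<and>
    mean_homogeneous M (product_field i\<^sub>1 S \<Theta>) \<and>
    (\<forall>\<delta> :: real \<Rightarrow> real.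
       (\<forall>\<epsilon>>0. \<delta> \<epsilon> > 0) \<longrightarrow>
       ((\<lambda>\<epsilon>. \<delta> \<epsilon> / \<epsilon>) \<longlongrightarrow> 0) (at_right 0) \<longrightarrow>
       Liminf (at_right 0) (\<lambda>\<epsilon>. ereal (\<epsilon> powr (- \<gamma>) * \<delta> \<epsilon>)) > 0 \<longrightarrow>
       (\<forall>\<rho>>0.
          asymptotically_le_in_prob M
            (\<lambda>\<epsilon> \<omega>. ennreal (1 / \<rho> ^ (CARD('d) - 1)) *
               surface_tension W q (\<lambda>y. product_field i\<^sub>1 S \<Theta> y \<omega>) \<epsilon> (\<delta> \<epsilon>) (axis i\<^sub>1 1) (cube \<rho>))
            (sigma_W W * sqrt (ess_inf_field M S)) \<and>
          sigma_W W * sqrt (ess_inf_field M S) < sigma_bar W M (product_field i\<^sub>1 S \<Theta>)))"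
proof -
  interpret M0: prob_space M\<^sub>0 using checkerboard by (simp add: random_checkerboard_def)
  obtain c where c: "0 < c" and "stripe_profile (\<lambda>k. c * (1 + \<bar>real_of_int k\<bar>) powr - (1 + 1 / \<gamma>))"
    using stripe_profile_powr[of "1 / \<gamma>"] gamma by auto
  define h where "h = (\<lambda>k. c * (1 + \<bar>real_of_int k\<bar>) powr - (1 + 1 / \<gamma>))"
  interpret stripe_profile h unfolding h_def by fact
  have m0[measurable]: "\<Theta>\<^sub>0 z \<in> borel_measurable M\<^sub>0" for z
    using checkerboard by (auto simp: random_checkerboard_def M0.indep_vars_def)
  obtain a b where ab: "0 < a" "\<And>z. AE \<omega> in M\<^sub>0. a \<le> \<Theta>\<^sub>0 z \<omega> \<and> \<Theta>\<^sub>0 z \<omega> \<le> b"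
    using checkerboard by (auto simp: random_checkerboard_def)
  have path0: "(\<lambda>\<omega> z. \<Theta>\<^sub>0 z \<omega>) \<in> measurable M\<^sub>0 (PiM UNIV (\<lambda>_. borel))"
    by (rule measurable_PiM_single') auto
  \<comment> \<open>The given probability space has an arbitrary type; its image on the space of
    cell configurations has the type required of the second component and carries the same
    law.\<close>
  define N2 where "N2 = distr M\<^sub>0 (PiM UNIV (\<lambda>_. borel)) (\<lambda>\<omega> z. \<Theta>\<^sub>0 z \<omega>)"
  have sets_N2 [measurable_cong]: "sets N2 = sets (PiM UNIV (\<lambda>_. borel))" by (simp add: N2_def)
  interpret N2: prob_space N2 unfolding N2_def by (rule M0.prob_space_distr[OF path0])
  interpret N12: pair_prob_space U.N N2 by unfold_locales
  define \<Theta> :: "int^'d \<Rightarrow> (int^'d \<Rightarrow> real) \<Rightarrow> real" where "\<Theta> z t = max a (min b (t z))" for z t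
  have coord [measurable]: "(\<lambda>t. t z) \<in> borel_measurable N2" for z
    using measurable_component_singleton[of z UNIV "\<lambda>_. borel :: real measure"]
    by (simp add: measurable_cong_sets[OF sets_N2 refl])
  have [measurable]: "\<Theta> z \<in> borel_measurable N2" for z unfolding \<Theta>_def by measurable
  have AE_N2: "AE t in N2. \<forall>z. a \<le> t z \<and> t z \<le> b"
  proof -
    have [measurable]: "(\<lambda>t. t z) \<in> borel_measurable (PiM UNIV (\<lambda>_. borel :: real measure))" for z :: "int^'d"
      by (rule measurable_component_singleton) auto
    have P: "{t \<in> space (PiM UNIV (\<lambda>_. borel)). \<forall>z :: int^'d. a \<le> t z \<and> t z \<le> b} \<in> sets (PiM UNIV (\<lambda>_. borel))"
      by measurable
    show ?thesis unfolding N2_def using ab(2) by (subst AE_distr_iff[OF path0 P]) (simp add: AE_all_countable)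
  qed
  have law2: "distr N2 (PiM UNIV (\<lambda>_. borel)) (\<lambda>t z. \<Theta> z t) = N2"
    unfolding \<Theta>_def by (rule distr_clamped_id[OF sets_N2 AE_N2])
  have R2: "random_checkerboard N2 \<Theta>"
    by (rule random_checkerboard_same_law(2)[OF checkerboard]) (auto simp: law2 N2_def[symmetric] N2.prob_space_axioms)
  have marg2: "distr N2 borel (\<Theta> z) = distr M\<^sub>0 borel (\<Theta>\<^sub>0 z)" for z
    by (rule random_checkerboard_same_law(1)[OF checkerboard]) (auto simp: law2 N2_def[symmetric] N2.prob_space_axioms)
  have indep2: "N2.indep_vars (\<lambda>_. borel) \<Theta> UNIV" using R2 by (simp add: random_checkerboard_def)
  have \<Theta>b: "0 < \<Theta> z t \<and> \<Theta> z t \<le> max a b" for z t using ab(1) by (auto simp: \<Theta>_def)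
  \<comment> \<open>The origin is the centre of cell 0, so the mean of the field there is the mean
    of a cell value.\<close>
  have "M0.expectation (\<Theta>\<^sub>0 0) = 1"
  proof -
    have "cell_index (0 :: real^'d) = 0" by (simp add: cell_index_def vec_eq_iff)
    moreover have "(0 :: real^'d) \<in> unit_cell 0" by (simp add: mem_unit_cell)
    ultimately have "checkerboard_field \<Theta>\<^sub>0 0 = \<Theta>\<^sub>0 0" by (simp add: fun_eq_iff checkerboard_field_eq)
    then show ?thesis using mean by (simp add: field_mean_def)
  qed
  moreover have "N2.expectation (\<Theta> z) = M0.expectation (\<Theta>\<^sub>0 0)" for z
  proof -
    have "N2.expectation (\<Theta> z) = integral\<^sup>L (distr N2 borel (\<Theta> z)) (\<lambda>x. x)" by (subst integral_distr) auto
    also have "distr N2 borel (\<Theta> z) = distr M\<^sub>0 borel (\<Theta>\<^sub>0 0)"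
      using checkerboard unfolding marg2 random_checkerboard_def by blast
    also have "integral\<^sup>L \<dots> (\<lambda>x. x) = M0.expectation (\<Theta>\<^sub>0 0)" by (subst integral_distr) auto
    finally show ?thesis .
  qed
  ultimately have E\<Theta>: "N2.expectation (\<Theta> z) = 1" for z by simp
  define M where "M = U.N \<Otimes>\<^sub>M N2"
  define S where "S = (\<lambda>x (\<omega> :: (real \<Rightarrow> real) \<times> (int^'d \<Rightarrow> real)). stripe_field h x (fst \<omega>))"
  define \<Theta>' where "\<Theta>' = (\<lambda>z (\<omega> :: (real \<Rightarrow> real) \<times> (int^'d \<Rightarrow> real)). \<Theta> z (snd \<omega>))"
  have field: "product_field i\<^sub>1 S \<Theta>' y \<omega> = cellwise (\<lambda>z. stripe h (fst \<omega>) (z $ i\<^sub>1) * \<Theta> z (snd \<omega>)) y" for y \<omega>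
    unfolding S_def \<Theta>'_def by (rule product_field_cellwise)
  have ergodic: "stationary_ergodic_field M S"
    unfolding M_def S_def
    by (rule stationary_ergodic_field_fst[OF U.stripe_field_stationary_ergodic N2.prob_space_axioms U.stripe_field_measurable_path])
  have law: "distr M (PiM UNIV (\<lambda>_. borel)) (\<lambda>\<omega> z. \<Theta>' z \<omega>) = distr M\<^sub>0 (PiM UNIV (\<lambda>_. borel)) (\<lambda>\<omega> z. \<Theta>\<^sub>0 z \<omega>)"
  proof -
    have "distr M (PiM UNIV (\<lambda>_. borel)) (\<lambda>\<omega> z. \<Theta>' z \<omega>) = distr (distr M N2 snd) (PiM UNIV (\<lambda>_. borel)) (\<lambda>t z. \<Theta> z t)"
      unfolding M_def \<Theta>'_def by (subst distr_distr) (auto simp: comp_def intro!: measurable_PiM_single')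
    also have "distr M N2 snd = N2"
      unfolding M_def by (rule distr_pair_snd_prob[OF U.P.P.prob_space_axioms N2.prob_space_axioms])
    also note law2
    also note N2_def
    finally show ?thesis .
  qed
  have checker: "random_checkerboard M \<Theta>'"
    by (rule random_checkerboard_same_law(2)[OF checkerboard _ _ law])
      (auto simp: M_def \<Theta>'_def N12.P.prob_space_axioms)
  define \<mu> where "\<mu> = U.P.expectation (\<lambda>s. stripe h s 0)"
  have \<mu>: "1 < \<mu>" unfolding \<mu>_def by (rule expectation_stripe_gt_1)
  \<comment> \<open>Inside a cell the field is a product of a function of each component, and the
    checkerboard has mean 1, so its mean is that of the stripe. On faces it would be 0; these form a
    null set, which homogeneity of the mean tolerates.\<close>
  have E: "prob_space.expectation M (product_field i\<^sub>1 S \<Theta>' y) = \<mu>" if "y \<in> unit_cell (cell_index y)" for y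
  proof -
    let ?z = "cell_index y"
    have int: "integrable (U.N \<Otimes>\<^sub>M N2) (\<lambda>\<omega>. stripe h (fst \<omega>) (?z $ i\<^sub>1) * \<Theta> ?z (snd \<omega>))"
    proof (rule N12.P.integrable_const_bound[of _ "2 * max a b"])
      show "AE \<omega> in U.N \<Otimes>\<^sub>M N2. norm (stripe h (fst \<omega>) (?z $ i\<^sub>1) * \<Theta> ?z (snd \<omega>)) \<le> 2 * max a b"
      proof (rule AE_I2)
        fix \<omega> :: "(real \<Rightarrow> real) \<times> (int^'d \<Rightarrow> real)"
        have "\<bar>stripe h (fst \<omega>) (?z $ i\<^sub>1)\<bar> \<le> 2" using stripe_range[of h "fst \<omega>" "?z $ i\<^sub>1"] by auto
        moreover have "\<bar>\<Theta> ?z (snd \<omega>)\<bar> \<le> max a b" using \<Theta>b[of ?z "snd \<omega>"] by linarith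
        ultimately show "norm (stripe h (fst \<omega>) (?z $ i\<^sub>1) * \<Theta> ?z (snd \<omega>)) \<le> 2 * max a b"
          unfolding real_norm_def abs_mult by (intro mult_mono) auto
      qed
    qed measurable
    have "prob_space.expectation M (product_field i\<^sub>1 S \<Theta>' y) =
        N12.P.expectation (\<lambda>\<omega>. stripe h (fst \<omega>) (?z $ i\<^sub>1) * \<Theta> ?z (snd \<omega>))"
      unfolding M_def using that by (intro Bochner_Integration.integral_cong) (auto simp: field cellwise_def)
    also have "\<dots> = U.P.expectation (\<lambda>s. N2.expectation (\<lambda>t. stripe h s (?z $ i\<^sub>1) * \<Theta> ?z t))"
      using N12.integral_fst'[OF int] by simp
    also have "\<dots> = \<mu>" by (simp add: E\<Theta> \<mu>_def expectation_stripe[of "?z $ i\<^sub>1"])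
    finally show ?thesis .
  qed
  have "(0 :: real^'d) \<in> unit_cell (cell_index 0)" by (simp add: mem_unit_cell cell_index_def)
  from E[OF this] have fm: "field_mean M (product_field i\<^sub>1 S \<Theta>') = \<mu>" by (simp add: field_mean_def)
  have hom: "mean_homogeneous M (product_field i\<^sub>1 S \<Theta>')"
    unfolding mean_homogeneous_def fm using AE_unit_cell by eventually_elim (rule E)
  have ess: "ess_inf_field M S = 1"
    unfolding M_def S_def by (rule ess_inf_stripe_field[OF N2.prob_space_axioms])
  have gap: "sigma_W W * sqrt (ess_inf_field M S) < sigma_bar W M (product_field i\<^sub>1 S \<Theta>')"
    unfolding sigma_bar_def fm ess using sigma_W_pos[OF W] \<mu> by (intro mult_strict_left_mono) auto
  have asymp: "asymptotically_le_in_prob M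
      (\<lambda>\<epsilon> \<omega>. ennreal (1 / \<rho> ^ (CARD('d) - 1)) *
         surface_tension W q (\<lambda>y. product_field i\<^sub>1 S \<Theta>' y \<omega>) \<epsilon> (\<delta> \<epsilon>) (axis i\<^sub>1 1) (cube \<rho>))
      (sigma_W W * sqrt (ess_inf_field M S))"
    if \<delta>: "\<forall>\<epsilon>>0. \<delta> \<epsilon> > 0" "((\<lambda>\<epsilon>. \<delta> \<epsilon> / \<epsilon>) \<longlongrightarrow> 0) (at_right 0)"
      "Liminf (at_right 0) (\<lambda>\<epsilon>. ereal (\<epsilon> powr (- \<gamma>) * \<delta> \<epsilon>)) > 0" and "\<rho> > 0" for \<delta> \<rho>
  proof -
    have "(\<lambda>y. product_field i\<^sub>1 S \<Theta>' y \<omega>) = cellwise (\<lambda>z. stripe h (fst \<omega>) (z $ i\<^sub>1) * \<Theta> z (snd \<omega>))" for \<omega>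
      by (simp add: fun_eq_iff field)
    moreover have "asymptotically_le_in_prob (U.N \<Otimes>\<^sub>M N2)
      (\<lambda>\<epsilon> \<omega>. ennreal (1 / \<rho> ^ (CARD('d) - 1)) *
        surface_tension W q (cellwise (\<lambda>z. stripe h (fst \<omega>) (z $ i\<^sub>1) * \<Theta> z (snd \<omega>))) \<epsilon> (\<delta> \<epsilon>) (axis i\<^sub>1 1) (cube \<rho>))
      (sigma_W W)"
    proof (rule surface_tension_asymptotically_le[OF W q N2.prob_space_axioms indep2 \<Theta>b E\<Theta> _ \<delta>(2) _ \<open>\<rho> > 0\<close>])
      show "0 < \<delta> \<epsilon>" if "0 < \<epsilon>" for \<epsilon> using \<delta>(1) that by blast
      show "filterlim (\<lambda>\<epsilon>. (2 * real (nat \<lfloor>r / (2 * \<delta> \<epsilon>)\<rfloor>) + 1) * h (int (nat \<lceil>K * \<epsilon> / \<delta> \<epsilon> + 1\<rceil>))) at_top (at_right 0)"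
        if "0 \<le> K" "0 < r" for K r
        unfolding h_def by (rule expected_number_of_stripes_at_top[OF gamma c that _ \<delta>(2,3)]) (use \<delta>(1) in blast)
    qed
    ultimately show ?thesis unfolding ess unfolding M_def by simp
  qed
  show ?thesis
    using ergodic checker law hom asymp gap by blast
qed

end
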